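(* Let $A$ be a ring and let $B$ be a finite \'etale $A$-algebra. Let $A_0\subset A$ be a subring with an ideal $I_0\subset A_0$. Let $B_0$ be an $A_0$-subalgebra of $B$ such that $B=\bigcup_{n\ge 1}(B_0:_B I_0^n)$. Assume that there exists an integer $c>0$ such that $\mathrm{Tr}_{B/A}(tm)\in A_0$ for every $t\in I_0^c$ and every $m\in B_0$. Then: (1) If $A_0$ is $I_0$-adically separated, then $B_0$ is $I_0$-adically separated. (2) If $A_0$ is $I_0$-adically complete, then $B_0$ is $I_0$-adically complete.
   Context: All rings are commutative with unity. $(B_0:_B I_0^n)=\{b\in B : I_0^n b\subset B_0\}$. For a finite projective ring extension $A\to B$ (in particular a finite \'etale one), $\mathrm{Tr}_{B/A}:B\to A$ denotes the trace map. An $A_0$-module $M$ is $I_0$-adically separated if $\bigcap_{n}I_0^nM=0$, and $I_0$-adically complete if every Cauchy sequence for the topology with fundamental system of neighborhoods of $0$ given by $\{I_0^nM\}_{n\ge1}$ converges in $M$ (separatedness is not part of completeness). The ideal $I_0$ is not assumed to be finitely generated. *)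

theory Defs
  imports "HOL-Algebra.Free_Abelian_Groups" "HOL-Algebra.Module" "HOL-Algebra.Generated_Groups"
    "HOL-Algebra.Subrings" "HOL-Algebra.Ideal_Product"
begin

text \<open>
  An algebra over a commutative ring is given by the library locale \<^locale>\<open>algebra\<close>; the structure map
  is \<open>a \<mapsto> a \<odot> \<one>\<close>, which need not be injective, and zero rings are allowed.
\<close>

definition regular_module :: "('a, 'm) ring_scheme \<Rightarrow> ('a, 'a) module" where
  "regular_module R = \<lparr>carrier = carrier R, mult = mult R, one = one R,
     zero = zero R, add = add R, smult = mult R\<rparr>"

definition linear_maps ::
    "('r, 'm) ring_scheme \<Rightarrow> ('r, 'a, 'k) module_scheme \<Rightarrow> ('r, 'b, 'l) module_scheme \<Rightarrow> ('a \<Rightarrow> 'b) set" where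
  "linear_maps R M N = {h \<in> hom (add_monoid M) (add_monoid N).
     \<forall>a \<in> carrier R. \<forall>x \<in> carrier M. h (a \<odot>\<^bsub>M\<^esub> x) = a \<odot>\<^bsub>N\<^esub> h x}"

definition module_span ::
    "('r, 'm) ring_scheme \<Rightarrow> ('r, 'a, 'k) module_scheme \<Rightarrow> 'a set \<Rightarrow> 'a set" where
  "module_span R M S = \<Inter> {H. submodule H R M \<and> S \<subseteq> H}"

text \<open>The free module on \<open>S\<close>: finitely supported functions. The fields \<^const>\<open>mult\<close> and \<^const>\<open>one\<close>,
  present in every module record, carry no information here.\<close>

definition free_module :: "('r, 'm) ring_scheme \<Rightarrow> 'i set \<Rightarrow> ('r, 'i \<Rightarrow> 'r) module" where
  "free_module R S = \<lparr>
     carrier = {f. (\<forall>i \<in> S. f i \<in> carrier R) \<and> (\<forall>i. i \<notin> S \<longrightarrow> f i = \<zero>\<^bsub>R\<^esub>) \<and> finite {i. f i \<noteq> \<zero>\<^bsub>R\<^esub>}},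
     mult = undefined, one = undefined,
     zero = (\<lambda>i. \<zero>\<^bsub>R\<^esub>), add = (\<lambda>f g i. f i \<oplus>\<^bsub>R\<^esub> g i), smult = (\<lambda>a f i. a \<otimes>\<^bsub>R\<^esub> f i)\<rparr>"

definition free_gen :: "('r, 'm) ring_scheme \<Rightarrow> 'i \<Rightarrow> 'i \<Rightarrow> 'r" where
  "free_gen R i = (\<lambda>j. if j = i then \<one>\<^bsub>R\<^esub> else \<zero>\<^bsub>R\<^esub>)"

definition finitely_presented_module ::
    "('r, 'm) ring_scheme \<Rightarrow> ('r, 'a, 'k) module_scheme \<Rightarrow> bool" where
  "finitely_presented_module R M \<longleftrightarrow>
     (\<exists>(n::nat). \<exists>h \<in> linear_maps R (free_module R {..<n}) M.
        h ` carrier (free_module R {..<n}) = carrier M \<and>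
        (\<exists>G. finite G \<and> G \<subseteq> carrier (free_module R {..<n}) \<and>
           a_kernel (free_module R {..<n}) M h = module_span R (free_module R {..<n}) G))"

definition tensor_relations ::
    "('r, 'm) ring_scheme \<Rightarrow> ('r, 'a, 'k) module_scheme \<Rightarrow> ('r, 'b, 'l) module_scheme
      \<Rightarrow> ('a \<times> 'b \<Rightarrow>\<^sub>0 int) set" where
  "tensor_relations R N M = generate (free_Abelian_group (carrier N \<times> carrier M))
     ({frag_of (x \<oplus>\<^bsub>N\<^esub> y, m) - (frag_of (x, m) + frag_of (y, m)) | x y m.
         x \<in> carrier N \<and> y \<in> carrier N \<and> m \<in> carrier M} \<union>
      {frag_of (x, m \<oplus>\<^bsub>M\<^esub> m') - (frag_of (x, m) + frag_of (x, m')) | x m m'.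
         x \<in> carrier N \<and> m \<in> carrier M \<and> m' \<in> carrier M} \<union>
      {frag_of (a \<odot>\<^bsub>N\<^esub> x, m) - frag_of (x, a \<odot>\<^bsub>M\<^esub> m) | a x m.
         a \<in> carrier R \<and> x \<in> carrier N \<and> m \<in> carrier M})"

definition tensor_product ::
    "('r, 'm) ring_scheme \<Rightarrow> ('r, 'a, 'k) module_scheme \<Rightarrow> ('r, 'b, 'l) module_scheme
      \<Rightarrow> ('a \<times> 'b \<Rightarrow>\<^sub>0 int) set monoid" where
  "tensor_product R N M =
     free_Abelian_group (carrier N \<times> carrier M) Mod tensor_relations R N M"

text \<open>
  \<open>M\<close> is flat if \<open>H \<otimes> M \<rightarrow> N \<otimes> M\<close> is injective for every submodule \<open>H\<close> of a module \<open>N\<close>. The map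
  induced by the inclusion sends the class of \<open>z\<close> modulo the relations of \<open>H \<otimes> M\<close> to the class of
  \<open>z\<close> modulo the larger group of relations of \<open>N \<otimes> M\<close>. A definition cannot quantify over types, so \<open>N\<close> has
  carrier type \<open>(nat \<Rightarrow> 'r) set\<close>: up to isomorphism this covers all countably generated modules
  (as sets of cosets in a countable free module), and finitely generated \<open>N\<close> already suffice for
  flatness.
\<close>

definition flat_module :: "('r, 'm) ring_scheme \<Rightarrow> ('r, 'a, 'k) module_scheme \<Rightarrow> bool" where
  "flat_module R M \<longleftrightarrow>
     (\<forall>(N :: ('r, (nat \<Rightarrow> 'r) set) module) H. module R N \<and> submodule H R N \<longrightarrow>
        inj_on (\<lambda>X. tensor_relations R N M <#>\<^bsub>free_Abelian_group (carrier N \<times> carrier M)\<^esub> X)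
          (carrier (tensor_product R (N\<lparr>carrier := H\<rparr>) M)))"

text \<open>Kaehler differentials: the free \<open>B\<close>-module on symbols \<open>d b\<close> (here \<^term>\<open>free_gen B b\<close>) modulo
  additivity, the Leibniz rule and \<open>d (a \<cdot> 1) = 0\<close>; only the additive group of the quotient is kept.\<close>

definition kaehler_relations ::
    "('a, 'm) ring_scheme \<Rightarrow> ('a, 'b, 'k) module_scheme \<Rightarrow> ('b \<Rightarrow> 'b) set" where
  "kaehler_relations A B = (let F = free_module B (carrier B); d = free_gen B in
     module_span B F
      ({d (x \<oplus>\<^bsub>B\<^esub> y) \<ominus>\<^bsub>F\<^esub> (d x \<oplus>\<^bsub>F\<^esub> d y) | x y. x \<in> carrier B \<and> y \<in> carrier B} \<union>
       {d (x \<otimes>\<^bsub>B\<^esub> y) \<ominus>\<^bsub>F\<^esub> ((x \<odot>\<^bsub>F\<^esub> d y) \<oplus>\<^bsub>F\<^esub> (y \<odot>\<^bsub>F\<^esub> d x)) | x y. x \<in> carrier B \<and> y \<in> carrier B} \<union>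
       {d (a \<odot>\<^bsub>B\<^esub> \<one>\<^bsub>B\<^esub>) | a. a \<in> carrier A}))"

definition kaehler_differentials ::
    "('a, 'm) ring_scheme \<Rightarrow> ('a, 'b, 'k) module_scheme \<Rightarrow> ('b \<Rightarrow> 'b) set monoid" where
  "kaehler_differentials A B = free_module B (carrier B) A_Mod kaehler_relations A B"

definition formally_unramified ::
    "('a, 'm) ring_scheme \<Rightarrow> ('a, 'b, 'k) module_scheme \<Rightarrow> bool" where
  "formally_unramified A B \<longleftrightarrow>
     carrier (kaehler_differentials A B) = {\<one>\<^bsub>kaehler_differentials A B\<^esub>}"

text \<open>Finite etale means flat, unramified and finitely presented as a module (cf. Gabber and Ramero,
  "Almost ring theory"; unramified is stated through differentials). For a module-finite algebra, finite
  presentation as an algebra and as a module agree (EGA IV, 1.4.7), so this is "finite and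
  etale".\<close>

definition finite_etale ::
    "('a, 'm) ring_scheme \<Rightarrow> ('a, 'b, 'k) module_scheme \<Rightarrow> bool" where
  "finite_etale A B \<longleftrightarrow> algebra A B \<and> finitely_presented_module A B \<and> flat_module A B \<and>
     formally_unramified A B"

definition dual_basis ::
    "('r, 'm) ring_scheme \<Rightarrow> ('r, 'a, 'k) module_scheme \<Rightarrow> nat \<Rightarrow> (nat \<Rightarrow> 'a) \<Rightarrow> (nat \<Rightarrow> 'a \<Rightarrow> 'r) \<Rightarrow> bool" where
  "dual_basis R M n x f \<longleftrightarrow>
     (\<forall>i<n. x i \<in> carrier M \<and> f i \<in> linear_maps R M (regular_module R)) \<and>
     (\<forall>m \<in> carrier M. m = (\<Oplus>\<^bsub>M\<^esub>i\<in>{..<n}. f i m \<odot>\<^bsub>M\<^esub> x i))"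

text \<open>A module is finite projective iff it has a dual basis in the sense above. The endomorphism \<open>u\<close> then
  corresponds to \<open>\<Sum> f\<^sub>i \<otimes> u x\<^sub>i\<close> under \<open>End M \<cong> M\<^sup>* \<otimes> M\<close>, and the trace is its image under evaluation;
  it does not depend on the dual basis. The value is unspecified if \<open>M\<close> is not finite
  projective.\<close>

definition endo_trace ::
    "('r, 'm) ring_scheme \<Rightarrow> ('r, 'a, 'k) module_scheme \<Rightarrow> ('a \<Rightarrow> 'a) \<Rightarrow> 'r" where
  "endo_trace R M u =
     (THE t. \<exists>n x f. dual_basis R M n x f \<and> t = (\<Oplus>\<^bsub>R\<^esub>i\<in>{..<n}. f i (u (x i))))"

definition algebra_trace ::
    "('a, 'm) ring_scheme \<Rightarrow> ('a, 'b, 'k) module_scheme \<Rightarrow> 'b \<Rightarrow> 'a" where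
  "algebra_trace A B b = endo_trace A B (\<lambda>x. b \<otimes>\<^bsub>B\<^esub> x)"

definition ideal_power :: "('a, 'm) ring_scheme \<Rightarrow> 'a set \<Rightarrow> nat \<Rightarrow> 'a set" where
  "ideal_power R I n = I [^]\<^bsub>ideals_set R\<^esub> n"

definition ideal_power_smult ::
    "('r, 'm) ring_scheme \<Rightarrow> 'r set \<Rightarrow> nat \<Rightarrow> ('r, 'a, 'k) module_scheme \<Rightarrow> 'a set" where
  "ideal_power_smult R I n M =
     module_span R M {t \<odot>\<^bsub>M\<^esub> x | t x. t \<in> ideal_power R I n \<and> x \<in> carrier M}"

definition adically_separated ::
    "('r, 'm) ring_scheme \<Rightarrow> 'r set \<Rightarrow> ('r, 'a, 'k) module_scheme \<Rightarrow> bool" where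
  "adically_separated R I M \<longleftrightarrow> (\<Inter>n\<in>{1..}. ideal_power_smult R I n M) = {\<zero>\<^bsub>M\<^esub>}"

definition adically_Cauchy ::
    "('r, 'm) ring_scheme \<Rightarrow> 'r set \<Rightarrow> ('r, 'a, 'k) module_scheme \<Rightarrow> (nat \<Rightarrow> 'a) \<Rightarrow> bool" where
  "adically_Cauchy R I M s \<longleftrightarrow>
     (\<forall>n\<ge>1. \<exists>k. \<forall>i\<ge>k. \<forall>j\<ge>k. s i \<ominus>\<^bsub>M\<^esub> s j \<in> ideal_power_smult R I n M)"

definition adically_converges ::
    "('r, 'm) ring_scheme \<Rightarrow> 'r set \<Rightarrow> ('r, 'a, 'k) module_scheme \<Rightarrow> (nat \<Rightarrow> 'a) \<Rightarrow> 'a \<Rightarrow> bool" where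
  "adically_converges R I M s x \<longleftrightarrow>
     (\<forall>n\<ge>1. \<exists>k. \<forall>i\<ge>k. s i \<ominus>\<^bsub>M\<^esub> x \<in> ideal_power_smult R I n M)"

text \<open>Completeness does not include separatedness: limits need not be unique.\<close>

definition adically_complete ::
    "('r, 'm) ring_scheme \<Rightarrow> 'r set \<Rightarrow> ('r, 'a, 'k) module_scheme \<Rightarrow> bool" where
  "adically_complete R I M \<longleftrightarrow>
     (\<forall>s. range s \<subseteq> carrier M \<and> adically_Cauchy R I M s \<longrightarrow>
        (\<exists>x \<in> carrier M. adically_converges R I M s x))"

definition module_colon ::
    "('r, 'a, 'k) module_scheme \<Rightarrow> 'a set \<Rightarrow> 'r set \<Rightarrow> 'a set" where
  "module_colon M N J = {x \<in> carrier M. \<forall>t \<in> J. t \<odot>\<^bsub>M\<^esub> x \<in> N}"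

end

theory Submission
  imports Defs
begin

text \<open>
  A finitely presented flat module is projective, so \<open>B\<close> has a dual basis \<open>e\<^sub>l, f\<^sub>l\<close> over \<open>A\<close>. Let \<open>J\<close> be the
  kernel of the multiplication \<open>B \<otimes> B \<rightarrow> B\<close>. Vanishing differentials mean \<open>J = J\<^sup>2\<close>, and since \<open>J\<close> is
  finitely generated, some \<open>\<epsilon> = \<Sum> x\<^sub>i \<otimes> y\<^sub>i \<in> 1 + J\<close> annihilates \<open>J\<close>. Applying \<open>1 \<otimes> f\<^sub>l\<close> to
  \<open>(1 \<otimes> b e\<^sub>l) \<epsilon> = (b e\<^sub>l \<otimes> 1) \<epsilon>\<close> and summing over \<open>l\<close> gives \<open>b = \<Sum> Tr (y\<^sub>i b) x\<^sub>i\<close> for all \<open>b\<close>.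
  Some \<open>I\<^sub>0\<^sup>N\<close> multiplies all \<open>x\<^sub>i\<close> and \<open>y\<^sub>i\<close> into \<open>B\<^sub>0\<close>, hence \<open>b \<in> I\<^sub>0\<^bsup>N + c + n\<^esup> B\<^sub>0\<close> implies
  \<open>Tr (y\<^sub>i b) \<in> I\<^sub>0\<^sup>n\<close>, and \<open>a \<in> I\<^sub>0\<^bsup>N + n\<^esup>\<close> implies \<open>a x\<^sub>i \<in> I\<^sub>0\<^sup>n B\<^sub>0\<close>: up to a shift, the coordinates
  \<open>Tr (y\<^sub>i b)\<close> compare the two adic topologies.
\<close>

section \<open>Finite sums and linear maps\<close>

text \<open>The tensor product of the definitions is only a group, while the Nakayama argument needs
  a commutative ring containing \<open>b \<otimes> 1\<close> and \<open>1 \<otimes> b\<close>. The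
  passage from vanishing differentials to an annihilator of \<open>J\<close> works for any
  commutative ring with two homomorphisms from \<open>B\<close> that agree on scalars from
  \<open>A\<close>. Operators on the \<open>A\<close>-linear endomorphisms of \<open>B\<close> form
  such a ring, and evaluating them at suitable endomorphisms yields the identities about
  \<open>\<epsilon>\<close>: at the identity it is the multiplication
  \<open>B \<otimes> B \<rightarrow> B\<close>, at \<open>c \<mapsto> g c \<odot> 1\<close> it is
  \<open>1 \<otimes> g\<close>. The shift of the adic filtration has two sources: \<open>N\<close>
  is spent because \<open>x i\<close> and \<open>y i\<close> lie in \<open>B\<close> and not in
  \<open>B0\<close>, and \<open>c\<close> because the trace is known to take values in
  \<open>A0\<close> only after multiplication by the \<open>c\<close>-th power of \<open>I0\<close>.
  For the same reason the coordinates of a Cauchy sequence need not lie in \<open>A0\<close>; the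
  sequence is therefore translated by one of its late terms before limits are taken in
  \<open>A0\<close>. The limit is then built in \<open>B\<close>, and its membership in
  \<open>B0\<close> is recovered from the convergence itself.\<close>

context abelian_monoid
begin

lemma finsum_swap:
  assumes "finite X" "finite Y" "\<And>x y. \<lbrakk>x \<in> X; y \<in> Y\<rbrakk> \<Longrightarrow> f x y \<in> carrier G"
  shows "(\<Oplus>x\<in>X. \<Oplus>y\<in>Y. f x y) = (\<Oplus>y\<in>Y. \<Oplus>x\<in>X. f x y)"
  using assms(1,3)
proof (induction X rule: finite_induct)
  case (insert x X)
  have "(\<Oplus>y\<in>Y. \<Oplus>x\<in>insert x X. f x y) = (\<Oplus>y\<in>Y. f x y \<oplus> (\<Oplus>x\<in>X. f x y))"
    using insert by (intro finsum_cong') (auto simp: finsum_insert Pi_def)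
  then show ?case
    using insert by (simp add: finsum_insert finsum_addf Pi_def)
qed (simp add: finsum_empty finsum_zero)

lemma finsum_lessThan_Suc:
  fixes n :: nat
  assumes "\<And>i. i \<le> n \<Longrightarrow> f i \<in> carrier G"
  shows "(\<Oplus>i\<in>{..<Suc n}. f i) = (\<Oplus>i\<in>{..<n}. f i) \<oplus> f n"
  using assms by (simp add: lessThan_Suc finsum_insert Pi_def a_comm)

lemma finsum_append:
  fixes p q :: nat
  assumes "\<And>l. l < p \<Longrightarrow> f l \<in> carrier G" "\<And>l. l < q \<Longrightarrow> g l \<in> carrier G"
  shows "(\<Oplus>l\<in>{..<p + q}. if l < p then f l else g (l - p)) =
    (\<Oplus>l\<in>{..<p}. f l) \<oplus> (\<Oplus>l\<in>{..<q}. g l)"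
  using assms(2)
proof (induction q)
  case 0
  have "(\<Oplus>l\<in>{..<p}. if l < p then f l else g (l - p)) = (\<Oplus>l\<in>{..<p}. f l)"
    using assms(1) by (intro finsum_cong') auto
  then show ?case
    using assms(1) by (simp add: finsum_empty Pi_def)
next
  case (Suc q)
  have "(\<Oplus>l\<in>{..<Suc (p + q)}. if l < p then f l else g (l - p)) =
      (\<Oplus>l\<in>{..<p + q}. if l < p then f l else g (l - p)) \<oplus> g q"
    by (subst finsum_lessThan_Suc) (use assms(1) Suc.prems in auto)
  then show ?case
    using Suc assms(1) by (simp add: finsum_lessThan_Suc a_assoc Pi_def)
qed

lemma finsum_delta:
  assumes "finite X" "i \<in> X" "x \<in> carrier G"
  shows "(\<Oplus>j\<in>X. if j = i then x else \<zero>) = x"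
  using finsum_singleton[OF assms(2,1), of "\<lambda>_. x"] assms(3) by (simp add: Pi_def eq_commute)

end

lemma (in abelian_group) minus_eq_zero_iff:
  assumes "x \<in> carrier G" "y \<in> carrier G"
  shows "x \<ominus> y = \<zero> \<longleftrightarrow> x = y"
  using minus_equality[of x "\<ominus> y"] assms by (auto simp: a_minus_def r_neg)

text \<open>Additivity alone suffices, which matters for the map \<open>d\<close> below: its target
  is a ring without a scalar multiplication by \<open>A\<close>.\<close>

lemma additive_finsum:
  assumes "abelian_group G" "abelian_group H" "h \<in> hom (add_monoid G) (add_monoid H)"
    and "finite X" "f \<in> X \<rightarrow> carrier G"
  shows "h (\<Oplus>\<^bsub>G\<^esub>i\<in>X. f i) = (\<Oplus>\<^bsub>H\<^esub>i\<in>X. h (f i))"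
proof -
  interpret G: abelian_group G by fact
  interpret H: abelian_group H by fact
  interpret h: group_hom "add_monoid G" "add_monoid H" h
    using assms(3) G.a_group H.a_group by (simp add: group_hom_def group_hom_axioms_def)
  have hG: "x \<in> carrier G \<Longrightarrow> h x \<in> carrier H" for x
    using h.hom_closed by simp
  show ?thesis
    using assms(4,5)
  proof (induction X rule: finite_induct)
    case empty
    show ?case
      using h.hom_one by (simp add: G.finsum_empty H.finsum_empty)
  next
    case (insert x X)
    have "finsum G f X \<in> carrier G" "f x \<in> carrier G"
      using insert.prems by (auto intro: G.finsum_closed)
    then show ?case
      using insert h.hom_mult[of "f x" "finsum G f X"] hG
      by (simp add: G.finsum_insert H.finsum_insert Pi_def)
  qed
qed

lemma linear_mapsI:
  assumes "\<And>x. x \<in> carrier M \<Longrightarrow> h x \<in> carrier N"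
    and "\<And>x y. \<lbrakk>x \<in> carrier M; y \<in> carrier M\<rbrakk> \<Longrightarrow> h (x \<oplus>\<^bsub>M\<^esub> y) = h x \<oplus>\<^bsub>N\<^esub> h y"
    and "\<And>a x. \<lbrakk>a \<in> carrier R; x \<in> carrier M\<rbrakk> \<Longrightarrow> h (a \<odot>\<^bsub>M\<^esub> x) = a \<odot>\<^bsub>N\<^esub> h x"
  shows "h \<in> linear_maps R M N"
  using assms by (auto simp: linear_maps_def hom_def)

lemma linear_mapsD:
  assumes "h \<in> linear_maps R M N"
  shows "x \<in> carrier M \<Longrightarrow> h x \<in> carrier N"
    and "\<lbrakk>x \<in> carrier M; y \<in> carrier M\<rbrakk> \<Longrightarrow> h (x \<oplus>\<^bsub>M\<^esub> y) = h x \<oplus>\<^bsub>N\<^esub> h y"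
    and "\<lbrakk>a \<in> carrier R; x \<in> carrier M\<rbrakk> \<Longrightarrow> h (a \<odot>\<^bsub>M\<^esub> x) = a \<odot>\<^bsub>N\<^esub> h x"
  using assms by (auto simp: linear_maps_def hom_def)

lemma linear_maps_zero:
  assumes "module R M" "module R N" "h \<in> linear_maps R M N"
  shows "h \<zero>\<^bsub>M\<^esub> = \<zero>\<^bsub>N\<^esub>"
proof -
  interpret M: module R M by fact
  interpret N: module R N by fact
  have "h (\<zero>\<^bsub>R\<^esub> \<odot>\<^bsub>M\<^esub> \<zero>\<^bsub>M\<^esub>) = \<zero>\<^bsub>R\<^esub> \<odot>\<^bsub>N\<^esub> h \<zero>\<^bsub>M\<^esub>"
    using linear_mapsD(3)[OF assms(3)] by blast
  then show ?thesis
    using linear_mapsD(1)[OF assms(3), of "\<zero>\<^bsub>M\<^esub>"] by simp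
qed

lemma linear_maps_minus:
  assumes "module R M" "module R N" "h \<in> linear_maps R M N" "x \<in> carrier M"
  shows "h (\<ominus>\<^bsub>M\<^esub> x) = \<ominus>\<^bsub>N\<^esub> h x"
proof -
  interpret M: module R M by fact
  interpret N: module R N by fact
  have "h (\<ominus>\<^bsub>M\<^esub> x) \<oplus>\<^bsub>N\<^esub> h x = h (\<ominus>\<^bsub>M\<^esub> x \<oplus>\<^bsub>M\<^esub> x)"
    using linear_mapsD(2)[OF assms(3)] assms(4) by simp
  also have "\<dots> = \<zero>\<^bsub>N\<^esub>"
    using linear_maps_zero[OF assms(1-3)] assms(4) by (simp add: M.l_neg)
  finally show ?thesis
    using linear_mapsD(1)[OF assms(3)] assms(4) by (simp add: N.minus_equality)
qed

lemma linear_maps_finsum: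
  assumes "module R M" "module R N" "h \<in> linear_maps R M N"
    and "finite X" "f \<in> X \<rightarrow> carrier M"
  shows "h (\<Oplus>\<^bsub>M\<^esub>i\<in>X. f i) = (\<Oplus>\<^bsub>N\<^esub>i\<in>X. h (f i))"
  using additive_finsum[OF _ _ _ assms(4,5)] assms(1-3)
  by (auto simp: module_def linear_maps_def)

lemma regular_module_simps [simp]:
  "carrier (regular_module R) = carrier R" "mult (regular_module R) = mult R"
  "one (regular_module R) = one R" "zero (regular_module R) = zero R"
  "add (regular_module R) = add R" "smult (regular_module R) = mult R"
  by (simp_all add: regular_module_def)

lemma finsum_regular_module [simp]: "finsum (regular_module R) f X = finsum R f X"
  by (simp add: finsum_def regular_module_def finprod_def)

lemma (in cring) regular_module_is_module: "module R (regular_module R)"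
proof (intro moduleI)
  show "abelian_group (regular_module R)"
    by (intro abelian_groupI) (auto simp: a_ac intro!: bexI[of _ "\<ominus> _"] l_neg)
qed (simp_all add: is_cring l_distr r_distr m_assoc)

lemma (in module) finsum_smult_rdistr:
  assumes "finite X" "x \<in> carrier M" "f \<in> X \<rightarrow> carrier R"
  shows "(\<Oplus>\<^bsub>R\<^esub>i\<in>X. f i) \<odot>\<^bsub>M\<^esub> x = (\<Oplus>\<^bsub>M\<^esub>i\<in>X. f i \<odot>\<^bsub>M\<^esub> x)"
  using assms(1,3)
proof (induction X rule: finite_induct)
  case (insert i X)
  then show ?case
    using assms(2) by (simp add: R.finsum_insert M.finsum_insert smult_l_distr Pi_def)
qed (simp add: R.finsum_empty M.finsum_empty assms)

lemma linear_maps_image_submodule: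
  assumes "module R M" "module R N" "h \<in> linear_maps R M N"
  shows "submodule (h ` carrier M) R N"
proof -
  interpret M: module R M by fact
  interpret N: module R N by fact
  note lin = linear_mapsD[OF assms(3)]
  show ?thesis
  proof (intro N.submoduleI)
    show "\<zero>\<^bsub>N\<^esub> \<in> h ` carrier M"
      using linear_maps_zero[OF assms] by (intro image_eqI[of _ _ "\<zero>\<^bsub>M\<^esub>"]) auto
    show "h ` carrier M \<subseteq> carrier N"
      using lin(1) by blast
    fix x
    assume "x \<in> h ` carrier M"
    then obtain u where u: "u \<in> carrier M" "x = h u"
      by blast
    show "\<ominus>\<^bsub>N\<^esub> x \<in> h ` carrier M"
      using u linear_maps_minus[OF assms u(1)] by (intro image_eqI[of _ _ "\<ominus>\<^bsub>M\<^esub> u"]) auto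
    show "a \<odot>\<^bsub>N\<^esub> x \<in> h ` carrier M" if "a \<in> carrier R" for a
      using u lin(3)[OF that u(1)] that by (intro image_eqI[of _ _ "a \<odot>\<^bsub>M\<^esub> u"]) auto
    fix y
    assume "y \<in> h ` carrier M"
    then obtain v where v: "v \<in> carrier M" "y = h v"
      by blast
    show "x \<oplus>\<^bsub>N\<^esub> y \<in> h ` carrier M"
      using u v lin(2)[OF u(1) v(1)] by (intro image_eqI[of _ _ "u \<oplus>\<^bsub>M\<^esub> v"]) auto
  qed
qed

lemma (in module) submodule_vimage:
  assumes "module R N" "h \<in> linear_maps R M N" "submodule H R N"
  shows "submodule {x \<in> carrier M. h x \<in> H} R M"
proof -
  interpret N: module R N by fact
  show ?thesis
    using N.submoduleE[OF assms(3)] linear_mapsD[OF assms(2)]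
      linear_maps_zero[OF module_axioms assms(1,2)] linear_maps_minus[OF module_axioms assms(1,2)]
      submodule.axioms(1)[OF assms(3), THEN subgroup.one_closed]
    by (intro submoduleI) auto
qed

lemma (in module) submodule_zero: "submodule {\<zero>\<^bsub>M\<^esub>} R M"
  by (intro submoduleI) auto

lemma module_span_minimal: "\<lbrakk>submodule H R M; S \<subseteq> H\<rbrakk> \<Longrightarrow> module_span R M S \<subseteq> H"
  by (auto simp: module_span_def)

lemma module_span_superset: "S \<subseteq> module_span R M S"
  by (auto simp: module_span_def)

lemma module_span_zero: "\<zero>\<^bsub>M\<^esub> \<in> module_span R M S"
  by (auto simp: module_span_def dest: submodule.axioms(1)[THEN subgroup.one_closed])

lemma (in module) module_span_submodule:
  assumes "S \<subseteq> carrier M"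
  shows "submodule (module_span R M S) R M"
proof (intro submoduleI)
  show "module_span R M S \<subseteq> carrier M"
    using module_span_minimal[OF carrier_is_submodule assms] .
qed (auto simp: module_span_def submoduleE dest: submodule.axioms(1)[THEN subgroup.one_closed])

section \<open>Free modules\<close>

lemma free_module_simps [simp]:
  "zero (free_module R S) = (\<lambda>i. \<zero>\<^bsub>R\<^esub>)"
  "add (free_module R S) = (\<lambda>f g i. f i \<oplus>\<^bsub>R\<^esub> g i)"
  "smult (free_module R S) = (\<lambda>a f i. a \<otimes>\<^bsub>R\<^esub> f i)"
  by (simp_all add: free_module_def)

lemma free_module_carrier:
  "f \<in> carrier (free_module R S) \<longleftrightarrow>
    (\<forall>i\<in>S. f i \<in> carrier R) \<and> (\<forall>i. i \<notin> S \<longrightarrow> f i = \<zero>\<^bsub>R\<^esub>) \<and> finite {i. f i \<noteq> \<zero>\<^bsub>R\<^esub>}"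
  by (simp add: free_module_def)

lemma (in cring) free_module_coeff [simp]:
  "f \<in> carrier (free_module R S) \<Longrightarrow> f i \<in> carrier R"
  by (cases "i \<in> S") (auto simp: free_module_carrier)

lemma (in cring) free_module_is_module: "module R (free_module R S)"
proof (intro moduleI)
  let ?F = "free_module R S"
  have add: "f \<oplus>\<^bsub>?F\<^esub> g \<in> carrier ?F" if "f \<in> carrier ?F" "g \<in> carrier ?F" for f g
  proof -
    have "{i. f i \<oplus> g i \<noteq> \<zero>} \<subseteq> {i. f i \<noteq> \<zero>} \<union> {i. g i \<noteq> \<zero>}"
      by auto
    then have "finite {i. f i \<oplus> g i \<noteq> \<zero>}"
      using that by (elim finite_subset) (simp add: free_module_carrier)
    then show ?thesis
      using that by (simp add: free_module_carrier)
  qed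
  have smult: "a \<odot>\<^bsub>?F\<^esub> f \<in> carrier ?F" if "a \<in> carrier R" "f \<in> carrier ?F" for a f
  proof -
    have "{i. a \<otimes> f i \<noteq> \<zero>} \<subseteq> {i. f i \<noteq> \<zero>}"
      using that by auto
    then have "finite {i. a \<otimes> f i \<noteq> \<zero>}"
      using that by (elim finite_subset) (simp add: free_module_carrier)
    then show ?thesis
      using that by (simp add: free_module_carrier)
  qed
  have neg: "\<exists>g\<in>carrier ?F. g \<oplus>\<^bsub>?F\<^esub> f = \<zero>\<^bsub>?F\<^esub>" if "f \<in> carrier ?F" for f
    using smult[OF _ that, of "\<ominus> \<one>"] that
    by (intro bexI[of _ "(\<ominus> \<one>) \<odot>\<^bsub>?F\<^esub> f"]) (auto simp: l_minus l_neg)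
  show "abelian_group ?F"
  proof (intro abelian_groupI)
    show "\<zero>\<^bsub>?F\<^esub> \<in> carrier ?F"
      by (simp add: free_module_carrier)
  qed (use add neg in \<open>auto simp: a_ac\<close>)
  show "a \<odot>\<^bsub>?F\<^esub> f \<in> carrier ?F" if "a \<in> carrier R" "f \<in> carrier ?F" for a f
    using smult that .
qed (auto simp: is_cring l_distr r_distr m_assoc)

lemma (in cring) free_module_minus:
  assumes "f \<in> carrier (free_module R S)"
  shows "\<ominus>\<^bsub>free_module R S\<^esub> f = (\<lambda>i. \<ominus> f i)"
proof -
  interpret F: module R "free_module R S"
    by (rule free_module_is_module)
  have "(\<ominus> \<one>) \<odot>\<^bsub>free_module R S\<^esub> f = \<ominus>\<^bsub>free_module R S\<^esub> f"
    using F.smult_l_minus[of \<one> f] assms by (simp del: free_module_simps)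
  then show ?thesis
    using assms by (auto simp: l_minus fun_eq_iff)
qed

lemma (in cring) free_gen_closed: "i \<in> S \<Longrightarrow> free_gen R i \<in> carrier (free_module R S)"
  by (auto simp: free_gen_def free_module_carrier)

lemma (in cring) free_module_finsum:
  assumes "finite X" "f \<in> X \<rightarrow> carrier (free_module R S)"
  shows "(\<Oplus>\<^bsub>free_module R S\<^esub>x\<in>X. f x) i = (\<Oplus>x\<in>X. f x i)"
proof -
  interpret F: module R "free_module R S"
    by (rule free_module_is_module)
  have "(\<lambda>f. f i) \<in> linear_maps R (free_module R S) (regular_module R)"
    by (intro linear_mapsI) auto
  from linear_maps_finsum[OF F.module_axioms regular_module_is_module this assms]
  show ?thesis
    by simp
qed

lemma (in cring) free_module_decomp:
  assumes "finite S" "f \<in> carrier (free_module R S)"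
  shows "f = (\<Oplus>\<^bsub>free_module R S\<^esub>i\<in>S. f i \<odot>\<^bsub>free_module R S\<^esub> free_gen R i)"
proof
  fix j
  interpret F: module R "free_module R S"
    by (rule free_module_is_module)
  have "(\<lambda>i. f i \<odot>\<^bsub>free_module R S\<^esub> free_gen R i) \<in> S \<rightarrow> carrier (free_module R S)"
    using assms by (intro funcsetI F.smult_closed free_gen_closed free_module_coeff)
  then have "(\<Oplus>\<^bsub>free_module R S\<^esub>i\<in>S. f i \<odot>\<^bsub>free_module R S\<^esub> free_gen R i) j =
      (\<Oplus>i\<in>S. f i \<otimes> free_gen R i j)"
    using free_module_finsum[OF assms(1)] by simp
  also have "\<dots> = (\<Oplus>i\<in>S. if i = j then f j else \<zero>)"
    using assms by (intro finsum_cong') (auto simp: free_gen_def)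
  also have "\<dots> = f j"
  proof (cases "j \<in> S")
    case True
    then show ?thesis
      using finsum_delta[OF assms(1)] assms(2) by simp
  next
    case False
    then have "f j = \<zero>"
      using assms(2) by (auto simp: free_module_carrier)
    then have "(\<Oplus>i\<in>S. if i = j then f j else \<zero>) = (\<Oplus>i\<in>S. \<zero>)"
      by (intro finsum_cong') auto
    with \<open>f j = \<zero>\<close> show ?thesis
      by (simp add: finsum_zero)
  qed
  finally show "f j = (\<Oplus>\<^bsub>free_module R S\<^esub>i\<in>S. f i \<odot>\<^bsub>free_module R S\<^esub> free_gen R i) j" ..
qed

lemma (in module) free_module_comb_linear:
  assumes "finite S" "m \<in> S \<rightarrow> carrier M"
  shows "(\<lambda>v. \<Oplus>\<^bsub>M\<^esub>j\<in>S. v j \<odot>\<^bsub>M\<^esub> m j) \<in> linear_maps R (free_module R S) M"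
proof -
  have m: "m j \<in> carrier M" if "j \<in> S" for j
    using assms that by auto
  show ?thesis
  proof (intro linear_mapsI)
    fix a b assume "a \<in> carrier (free_module R S)" "b \<in> carrier (free_module R S)"
    then have ab: "a j \<in> carrier R" "b j \<in> carrier R" for j
      by (auto intro: free_module_coeff)
    have "(\<Oplus>\<^bsub>M\<^esub>j\<in>S. (a \<oplus>\<^bsub>free_module R S\<^esub> b) j \<odot>\<^bsub>M\<^esub> m j) =
        (\<Oplus>\<^bsub>M\<^esub>j\<in>S. a j \<odot>\<^bsub>M\<^esub> m j \<oplus>\<^bsub>M\<^esub> b j \<odot>\<^bsub>M\<^esub> m j)"
      using ab m assms(1) by (intro M.finsum_cong') (auto simp: smult_l_distr)
    then show "(\<Oplus>\<^bsub>M\<^esub>j\<in>S. (a \<oplus>\<^bsub>free_module R S\<^esub> b) j \<odot>\<^bsub>M\<^esub> m j) =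
        (\<Oplus>\<^bsub>M\<^esub>j\<in>S. a j \<odot>\<^bsub>M\<^esub> m j) \<oplus>\<^bsub>M\<^esub> (\<Oplus>\<^bsub>M\<^esub>j\<in>S. b j \<odot>\<^bsub>M\<^esub> m j)"
      using ab m assms(1) by (simp add: M.finsum_addf Pi_def)
  next
    fix r a assume "r \<in> carrier R" "a \<in> carrier (free_module R S)"
    then have ra: "r \<in> carrier R" "a j \<in> carrier R" for j
      by (auto intro: free_module_coeff)
    have "(\<Oplus>\<^bsub>M\<^esub>j\<in>S. (r \<odot>\<^bsub>free_module R S\<^esub> a) j \<odot>\<^bsub>M\<^esub> m j) = (\<Oplus>\<^bsub>M\<^esub>j\<in>S. r \<odot>\<^bsub>M\<^esub> (a j \<odot>\<^bsub>M\<^esub> m j))"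
      using ra m assms(1) by (intro M.finsum_cong') (auto simp: smult_assoc1)
    then show "(\<Oplus>\<^bsub>M\<^esub>j\<in>S. (r \<odot>\<^bsub>free_module R S\<^esub> a) j \<odot>\<^bsub>M\<^esub> m j) = r \<odot>\<^bsub>M\<^esub> (\<Oplus>\<^bsub>M\<^esub>j\<in>S. a j \<odot>\<^bsub>M\<^esub> m j)"
      using ra m assms(1) by (simp add: finsum_smult_ldistr Pi_def)
  qed (use m in \<open>auto intro!: M.finsum_closed intro: free_module_coeff\<close>)
qed

section \<open>Flat modules and relations\<close>

text \<open>The tuples in the image of \<open>K \<otimes> M \<rightarrow> M\<^sup>n\<close>.\<close>

definition tensor_tuple ::
    "('r, 'a, 'k) module_scheme \<Rightarrow> nat \<Rightarrow> (nat \<Rightarrow> 'r) set \<Rightarrow> (nat \<Rightarrow> 'a) \<Rightarrow> bool" where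
  "tensor_tuple M n K v \<longleftrightarrow>
     (\<exists>(p::nat) a y. (\<forall>l<p. a l \<in> K \<and> y l \<in> carrier M) \<and>
        (\<forall>j<n. v j = (\<Oplus>\<^bsub>M\<^esub>l\<in>{..<p}. a l j \<odot>\<^bsub>M\<^esub> y l)))"

context module
begin

lemma tensor_tuple_zero:
  assumes "\<And>j. j < n \<Longrightarrow> v j = \<zero>\<^bsub>M\<^esub>"
  shows "tensor_tuple M n K v"
  unfolding tensor_tuple_def by (rule exI[of _ 0]) (simp add: assms)

lemma tensor_tuple_gen:
  assumes "a \<in> K" "y \<in> carrier M" "\<And>j. a j \<in> carrier R" "\<And>j. j < n \<Longrightarrow> v j = a j \<odot>\<^bsub>M\<^esub> y"
  shows "tensor_tuple M n K v"
  unfolding tensor_tuple_def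
  by (rule exI[of _ 1], rule exI[of _ "\<lambda>_. a"], rule exI[of _ "\<lambda>_. y"])
    (use assms in \<open>simp add: lessThan_Suc\<close>)

lemma tensor_tuple_add:
  assumes v: "tensor_tuple M n K v" and w: "tensor_tuple M n K w"
    and K: "\<And>a j. a \<in> K \<Longrightarrow> a j \<in> carrier R"
    and u: "\<And>j. j < n \<Longrightarrow> u j = v j \<oplus>\<^bsub>M\<^esub> w j"
  shows "tensor_tuple M n K u"
proof -
  obtain p :: nat and a y where 1: "\<And>l. l < p \<Longrightarrow> a l \<in> K" "\<And>l. l < p \<Longrightarrow> y l \<in> carrier M"
      "\<And>j. j < n \<Longrightarrow> v j = (\<Oplus>\<^bsub>M\<^esub>l\<in>{..<p}. a l j \<odot>\<^bsub>M\<^esub> y l)"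
    using v by (auto simp: tensor_tuple_def)
  obtain q :: nat and b z where 2: "\<And>l. l < q \<Longrightarrow> b l \<in> K" "\<And>l. l < q \<Longrightarrow> z l \<in> carrier M"
      "\<And>j. j < n \<Longrightarrow> w j = (\<Oplus>\<^bsub>M\<^esub>l\<in>{..<q}. b l j \<odot>\<^bsub>M\<^esub> z l)"
    using w by (auto simp: tensor_tuple_def)
  let ?a = "\<lambda>l. if l < p then a l else b (l - p)"
  let ?y = "\<lambda>l. if l < p then y l else z (l - p)"
  have "u j = (\<Oplus>\<^bsub>M\<^esub>l\<in>{..<p + q}. ?a l j \<odot>\<^bsub>M\<^esub> ?y l)" if "j < n" for j
  proof -
    have "u j = (\<Oplus>\<^bsub>M\<^esub>l\<in>{..<p + q}. if l < p then a l j \<odot>\<^bsub>M\<^esub> y l else b (l - p) j \<odot>\<^bsub>M\<^esub> z (l - p))"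
      using 1 2 K that by (subst M.finsum_append) (simp_all add: u)
    also have "\<dots> = (\<Oplus>\<^bsub>M\<^esub>l\<in>{..<p + q}. ?a l j \<odot>\<^bsub>M\<^esub> ?y l)"
      using 1 2 K by (intro M.finsum_cong') auto
    finally show ?thesis .
  qed
  moreover have "\<forall>l<p + q. ?a l \<in> K \<and> ?y l \<in> carrier M"
    using 1 2 by auto
  ultimately show ?thesis
    unfolding tensor_tuple_def
    by (intro exI[of _ "p + q"] exI[of _ ?a] exI[of _ ?y]) blast
qed

lemma tensor_tuple_neg:
  assumes v: "tensor_tuple M n K v" and K: "\<And>a j. a \<in> K \<Longrightarrow> a j \<in> carrier R"
    and u: "\<And>j. j < n \<Longrightarrow> u j = \<ominus>\<^bsub>M\<^esub> v j"
  shows "tensor_tuple M n K u"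
proof -
  obtain p :: nat and a y where 1: "\<And>l. l < p \<Longrightarrow> a l \<in> K" "\<And>l. l < p \<Longrightarrow> y l \<in> carrier M"
      "\<And>j. j < n \<Longrightarrow> v j = (\<Oplus>\<^bsub>M\<^esub>l\<in>{..<p}. a l j \<odot>\<^bsub>M\<^esub> y l)"
    using v by (auto simp: tensor_tuple_def)
  have "u j = (\<Oplus>\<^bsub>M\<^esub>l\<in>{..<p}. a l j \<odot>\<^bsub>M\<^esub> (\<ominus>\<^bsub>M\<^esub> y l))" if "j < n" for j
  proof -
    have "u j = (\<ominus> \<one>) \<odot>\<^bsub>M\<^esub> (\<Oplus>\<^bsub>M\<^esub>l\<in>{..<p}. a l j \<odot>\<^bsub>M\<^esub> y l)"
      using that 1 K by (simp add: u smult_l_minus M.finsum_closed Pi_def)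
    also have "\<dots> = (\<Oplus>\<^bsub>M\<^esub>l\<in>{..<p}. (\<ominus> \<one>) \<odot>\<^bsub>M\<^esub> (a l j \<odot>\<^bsub>M\<^esub> y l))"
      using 1 K by (intro finsum_smult_ldistr) auto
    also have "\<dots> = (\<Oplus>\<^bsub>M\<^esub>l\<in>{..<p}. a l j \<odot>\<^bsub>M\<^esub> (\<ominus>\<^bsub>M\<^esub> y l))"
      using 1 K by (intro M.finsum_cong') (auto simp: smult_l_minus smult_r_minus)
    finally show ?thesis .
  qed
  then show ?thesis
    using 1 unfolding tensor_tuple_def by (intro exI[of _ p] exI[of _ a] exI[of _ "\<lambda>l. \<ominus>\<^bsub>M\<^esub> y l"]) simp
qed

end

section \<open>Tensor relations and flatness as a statement about them\<close>

definition tensor_generators ::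
    "('r, 'm) ring_scheme \<Rightarrow> ('r, 'a, 'k) module_scheme \<Rightarrow> ('r, 'b, 'l) module_scheme
      \<Rightarrow> ('a \<times> 'b \<Rightarrow>\<^sub>0 int) set" where
  "tensor_generators R N M =
     {frag_of (x \<oplus>\<^bsub>N\<^esub> y, m) - (frag_of (x, m) + frag_of (y, m)) | x y m.
         x \<in> carrier N \<and> y \<in> carrier N \<and> m \<in> carrier M} \<union>
      {frag_of (x, m \<oplus>\<^bsub>M\<^esub> m') - (frag_of (x, m) + frag_of (x, m')) | x m m'.
         x \<in> carrier N \<and> m \<in> carrier M \<and> m' \<in> carrier M} \<union>
      {frag_of (a \<odot>\<^bsub>N\<^esub> x, m) - frag_of (x, a \<odot>\<^bsub>M\<^esub> m) | a x m.
         a \<in> carrier R \<and> x \<in> carrier N \<and> m \<in> carrier M}"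

lemma tensor_relations_eq:
  "tensor_relations R N M =
     generate (free_Abelian_group (carrier N \<times> carrier M)) (tensor_generators R N M)"
  by (simp add: tensor_relations_def tensor_generators_def)

lemma keys_diff_subset: "Poly_Mapping.keys a \<subseteq> S \<Longrightarrow> Poly_Mapping.keys b \<subseteq> S \<Longrightarrow>
    Poly_Mapping.keys (a - b :: 'a \<Rightarrow>\<^sub>0 int) \<subseteq> S"
  by (rule order_trans[OF keys_diff]) simp

lemma keys_add_subset: "Poly_Mapping.keys a \<subseteq> S \<Longrightarrow> Poly_Mapping.keys b \<subseteq> S \<Longrightarrow>
    Poly_Mapping.keys (a + b :: 'a \<Rightarrow>\<^sub>0 int) \<subseteq> S"
  by (rule order_trans[OF keys_add]) simp

lemma tensor_generators_closed:
  assumes "module R N" "module R M"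
  shows "tensor_generators R N M \<subseteq> carrier (free_Abelian_group (carrier N \<times> carrier M))"
proof -
  interpret N: module R N by fact
  interpret M: module R M by fact
  show ?thesis
  proof
    fix w
    assume "w \<in> tensor_generators R N M"
    then show "w \<in> carrier (free_Abelian_group (carrier N \<times> carrier M))"
      unfolding tensor_generators_def carrier_free_Abelian_group_iff
      by (elim UnE CollectE exE conjE; simp only:; intro keys_diff_subset keys_add_subset; simp)
  qed
qed

lemma tensor_relations_subgroup:
  assumes "module R N" "module R M"
  shows "subgroup (tensor_relations R N M) (free_Abelian_group (carrier N \<times> carrier M))"
  unfolding tensor_relations_eq
  by (intro group.generate_is_subgroup tensor_generators_closed assms group_free_Abelian_group)

lemma tensor_relations_closed:
  assumes "module R N" "module R M"
  shows "0 \<in> tensor_relations R N M"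
    and "\<lbrakk>u \<in> tensor_relations R N M; v \<in> tensor_relations R N M\<rbrakk> \<Longrightarrow> u + v \<in> tensor_relations R N M"
    and "u \<in> tensor_relations R N M \<Longrightarrow> - u \<in> tensor_relations R N M"
    and "\<lbrakk>u \<in> tensor_relations R N M; v \<in> tensor_relations R N M\<rbrakk> \<Longrightarrow> u - v \<in> tensor_relations R N M"
proof -
  interpret subgroup "tensor_relations R N M" "free_Abelian_group (carrier N \<times> carrier M)"
    by (rule tensor_relations_subgroup[OF assms])
  show "0 \<in> tensor_relations R N M"
    using one_closed by simp
  show *: "u + v \<in> tensor_relations R N M" if "u \<in> tensor_relations R N M" "v \<in> tensor_relations R N M" for u v
    using m_closed[OF that] by simp
  show **: "- u \<in> tensor_relations R N M" if "u \<in> tensor_relations R N M" for u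
  proof -
    have "Poly_Mapping.keys u \<subseteq> carrier N \<times> carrier M"
      using subset that unfolding carrier_free_Abelian_group_iff[symmetric] by blast
    then show ?thesis
      using m_inv_closed[OF that] by simp
  qed
  show "u - v \<in> tensor_relations R N M" if "u \<in> tensor_relations R N M" "v \<in> tensor_relations R N M"
    using *[OF that(1) **[OF that(2)]] by simp
qed

lemma tensor_relations_gens:
  "\<lbrakk>x \<in> carrier N; y \<in> carrier N; m \<in> carrier M\<rbrakk> \<Longrightarrow>
     frag_of (x \<oplus>\<^bsub>N\<^esub> y, m) - (frag_of (x, m) + frag_of (y, m)) \<in> tensor_relations R N M"
  "\<lbrakk>x \<in> carrier N; m \<in> carrier M; m' \<in> carrier M\<rbrakk> \<Longrightarrow>
     frag_of (x, m \<oplus>\<^bsub>M\<^esub> m') - (frag_of (x, m) + frag_of (x, m')) \<in> tensor_relations R N M"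
  "\<lbrakk>a \<in> carrier R; x \<in> carrier N; m \<in> carrier M\<rbrakk> \<Longrightarrow>
     frag_of (a \<odot>\<^bsub>N\<^esub> x, m) - frag_of (x, a \<odot>\<^bsub>M\<^esub> m) \<in> tensor_relations R N M"
  unfolding tensor_relations_eq tensor_generators_def by (rule generate.incl, blast)+

text \<open>This turns injectivity on cosets into membership: the class of \<open>z\<close> and the
  class of \<open>0\<close> both go to the trivial coset over \<open>N\<close>, so they already
  agree over \<open>H\<close>.\<close>

lemma flat_module_relations:
  fixes N :: "('r, (nat \<Rightarrow> 'r) set) module"
  assumes "flat_module R M" "module R M" "module R N" "submodule H R N"
    and "z \<in> tensor_relations R N M" "Poly_Mapping.keys z \<subseteq> H \<times> carrier M"
  shows "z \<in> tensor_relations R (N\<lparr>carrier := H\<rparr>) M"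
proof -
  let ?rN = "tensor_relations R N M" and ?rH = "tensor_relations R (N\<lparr>carrier := H\<rparr>) M"
  let ?FH = "free_Abelian_group (H \<times> carrier M)" and ?FN = "free_Abelian_group (carrier N \<times> carrier M)"
  have H: "module R (N\<lparr>carrier := H\<rparr>)"
    using submodule.submodule_is_module[OF assms(4,3)] .
  have HN: "H \<subseteq> carrier N"
    using module.submoduleE(1)[OF assms(3,4)] .
  note clN = tensor_relations_closed[OF assms(3,2)]
  have "tensor_generators R (N\<lparr>carrier := H\<rparr>) M \<subseteq> tensor_generators R N M"
  proof
    fix w
    assume "w \<in> tensor_generators R (N\<lparr>carrier := H\<rparr>) M"
    then show "w \<in> tensor_generators R N M"
      unfolding tensor_generators_def Un_iff mem_Collect_eq
      by (elim disj_forward ex_forward conj_forward) (simp_all add: subsetD[OF HN])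
  qed
  then have gens: "tensor_generators R (N\<lparr>carrier := H\<rparr>) M \<subseteq> ?rN"
    unfolding tensor_relations_eq[of R N] by (auto intro: generate.incl)
  have gensH: "tensor_generators R (N\<lparr>carrier := H\<rparr>) M \<subseteq> carrier ?FH"
    using tensor_generators_closed[OF H assms(2)] by simp
  have sub: "w \<in> ?rN" if "w \<in> ?rH" for w
    using that unfolding tensor_relations_eq[of R "N\<lparr>carrier := H\<rparr>"]
  proof (induction rule: generate.induct)
    \<comment> \<open>The inverse in the free group over \<open>H\<close> is known to be negation
      for elements supported in \<open>H \<times> carrier M\<close>, hence the check on the
      support.\<close>
    case (inv h)
    then have "Poly_Mapping.keys h \<subseteq> H \<times> carrier M"
      using gensH unfolding carrier_free_Abelian_group_iff[symmetric] by blast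
    then have "inv\<^bsub>?FH\<^esub> h = - h"
      by (rule inv_free_Abelian_group)
    moreover have "- h \<in> ?rN"
      using inv gens by (intro clN(3)) blast
    ultimately show ?case
      by simp
  next
    case one
    show ?case
      using clN(1) by simp
  next
    case (incl h)
    then show ?case
      using gens by blast
  next
    case (eng u v)
    then show ?case
      using clN(2)[of u v] by simp
  qed
  \<comment> \<open>The induced map sends the class of any relation over \<open>N\<close> to the
    trivial class. This is applied to \<open>z\<close> and to \<open>0\<close>.\<close>
  have coset: "?rN <#>\<^bsub>?FN\<^esub> (?rH #>\<^bsub>?FH\<^esub> w) = ?rN" if "w \<in> ?rN" for w
  proof
    have "r + (h + w) \<in> ?rN" if "r \<in> ?rN" "h \<in> ?rH" for r h
      using clN(2)[OF that(1) clN(2)[OF sub[OF that(2)] \<open>w \<in> ?rN\<close>]] .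
    then show "?rN <#>\<^bsub>?FN\<^esub> (?rH #>\<^bsub>?FH\<^esub> w) \<subseteq> ?rN"
      unfolding set_mult_def r_coset_def mult_free_Abelian_group by blast
    have "r \<in> ?rN <#>\<^bsub>?FN\<^esub> (?rH #>\<^bsub>?FH\<^esub> w)" if "r \<in> ?rN" for r
    proof -
      have "r - w \<in> ?rN" "0 \<in> ?rH" "r = r - w + (0 + w)"
        using clN(4)[OF that \<open>w \<in> ?rN\<close>] tensor_relations_closed(1)[OF H assms(2)] by simp_all
      then show ?thesis
        unfolding set_mult_def r_coset_def mult_free_Abelian_group by blast
    qed
    then show "?rN \<subseteq> ?rN <#>\<^bsub>?FN\<^esub> (?rH #>\<^bsub>?FH\<^esub> w)"
      by blast
  qed
  have "inj_on (\<lambda>X. ?rN <#>\<^bsub>?FN\<^esub> X) (carrier (tensor_product R (N\<lparr>carrier := H\<rparr>) M))"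
    using assms(1,3,4) unfolding flat_module_def by blast
  moreover have "?rH #>\<^bsub>?FH\<^esub> w \<in> carrier (tensor_product R (N\<lparr>carrier := H\<rparr>) M)"
    if "Poly_Mapping.keys w \<subseteq> H \<times> carrier M" for w
    using that unfolding tensor_product_def carrier_FactGroup
    by simp
  ultimately have "?rH #>\<^bsub>?FH\<^esub> z = ?rH #>\<^bsub>?FH\<^esub> 0"
    using coset[OF assms(5)] coset[OF clN(1)] assms(6) by (simp add: inj_on_def)
  moreover have "0 + z \<in> ?rH #>\<^bsub>?FH\<^esub> z"
    unfolding r_coset_def mult_free_Abelian_group using tensor_relations_closed(1)[OF H assms(2)] by blast
  ultimately have "0 + z \<in> ?rH #>\<^bsub>?FH\<^esub> 0"
    by simp
  then show ?thesis
    unfolding r_coset_def mult_free_Abelian_group by simp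
qed

section \<open>The equational criterion for flatness\<close>

lemma free_Abelian_group_hom_values:
  assumes "abelian_group M" "h \<in> hom (free_Abelian_group S) (add_monoid M)"
  shows "h 0 = \<zero>\<^bsub>M\<^esub>"
    and "Poly_Mapping.keys u \<subseteq> S \<Longrightarrow> h u \<in> carrier M"
    and "\<lbrakk>Poly_Mapping.keys u \<subseteq> S; Poly_Mapping.keys v \<subseteq> S\<rbrakk> \<Longrightarrow> h (u + v) = h u \<oplus>\<^bsub>M\<^esub> h v"
    and "Poly_Mapping.keys u \<subseteq> S \<Longrightarrow> h (- u) = \<ominus>\<^bsub>M\<^esub> h u"
    and "\<lbrakk>Poly_Mapping.keys u \<subseteq> S; Poly_Mapping.keys v \<subseteq> S\<rbrakk> \<Longrightarrow> h (u - v) = h u \<ominus>\<^bsub>M\<^esub> h v"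
proof -
  interpret M: abelian_group M by fact
  interpret h: group_hom "free_Abelian_group S" "add_monoid M" h
    using assms(2) M.a_group by (simp add: group_hom_def group_hom_axioms_def)
  show "h 0 = \<zero>\<^bsub>M\<^esub>"
    using h.hom_one by simp
  show "h u \<in> carrier M" if "Poly_Mapping.keys u \<subseteq> S" for u
    using h.hom_closed[of u] that by simp
  show add: "h (u + v) = h u \<oplus>\<^bsub>M\<^esub> h v" if "Poly_Mapping.keys u \<subseteq> S" "Poly_Mapping.keys v \<subseteq> S" for u v
    using h.hom_mult[of u v] that by simp
  show neg: "h (- u) = \<ominus>\<^bsub>M\<^esub> h u" if "Poly_Mapping.keys u \<subseteq> S" for u
    using h.hom_inv[of u] that by (simp add: a_inv_def)
  show "h (u - v) = h u \<ominus>\<^bsub>M\<^esub> h v" if "Poly_Mapping.keys u \<subseteq> S" "Poly_Mapping.keys v \<subseteq> S"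
    using add[of u "- v"] neg[of v] that by (simp add: a_minus_def)
qed

text \<open>The setting of the equational criterion: a vanishing sum of
  \<open>\<gamma> j \<otimes> m j\<close> in \<open>N \<otimes> M\<close> is to be explained by
  syzygies of the \<open>\<gamma> j\<close>. The familiar case is \<open>N = R\<close>, a single
  linear equation; taking \<open>N\<close> free of rank \<open>k\<close> handles \<open>k\<close>
  equations simultaneously.\<close>

locale flat_relation =
  fixes R :: "('r, 'm) ring_scheme" (structure) and N :: "('r, (nat \<Rightarrow> 'r) set) module"
    and M :: "('r, 'a, 'k) module_scheme" and n :: nat and \<gamma> :: "nat \<Rightarrow> (nat \<Rightarrow> 'r) set"
  assumes N_module: "module R N" and M_module: "module R M"
    and \<gamma>: "j < n \<Longrightarrow> \<gamma> j \<in> carrier N"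
begin

sublocale R?: cring R
  using M_module by (rule module.axioms)

sublocale N: module R N
  by (rule N_module)

sublocale M: module R M
  by (rule M_module)

abbreviation "F \<equiv> free_module R {..<n}"

definition comb :: "(nat \<Rightarrow> 'r) \<Rightarrow> (nat \<Rightarrow> 'r) set" where
  "comb a = (\<Oplus>\<^bsub>N\<^esub>j\<in>{..<n}. a j \<odot>\<^bsub>N\<^esub> \<gamma> j)"

definition syz :: "(nat \<Rightarrow> 'r) set" where
  "syz = {a \<in> carrier F. comb a = \<zero>\<^bsub>N\<^esub>}"

definition coords :: "(nat \<Rightarrow> 'r) set \<Rightarrow> nat \<Rightarrow> 'r" where
  "coords h = (SOME a. a \<in> carrier F \<and> comb a = h)"

lemma F_module: "module R F"
  by (rule free_module_is_module)

lemma comb_linear: "comb \<in> linear_maps R F N"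
  using N.free_module_comb_linear[of "{..<n}" \<gamma>] \<gamma> by (auto simp: comb_def[abs_def])

lemma comb_free_gen: "k < n \<Longrightarrow> comb (free_gen R k) = \<gamma> k"
proof -
  assume k: "k < n"
  have "comb (free_gen R k) = (\<Oplus>\<^bsub>N\<^esub>j\<in>{..<n}. if j = k then \<gamma> k else \<zero>\<^bsub>N\<^esub>)"
    unfolding comb_def using \<gamma> k by (intro N.finsum_cong') (auto simp: free_gen_def)
  then show ?thesis
    using N.finsum_delta[of "{..<n}" k "\<gamma> k"] \<gamma> k by simp
qed

abbreviation "H \<equiv> comb ` carrier F"

lemma H_submodule: "submodule H R N"
  using F_module N_module comb_linear by (rule linear_maps_image_submodule)

lemma coords: "h \<in> H \<Longrightarrow> coords h \<in> carrier F" "h \<in> H \<Longrightarrow> comb (coords h) = h"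
proof -
  assume "h \<in> H"
  then have "\<exists>a. a \<in> carrier F \<and> comb a = h"
    by auto
  then have "coords h \<in> carrier F \<and> comb (coords h) = h"
    unfolding coords_def by (rule someI_ex)
  then show "coords h \<in> carrier F" "comb (coords h) = h"
    by auto
qed

lemma coords_coeff [simp]: "h \<in> H \<Longrightarrow> coords h j \<in> carrier R"
  by (rule free_module_coeff[OF coords(1)])

text \<open>The failure of \<open>coords\<close> to be linear always takes this form, so it is
  absorbed by \<open>syz\<close>.\<close>

lemma syz_diff:
  assumes "a \<in> carrier F" "b \<in> carrier F" "comb a = comb b"
  shows "(\<lambda>j. a j \<ominus> b j) \<in> syz"
proof -
  interpret F: module R F by (rule F_module)
  have "a \<ominus>\<^bsub>F\<^esub> b = (\<lambda>j. a j \<ominus> b j)"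
    using assms by (simp add: a_minus_def free_module_minus)
  moreover have "comb (a \<ominus>\<^bsub>F\<^esub> b) = \<zero>\<^bsub>N\<^esub>"
    using assms linear_mapsD(1)[OF comb_linear, of b]
    by (simp add: a_minus_def linear_mapsD(2)[OF comb_linear]
        linear_maps_minus[OF F_module N.module_axioms comb_linear] N.r_neg del: free_module_simps)
  moreover have "a \<ominus>\<^bsub>F\<^esub> b \<in> carrier F"
    using assms by (intro F.minus_closed)
  ultimately show ?thesis
    by (simp add: syz_def)
qed

lemma syz_coeff: "a \<in> syz \<Longrightarrow> a j \<in> carrier R"
  by (auto simp: syz_def)

abbreviation "tup \<equiv> tensor_tuple M n syz"

text \<open>The homomorphism \<open>h \<otimes> m \<mapsto> coords h \<cdot> m\<close> to \<open>M\<^sup>n\<close> is well defined modulo the tuples spanned by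
  syzygies, although \<^const>\<open>coords\<close> itself is not linear.\<close>

lemma coords_tensor_tuple:
  assumes \<Phi>: "\<And>j. j < n \<Longrightarrow> \<Phi> j \<in> hom (free_Abelian_group (H \<times> carrier M)) (add_monoid M)"
    and \<Phi>_gen: "\<And>j h m. \<lbrakk>j < n; h \<in> H; m \<in> carrier M\<rbrakk> \<Longrightarrow> \<Phi> j (frag_of (h, m)) = coords h j \<odot>\<^bsub>M\<^esub> m"
    and z: "z \<in> tensor_relations R (N\<lparr>carrier := H\<rparr>) M"
  shows "tup (\<lambda>j. \<Phi> j z)"
proof -
  let ?FH = "free_Abelian_group (H \<times> carrier M)"
  let ?gens = "tensor_generators R (N\<lparr>carrier := H\<rparr>) M"
  interpret F: module R F by (rule F_module)
  note val = free_Abelian_group_hom_values[OF M.abelian_group_axioms \<Phi>]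
  have HN: "H \<subseteq> carrier N" and Ha: "\<And>x y. \<lbrakk>x \<in> H; y \<in> H\<rbrakk> \<Longrightarrow> x \<oplus>\<^bsub>N\<^esub> y \<in> H"
    and Hs: "\<And>a x. \<lbrakk>a \<in> carrier R; x \<in> H\<rbrakk> \<Longrightarrow> a \<odot>\<^bsub>N\<^esub> x \<in> H"
    using N.submoduleE[OF H_submodule] by auto
  have gens_keys: "Poly_Mapping.keys w \<subseteq> H \<times> carrier M" if "w \<in> ?gens" for w
    using subsetD[OF tensor_generators_closed[OF
          submodule.submodule_is_module[OF H_submodule N_module] M_module] that] by simp
  have k1: "Poly_Mapping.keys (frag_of (h, m)) \<subseteq> H \<times> carrier M" if "h \<in> H" "m \<in> carrier M" for h m
    using that by simp
  have gens: "tup (\<lambda>j. \<Phi> j w)" if w: "w \<in> ?gens" for w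
  proof -
    consider (l) x y m where "x \<in> H" "y \<in> H" "m \<in> carrier M"
        "w = frag_of (x \<oplus>\<^bsub>N\<^esub> y, m) - (frag_of (x, m) + frag_of (y, m))"
      | (r) x m m' where "x \<in> H" "m \<in> carrier M" "m' \<in> carrier M"
        "w = frag_of (x, m \<oplus>\<^bsub>M\<^esub> m') - (frag_of (x, m) + frag_of (x, m'))"
      | (s) a x m where "a \<in> carrier R" "x \<in> H" "m \<in> carrier M"
        "w = frag_of (a \<odot>\<^bsub>N\<^esub> x, m) - frag_of (x, a \<odot>\<^bsub>M\<^esub> m)"
      using w unfolding tensor_generators_def Un_iff mem_Collect_eq by (elim disjE exE conjE) simp_all
    then show ?thesis
    proof cases
      \<comment> \<open>In the first factor \<open>coords\<close> is additive up to a syzygy, so the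
        generator maps to that syzygy times \<open>m\<close>.\<close>
      case l
      have "comb (coords (x \<oplus>\<^bsub>N\<^esub> y)) = comb (coords x \<oplus>\<^bsub>F\<^esub> coords y)"
        using l Ha coords by (simp add: linear_mapsD(2)[OF comb_linear] del: free_module_simps)
      then have "(\<lambda>j. coords (x \<oplus>\<^bsub>N\<^esub> y) j \<ominus> (coords x \<oplus>\<^bsub>F\<^esub> coords y) j) \<in> syz"
        using l Ha by (intro syz_diff coords F.a_closed)
      then show ?thesis
      proof (rule M.tensor_tuple_gen[OF _ l(3)])
        fix j assume "j < n"
        then show "\<Phi> j w = (coords (x \<oplus>\<^bsub>N\<^esub> y) j \<ominus> (coords x \<oplus>\<^bsub>F\<^esub> coords y) j) \<odot>\<^bsub>M\<^esub> m"
          using l Ha by (simp add: val keys_add_subset \<Phi>_gen a_minus_def M.smult_l_distr M.smult_l_minus)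
      qed (use l Ha in \<open>simp add: R.minus_closed\<close>)
    next
      \<comment> \<open>In the second factor the formula is exactly additive, so the generator maps
        to zero.\<close>
      case r
      show ?thesis
      proof (rule M.tensor_tuple_zero)
        fix j assume "j < n"
        then show "\<Phi> j w = \<zero>\<^bsub>M\<^esub>"
          using r by (simp add: val keys_add_subset \<Phi>_gen M.smult_r_distr a_minus_def M.r_neg)
      qed
    next
      case s
      have "comb (coords (a \<odot>\<^bsub>N\<^esub> x)) = comb (a \<odot>\<^bsub>F\<^esub> coords x)"
        using s Hs coords by (simp add: linear_mapsD(3)[OF comb_linear] del: free_module_simps)
      then have "(\<lambda>j. coords (a \<odot>\<^bsub>N\<^esub> x) j \<ominus> (a \<odot>\<^bsub>F\<^esub> coords x) j) \<in> syz"
        using s Hs by (intro syz_diff coords F.smult_closed)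
      then show ?thesis
      proof (rule M.tensor_tuple_gen[OF _ s(3)])
        fix j assume "j < n"
        then show "\<Phi> j w = (coords (a \<odot>\<^bsub>N\<^esub> x) j \<ominus> (a \<odot>\<^bsub>F\<^esub> coords x) j) \<odot>\<^bsub>M\<^esub> m"
          using s Hs by (simp add: val \<Phi>_gen a_minus_def M.smult_l_distr M.smult_l_minus
              M.smult_assoc1[symmetric] R.m_comm)
      qed (use s Hs in \<open>simp add: R.minus_closed\<close>)
    qed
  qed
  \<comment> \<open>The support is carried through the induction because the homomorphism laws for
    \<open>\<Phi> j\<close> apply to elements supported in
    \<open>H \<times> carrier M\<close>.\<close>
  have "Poly_Mapping.keys z \<subseteq> H \<times> carrier M \<and> tup (\<lambda>j. \<Phi> j z)"
    using z unfolding tensor_relations_eq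
  proof (induction rule: generate.induct)
    case one
    show ?case
      by (simp add: M.tensor_tuple_zero val)
  next
    case (incl w)
    then show ?case
      using gens gens_keys by blast
  next
    case (inv w)
    then have k: "Poly_Mapping.keys w \<subseteq> H \<times> carrier M"
      using gens_keys by blast
    have "tup (\<lambda>j. \<Phi> j (- w))"
      by (rule M.tensor_tuple_neg[OF gens[OF inv]]) (simp_all add: val k syz_coeff)
    then show ?case
      using k by simp
  next
    case (eng u v)
    then have k: "Poly_Mapping.keys u \<subseteq> H \<times> carrier M" "Poly_Mapping.keys v \<subseteq> H \<times> carrier M"
      by auto
    have "tup (\<lambda>j. \<Phi> j u)" "tup (\<lambda>j. \<Phi> j v)"
      using eng by auto
    then have "tup (\<lambda>j. \<Phi> j (u + v))"
      by (rule M.tensor_tuple_add) (use k in \<open>simp_all add: val syz_coeff\<close>)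
    then show ?case
      using k keys_add_subset by simp
  qed
  then show ?thesis ..
qed

text \<open>By flatness the relation already holds in \<open>H \<otimes> M\<close>, where
  \<open>H\<close> is spanned by the \<open>\<gamma> j\<close>. Applying \<open>coords\<close> shows
  that the sum of \<open>coords (\<gamma> k) \<odot> m k\<close> is a tuple spanned by syzygies. It
  differs from \<open>m\<close> by the sum of
  \<open>(free_gen R k - coords (\<gamma> k)) \<odot> m k\<close>, which is again such a
  tuple.\<close>

lemma flat_vanishing:
  assumes flat: "flat_module R M" and m: "\<And>j. j < n \<Longrightarrow> m j \<in> carrier M"
    and rel: "(\<Sum>j<n. frag_of (\<gamma> j, m j)) \<in> tensor_relations R N M"
  shows "tup m"
proof -
  let ?FH = "free_Abelian_group (H \<times> carrier M)"
  interpret F: module R F by (rule F_module)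
  have \<gamma>H: "\<gamma> j \<in> H" if "j < n" for j
    using comb_free_gen[OF that] free_gen_closed[of j "{..<n}"] that by (metis image_eqI lessThan_iff)
  have keys: "Poly_Mapping.keys (\<Sum>j<k. frag_of (\<gamma> j, m j)) \<subseteq> H \<times> carrier M" if "k \<le> n" for k
    using that \<gamma>H m
    by (induction k) (simp_all add: keys_add_subset)
  have "\<forall>j. \<exists>\<phi>. \<phi> \<in> hom ?FH (add_monoid M) \<and>
      (\<forall>x \<in> H \<times> carrier M. \<phi> (frag_of x) = (case x of (h, m) \<Rightarrow> coords h j \<odot>\<^bsub>M\<^esub> m))"
  proof
    fix j
    have "(\<lambda>(h, m). coords h j \<odot>\<^bsub>M\<^esub> m) ` (H \<times> carrier M) \<subseteq> carrier (add_monoid M)"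
      by auto
    then show "\<exists>\<phi>. \<phi> \<in> hom ?FH (add_monoid M) \<and>
        (\<forall>x \<in> H \<times> carrier M. \<phi> (frag_of x) = (case x of (h, m) \<Rightarrow> coords h j \<odot>\<^bsub>M\<^esub> m))"
      by (rule comm_group.free_Abelian_group_universal[OF M.a_comm_group]) blast
  qed
  then obtain \<Phi> where \<Phi>: "\<And>j. \<Phi> j \<in> hom ?FH (add_monoid M)"
    and \<Phi>_gen: "\<And>j h m. \<lbrakk>h \<in> H; m \<in> carrier M\<rbrakk> \<Longrightarrow> \<Phi> j (frag_of (h, m)) = coords h j \<odot>\<^bsub>M\<^esub> m"
    by (metis (no_types, lifting) SigmaI case_prod_conv)
  note val = free_Abelian_group_hom_values[OF M.abelian_group_axioms \<Phi>]
  have t0: "tup (\<lambda>j. \<Phi> j (\<Sum>j<n. frag_of (\<gamma> j, m j)))"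
    using flat_module_relations[OF flat M.module_axioms N.module_axioms H_submodule rel keys] \<Phi> \<Phi>_gen
    by (intro coords_tensor_tuple) auto
  \<comment> \<open>\<open>w\<close> accumulates the corrections for the first \<open>k\<close>
    summands; once it is added, exactly the first \<open>k\<close> entries of \<open>m\<close> have
    been recovered.\<close>
  have "\<exists>w. tup w \<and> (\<forall>i<n. w i \<in> carrier M \<and>
      \<Phi> i (\<Sum>j<k. frag_of (\<gamma> j, m j)) \<oplus>\<^bsub>M\<^esub> w i = (if i < k then m i else \<zero>\<^bsub>M\<^esub>))" if "k \<le> n" for k
    using that
  proof (induction k)
    case 0
    show ?case
      by (rule exI[of _ "\<lambda>_. \<zero>\<^bsub>M\<^esub>"]) (simp add: M.tensor_tuple_zero val)
  next
    case (Suc k)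
    then obtain w where w: "tup w" "\<And>i. i < n \<Longrightarrow> w i \<in> carrier M"
      "\<And>i. i < n \<Longrightarrow> \<Phi> i (\<Sum>j<k. frag_of (\<gamma> j, m j)) \<oplus>\<^bsub>M\<^esub> w i = (if i < k then m i else \<zero>\<^bsub>M\<^esub>)"
      by auto
    have k: "k < n"
      using Suc.prems by simp
    \<comment> \<open>Both vectors are mapped to \<open>\<gamma> k\<close> by \<open>comb\<close>,
      so their difference is a syzygy.\<close>
    let ?a = "\<lambda>i. free_gen R k i \<ominus> coords (\<gamma> k) i"
    have gR: "free_gen R k i \<in> carrier R" for i
      by (simp add: free_gen_def)
    have aR: "?a i \<in> carrier R" for i
      using k \<gamma>H gR by (simp add: R.minus_closed)
    have "?a \<in> syz"
      using k \<gamma>H coords by (intro syz_diff free_gen_closed) (auto simp: comb_free_gen)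
    then have t: "tup (\<lambda>i. ?a i \<odot>\<^bsub>M\<^esub> m k)"
      using m[OF k] aR by (rule M.tensor_tuple_gen) simp
    show ?case
    proof (intro exI conjI allI impI)
      show "tup (\<lambda>i. w i \<oplus>\<^bsub>M\<^esub> ?a i \<odot>\<^bsub>M\<^esub> m k)"
        by (rule M.tensor_tuple_add[OF w(1) t]) (simp_all add: syz_coeff)
      fix i assume i: "i < n"
      show "w i \<oplus>\<^bsub>M\<^esub> ?a i \<odot>\<^bsub>M\<^esub> m k \<in> carrier M"
        using w i aR m k by simp
      have c: "\<Phi> i (\<Sum>j<k. frag_of (\<gamma> j, m j)) \<in> carrier M" "coords (\<gamma> k) i \<odot>\<^bsub>M\<^esub> m k \<in> carrier M"
        using keys[of k] k val \<gamma>H m by auto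
      have "\<Phi> i (\<Sum>j<Suc k. frag_of (\<gamma> j, m j)) \<oplus>\<^bsub>M\<^esub> (w i \<oplus>\<^bsub>M\<^esub> ?a i \<odot>\<^bsub>M\<^esub> m k)
          = (\<Phi> i (\<Sum>j<k. frag_of (\<gamma> j, m j)) \<oplus>\<^bsub>M\<^esub> coords (\<gamma> k) i \<odot>\<^bsub>M\<^esub> m k) \<oplus>\<^bsub>M\<^esub> (w i \<oplus>\<^bsub>M\<^esub> ?a i \<odot>\<^bsub>M\<^esub> m k)"
        using keys[of k] k \<gamma>H m by (simp add: val \<Phi>_gen)
      also have "\<dots> = (\<Phi> i (\<Sum>j<k. frag_of (\<gamma> j, m j)) \<oplus>\<^bsub>M\<^esub> w i) \<oplus>\<^bsub>M\<^esub>
          (coords (\<gamma> k) i \<odot>\<^bsub>M\<^esub> m k \<oplus>\<^bsub>M\<^esub> ?a i \<odot>\<^bsub>M\<^esub> m k)"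
        using c w(2)[OF i] aR m[OF k] by (simp add: M.a_ac)
      also have "coords (\<gamma> k) i \<odot>\<^bsub>M\<^esub> m k \<oplus>\<^bsub>M\<^esub> ?a i \<odot>\<^bsub>M\<^esub> m k = (coords (\<gamma> k) i \<oplus> ?a i) \<odot>\<^bsub>M\<^esub> m k"
        using aR \<gamma>H k m by (simp add: M.smult_l_distr)
      also have "coords (\<gamma> k) i \<oplus> ?a i = free_gen R k i"
        using gR[of i] coords_coeff[OF \<gamma>H[OF k], of i] by algebra
      finally show "\<Phi> i (\<Sum>j<Suc k. frag_of (\<gamma> j, m j)) \<oplus>\<^bsub>M\<^esub> (w i \<oplus>\<^bsub>M\<^esub> ?a i \<odot>\<^bsub>M\<^esub> m k) =
          (if i < Suc k then m i else \<zero>\<^bsub>M\<^esub>)"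
        using w(3)[OF i] m i k by (auto simp: free_gen_def less_Suc_eq)
    qed
  qed
  from this[OF order.refl] obtain w where w: "tup w" "\<And>i. i < n \<Longrightarrow> w i \<in> carrier M"
      "\<And>i. i < n \<Longrightarrow> \<Phi> i (\<Sum>j<n. frag_of (\<gamma> j, m j)) \<oplus>\<^bsub>M\<^esub> w i = m i"
    by auto
  show ?thesis
    by (rule M.tensor_tuple_add[OF t0 w(1)]) (simp_all add: w(3) syz_coeff)
qed

end

declare free_module_simps [simp del]

text \<open>An isomorphic copy of a module whose carrier consists of sets, as required by
  \<^const>\<open>flat_module\<close>.\<close>

definition singleton_module :: "('r, 'a, 'k) module_scheme \<Rightarrow> ('r, 'a set) module" where
  "singleton_module P = \<lparr>carrier = (\<lambda>f. {f}) ` carrier P, mult = undefined, one = undefined,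
     zero = {\<zero>\<^bsub>P\<^esub>}, add = (\<lambda>X Y. {the_elem X \<oplus>\<^bsub>P\<^esub> the_elem Y}),
     smult = (\<lambda>a X. {a \<odot>\<^bsub>P\<^esub> the_elem X})\<rparr>"

lemma singleton_module_zero: "\<zero>\<^bsub>singleton_module P\<^esub> = {\<zero>\<^bsub>P\<^esub>}"
  by (simp add: singleton_module_def)

lemma singleton_module_is_module:
  assumes "module R P"
  shows "module R (singleton_module P)"
proof -
  interpret module R P by fact
  show ?thesis
  proof (intro moduleI)
    show "abelian_group (singleton_module P)"
      by (intro abelian_groupI)
        (auto simp: singleton_module_def M.a_ac intro!: M.l_neg M.a_inv_closed)
  qed (auto simp: singleton_module_def is_cring smult_l_distr smult_r_distr smult_assoc1)
qed

lemma singleton_module_linear: "(\<lambda>x. {x}) \<in> linear_maps R P (singleton_module P)"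
  by (intro linear_mapsI) (auto simp: singleton_module_def)

section \<open>Bilinear computations modulo the tensor relations\<close>

lemma tensor_relations_zero:
  assumes "module R N" "module R M"
  shows "m \<in> carrier M \<Longrightarrow> frag_of (\<zero>\<^bsub>N\<^esub>, m) \<in> tensor_relations R N M"
    and "x \<in> carrier N \<Longrightarrow> frag_of (x, \<zero>\<^bsub>M\<^esub>) \<in> tensor_relations R N M"
proof -
  interpret N: module R N by fact
  interpret M: module R M by fact
  note cl = tensor_relations_closed(3)[OF assms]
  \<comment> \<open>At two zeros the additivity generator collapses to the negative of the claimed
    element.\<close>
  show "frag_of (\<zero>\<^bsub>N\<^esub>, m) \<in> tensor_relations R N M" if "m \<in> carrier M"
    using cl[OF tensor_relations_gens(1)[of "\<zero>\<^bsub>N\<^esub>" N "\<zero>\<^bsub>N\<^esub>" m]] that by simp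
  show "frag_of (x, \<zero>\<^bsub>M\<^esub>) \<in> tensor_relations R N M" if "x \<in> carrier N"
    using cl[OF tensor_relations_gens(2)[of x N "\<zero>\<^bsub>M\<^esub>" M "\<zero>\<^bsub>M\<^esub>"]] that by simp
qed

lemma tensor_relations_sum:
  assumes "module R N" "module R M" "\<And>i. i \<in> X \<Longrightarrow> z i \<in> tensor_relations R N M"
  shows "(\<Sum>i\<in>X. z i) \<in> tensor_relations R N M"
  using assms(3) by (induction X rule: infinite_finite_induct)
    (auto intro: tensor_relations_closed[OF assms(1,2)])

lemma tensor_relations_finsum:
  assumes NM: "module R N" "module R M" and "finite X"
  shows "\<lbrakk>x \<in> X \<rightarrow> carrier N; m \<in> carrier M\<rbrakk> \<Longrightarrow>
      frag_of (\<Oplus>\<^bsub>N\<^esub>i\<in>X. x i, m) - (\<Sum>i\<in>X. frag_of (x i, m)) \<in> tensor_relations R N M"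
    and "\<lbrakk>y \<in> carrier N; v \<in> X \<rightarrow> carrier M\<rbrakk> \<Longrightarrow>
      frag_of (y, \<Oplus>\<^bsub>M\<^esub>i\<in>X. v i) - (\<Sum>i\<in>X. frag_of (y, v i)) \<in> tensor_relations R N M"
proof -
  interpret N: module R N by fact
  interpret M: module R M by fact
  show "frag_of (\<Oplus>\<^bsub>N\<^esub>i\<in>X. x i, m) - (\<Sum>i\<in>X. frag_of (x i, m)) \<in> tensor_relations R N M"
    if "x \<in> X \<rightarrow> carrier N" "m \<in> carrier M"
    using \<open>finite X\<close> that
  proof (induction X rule: finite_induct)
    case (insert i X)
    have "frag_of (x i \<oplus>\<^bsub>N\<^esub> (\<Oplus>\<^bsub>N\<^esub>i\<in>X. x i), m) - (frag_of (x i, m) + frag_of (\<Oplus>\<^bsub>N\<^esub>i\<in>X. x i, m)) \<in>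
        tensor_relations R N M"
      using insert by (intro tensor_relations_gens) (auto intro!: N.finsum_closed)
    from tensor_relations_closed(2)[OF NM this insert.IH] insert show ?case
      by (simp add: Pi_def algebra_simps)
  qed (simp add: tensor_relations_zero NM)
  show "frag_of (y, \<Oplus>\<^bsub>M\<^esub>i\<in>X. v i) - (\<Sum>i\<in>X. frag_of (y, v i)) \<in> tensor_relations R N M"
    if "y \<in> carrier N" "v \<in> X \<rightarrow> carrier M"
    using \<open>finite X\<close> that
  proof (induction X rule: finite_induct)
    case (insert i X)
    have "frag_of (y, v i \<oplus>\<^bsub>M\<^esub> (\<Oplus>\<^bsub>M\<^esub>i\<in>X. v i)) - (frag_of (y, v i) + frag_of (y, \<Oplus>\<^bsub>M\<^esub>i\<in>X. v i)) \<in>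
        tensor_relations R N M"
      using insert by (intro tensor_relations_gens) (auto intro!: M.finsum_closed)
    from tensor_relations_closed(2)[OF NM this insert.IH] insert show ?case
      by (simp add: Pi_def algebra_simps)
  qed (simp add: tensor_relations_zero NM)
qed

text \<open>The matrix is moved across the tensor sign: the sum equals the sum over \<open>i\<close>
  of \<open>e i \<otimes> (\<Sum>j. g i j \<odot> m j)\<close>, and every second factor
  vanishes.\<close>

lemma tensor_relations_matrix:
  fixes g :: "'i \<Rightarrow> 'j \<Rightarrow> 'r"
  assumes NM: "module R N" "module R M" and fin: "finite I" "finite J"
    and g: "\<And>i j. \<lbrakk>i \<in> I; j \<in> J\<rbrakk> \<Longrightarrow> g i j \<in> carrier R"
    and e: "\<And>i. i \<in> I \<Longrightarrow> e i \<in> carrier N" and m: "\<And>j. j \<in> J \<Longrightarrow> m j \<in> carrier M"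
    and zero: "\<And>i. i \<in> I \<Longrightarrow> (\<Oplus>\<^bsub>M\<^esub>j\<in>J. g i j \<odot>\<^bsub>M\<^esub> m j) = \<zero>\<^bsub>M\<^esub>"
  shows "(\<Sum>j\<in>J. frag_of (\<Oplus>\<^bsub>N\<^esub>i\<in>I. g i j \<odot>\<^bsub>N\<^esub> e i, m j)) \<in> tensor_relations R N M"
proof -
  interpret N: module R N by fact
  interpret M: module R M by fact
  let ?T = "tensor_relations R N M"
  note sums = tensor_relations_sum[OF NM]
  note add = tensor_relations_closed(2)[OF NM]
  have 1: "(\<Sum>j\<in>J. frag_of (\<Oplus>\<^bsub>N\<^esub>i\<in>I. g i j \<odot>\<^bsub>N\<^esub> e i, m j) - (\<Sum>i\<in>I. frag_of (g i j \<odot>\<^bsub>N\<^esub> e i, m j))) \<in> ?T"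
    using g e m by (intro sums tensor_relations_finsum[OF NM fin(1)]) auto
  have 2: "(\<Sum>j\<in>J. \<Sum>i\<in>I. frag_of (g i j \<odot>\<^bsub>N\<^esub> e i, m j) - frag_of (e i, g i j \<odot>\<^bsub>M\<^esub> m j)) \<in> ?T"
    using g e m by (intro sums tensor_relations_gens) auto
  have "frag_of (e i, \<Oplus>\<^bsub>M\<^esub>j\<in>J. g i j \<odot>\<^bsub>M\<^esub> m j) - (\<Sum>j\<in>J. frag_of (e i, g i j \<odot>\<^bsub>M\<^esub> m j)) \<in> ?T" if "i \<in> I" for i
    using g e m that by (intro tensor_relations_finsum[OF NM fin(2)]) auto
  moreover have "frag_of (e i, \<Oplus>\<^bsub>M\<^esub>j\<in>J. g i j \<odot>\<^bsub>M\<^esub> m j) \<in> ?T" if "i \<in> I" for i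
    using that e by (simp add: zero tensor_relations_zero NM)
  ultimately have "(\<Sum>j\<in>J. frag_of (e i, g i j \<odot>\<^bsub>M\<^esub> m j)) \<in> ?T" if "i \<in> I" for i
    using tensor_relations_closed(4)[OF NM] that by force
  then have 3: "(\<Sum>i\<in>I. \<Sum>j\<in>J. frag_of (e i, g i j \<odot>\<^bsub>M\<^esub> m j)) \<in> ?T"
    by (rule sums)
  from add[OF add[OF 1 2] 3] show ?thesis
    by (simp add: sum_subtractf sum.swap[of _ J I])
qed

section \<open>Finitely presented flat modules are projective\<close>

text \<open>Let the rows \<open>g i\<close> generate the relations among the generators
  \<open>m j\<close>. The columns of this matrix satisfy a vanishing tensor relation with the
  \<open>m j\<close>, so the equational criterion writes \<open>m j\<close> as the sum of
  \<open>a l j \<odot> y l\<close> with every \<open>a l\<close> orthogonal to all rows. Pairing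
  with \<open>a l\<close> then kills the relations and descends to a functional \<open>f l\<close>
  on \<open>M\<close>; the \<open>y l\<close> and \<open>f l\<close> form the dual basis.\<close>

theorem flat_finitely_presented_dual_basis:
  assumes M_module: "module R M" and flat: "flat_module R M" and fp: "finitely_presented_module R M"
  shows "\<exists>n x f. dual_basis R M n x f"
proof -
  interpret M: module R M by fact
  obtain n :: nat and h G where h: "h \<in> linear_maps R (free_module R {..<n}) M"
    and surj: "h ` carrier (free_module R {..<n}) = carrier M"
    and G: "finite G" "G \<subseteq> carrier (free_module R {..<n})"
    and ker: "a_kernel (free_module R {..<n}) M h = module_span R (free_module R {..<n}) G"
    using fp unfolding finitely_presented_module_def by blast
  let ?F = "free_module R {..<n}"
  have F_module: "module R ?F"
    by (rule M.free_module_is_module)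
  interpret F: module R ?F by fact
  define m where "m j = h (free_gen R j)" for j
  have m: "m j \<in> carrier M" if "j < n" for j
    unfolding m_def using that by (intro linear_mapsD(1)[OF h] M.free_gen_closed) simp
  have h_eq: "h v = (\<Oplus>\<^bsub>M\<^esub>j\<in>{..<n}. v j \<odot>\<^bsub>M\<^esub> m j)" if v: "v \<in> carrier ?F" for v
  proof -
    have vj: "v j \<in> carrier R" for j
      using v by (rule M.free_module_coeff)
    have gen: "free_gen R j \<in> carrier ?F" if "j < n" for j
      using that by (intro M.free_gen_closed) simp
    have "h v = h (\<Oplus>\<^bsub>?F\<^esub>j\<in>{..<n}. v j \<odot>\<^bsub>?F\<^esub> free_gen R j)"
      using M.free_module_decomp[OF _ v] by simp
    also have "\<dots> = (\<Oplus>\<^bsub>M\<^esub>j\<in>{..<n}. h (v j \<odot>\<^bsub>?F\<^esub> free_gen R j))"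
      using vj gen by (intro linear_maps_finsum[OF F_module M_module h]) (auto)
    also have "\<dots> = (\<Oplus>\<^bsub>M\<^esub>j\<in>{..<n}. v j \<odot>\<^bsub>M\<^esub> m j)"
      using vj gen m by (intro M.finsum_cong')
        (auto simp: m_def linear_mapsD(3)[OF h])
    finally show ?thesis .
  qed
  obtain k :: nat and g where Gg: "G = g ` {..<k}"
    using G(1) by (metis finite_imp_nat_seg_image_inj_on lessThan_def)
  have gF: "g i \<in> carrier ?F" if "i < k" for i
    using G(2) Gg that by auto
  have gR: "g i j \<in> carrier R" if "i < k" for i j
    using gF[OF that] by (rule M.free_module_coeff)
  let ?P = "free_module R {..<k}"
  let ?N = "singleton_module ?P"
  have P_module: "module R ?P"
    by (rule M.free_module_is_module)
  have N_module: "module R ?N"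
    using P_module by (rule singleton_module_is_module)
  interpret P: module R ?P by fact
  interpret N: module R ?N by fact
  \<comment> \<open>The \<open>j\<close>-th column of the relation matrix, as an element of the free
    module of rank \<open>k\<close>.\<close>
  define \<gamma>0 where "\<gamma>0 j = (\<Oplus>\<^bsub>?P\<^esub>i\<in>{..<k}. g i j \<odot>\<^bsub>?P\<^esub> free_gen R i)" for j
  have genP: "free_gen R i \<in> carrier ?P" if "i < k" for i
    using that by (intro M.free_gen_closed) simp
  have smP: "g i j \<odot>\<^bsub>?P\<^esub> free_gen R i \<in> carrier ?P" if "i < k" for i j
    using gR genP that by (intro P.smult_closed)
  have \<gamma>0: "\<gamma>0 j \<in> carrier ?P" for j
    unfolding \<gamma>0_def using smP by (intro P.finsum_closed) auto
  have \<gamma>0_coeff: "\<gamma>0 j i = g i j" if "i < k" for i j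
  proof -
    have "\<gamma>0 j i = (\<Oplus>\<^bsub>R\<^esub>l\<in>{..<k}. g l j \<otimes>\<^bsub>R\<^esub> free_gen R l i)"
      unfolding \<gamma>0_def using smP by (subst M.free_module_finsum) (simp_all add: Pi_def free_module_simps)
    also have "\<dots> = (\<Oplus>\<^bsub>R\<^esub>l\<in>{..<k}. if l = i then g i j else \<zero>\<^bsub>R\<^esub>)"
      using gR that by (intro M.R.finsum_cong') (auto simp: free_gen_def)
    also have "\<dots> = g i j"
      using gR that by (intro M.R.finsum_delta) auto
    finally show ?thesis .
  qed
  note single = singleton_module_linear[of R ?P]
  have "flat_relation R ?N M n (\<lambda>j. {\<gamma>0 j})"
    by (intro flat_relation.intro N_module M_module linear_mapsD(1)[OF single] \<gamma>0)
  then interpret flat_relation R ?N M n "\<lambda>j. {\<gamma>0 j}" .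
  have comb_eq: "comb a = {\<Oplus>\<^bsub>?P\<^esub>j\<in>{..<n}. a j \<odot>\<^bsub>?P\<^esub> \<gamma>0 j}" if a: "a \<in> carrier ?F" for a
  proof -
    have aj: "a j \<in> carrier R" for j
      using a by (rule M.free_module_coeff)
    have "{\<Oplus>\<^bsub>?P\<^esub>j\<in>{..<n}. a j \<odot>\<^bsub>?P\<^esub> \<gamma>0 j} = (\<Oplus>\<^bsub>?N\<^esub>j\<in>{..<n}. {a j \<odot>\<^bsub>?P\<^esub> \<gamma>0 j})"
      using aj \<gamma>0 by (intro linear_maps_finsum[OF P_module N_module single]) auto
    also have "\<dots> = comb a"
      unfolding comb_def using aj \<gamma>0 linear_mapsD(1)[OF single]
      by (intro N.finsum_cong') (auto simp: linear_mapsD(3)[OF single])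
    finally show ?thesis ..
  qed
  \<comment> \<open>A syzygy of the columns, read coordinate by coordinate, is a vector orthogonal
    to every row.\<close>
  have syz_orth: "(\<Oplus>\<^bsub>R\<^esub>j\<in>{..<n}. g i j \<otimes>\<^bsub>R\<^esub> a j) = \<zero>\<^bsub>R\<^esub>" if a: "a \<in> syz" and i: "i < k" for a i
  proof -
    have aF: "a \<in> carrier ?F"
      using a by (simp add: syz_def)
    have aj: "a j \<in> carrier R" for j
      using a by (rule syz_coeff)
    have sm: "a j \<odot>\<^bsub>?P\<^esub> \<gamma>0 j \<in> carrier ?P" for j
      using aj \<gamma>0 by (intro P.smult_closed)
    have "(\<Oplus>\<^bsub>?P\<^esub>j\<in>{..<n}. a j \<odot>\<^bsub>?P\<^esub> \<gamma>0 j) = \<zero>\<^bsub>?P\<^esub>"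
      using a comb_eq[OF aF] by (simp add: syz_def singleton_module_zero)
    then have "(\<Oplus>\<^bsub>?P\<^esub>j\<in>{..<n}. a j \<odot>\<^bsub>?P\<^esub> \<gamma>0 j) i = \<zero>\<^bsub>R\<^esub>"
      by (simp add: free_module_simps)
    then have "(\<Oplus>\<^bsub>R\<^esub>j\<in>{..<n}. a j \<otimes>\<^bsub>R\<^esub> g i j) = \<zero>\<^bsub>R\<^esub>"
      using sm by (subst (asm) M.free_module_finsum) (simp_all add: Pi_def \<gamma>0_coeff i free_module_simps)
    moreover have "(\<Oplus>\<^bsub>R\<^esub>j\<in>{..<n}. a j \<otimes>\<^bsub>R\<^esub> g i j) = (\<Oplus>\<^bsub>R\<^esub>j\<in>{..<n}. g i j \<otimes>\<^bsub>R\<^esub> a j)"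
      using aj gR i by (intro M.R.finsum_cong') (auto simp: M.R.m_comm)
    ultimately show ?thesis
      by simp
  qed
  have "{\<gamma>0 j} = (\<Oplus>\<^bsub>?N\<^esub>i\<in>{..<k}. g i j \<odot>\<^bsub>?N\<^esub> {free_gen R i})" for j
  proof -
    have "{\<gamma>0 j} = (\<Oplus>\<^bsub>?N\<^esub>i\<in>{..<k}. {g i j \<odot>\<^bsub>?P\<^esub> free_gen R i})"
      unfolding \<gamma>0_def using smP by (intro linear_maps_finsum[OF P_module N_module single]) auto
    also have "\<dots> = (\<Oplus>\<^bsub>?N\<^esub>i\<in>{..<k}. g i j \<odot>\<^bsub>?N\<^esub> {free_gen R i})"
      using gR genP linear_mapsD(1)[OF single]
      by (intro N.finsum_cong') (auto simp: linear_mapsD(3)[OF single])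
    finally show ?thesis .
  qed
  moreover have "(\<Sum>j<n. frag_of (\<Oplus>\<^bsub>?N\<^esub>i\<in>{..<k}. g i j \<odot>\<^bsub>?N\<^esub> {free_gen R i}, m j)) \<in>
      tensor_relations R ?N M"
  proof (rule tensor_relations_matrix[OF N_module M_module])
    fix i assume i: "i \<in> {..<k}"
    show "(\<Oplus>\<^bsub>M\<^esub>j\<in>{..<n}. g i j \<odot>\<^bsub>M\<^esub> m j) = \<zero>\<^bsub>M\<^esub>"
      using h_eq[OF gF] i module_span_superset[of G R ?F] ker by (force simp: a_kernel_def' Gg)
  qed (use gR genP m linear_mapsD(1)[OF single] in auto)
  ultimately have rel: "(\<Sum>j<n. frag_of ({\<gamma>0 j}, m j)) \<in> tensor_relations R ?N M"
    by simp
  have "tensor_tuple M n syz m"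
    using flat m rel by (rule flat_vanishing)
  then obtain p :: nat and a y where a: "\<And>l. l < p \<Longrightarrow> a l \<in> syz" and y: "\<And>l. l < p \<Longrightarrow> y l \<in> carrier M"
    and m_eq: "\<And>j. j < n \<Longrightarrow> m j = (\<Oplus>\<^bsub>M\<^esub>l\<in>{..<p}. a l j \<odot>\<^bsub>M\<^esub> y l)"
    by (auto simp: tensor_tuple_def)
  have aR: "a l j \<in> carrier R" if "l < p" for l j
    using a[OF that] by (rule syz_coeff)
  define \<phi> where "\<phi> l v = (\<Oplus>\<^bsub>R\<^esub>j\<in>{..<n}. v j \<otimes>\<^bsub>R\<^esub> a l j)" for l v
  \<comment> \<open>The value is computed on an arbitrary preimage under \<open>h\<close>;
    \<open>\<phi>_ker\<close> makes it independent of that choice.\<close>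
  define f where "f l x = \<phi> l (SOME v. v \<in> carrier ?F \<and> h v = x)" for l x
  have reg: "module R (regular_module R)"
    by (rule M.regular_module_is_module)
  have \<phi>: "\<phi> l \<in> linear_maps R ?F (regular_module R)" if "l < p" for l
    using module.free_module_comb_linear[OF reg, of "{..<n}" "a l"] aR[OF that]
    by (simp add: \<phi>_def[abs_def] Pi_def)
  have \<phi>_ker: "\<phi> l v = \<zero>\<^bsub>R\<^esub>" if l: "l < p" and v: "v \<in> carrier ?F" "h v = \<zero>\<^bsub>M\<^esub>" for l v
  proof -
    \<comment> \<open>The vectors killed by the pairing form a submodule, so it is enough that they
      include the finitely many generators of the kernel of \<open>h\<close>.\<close>
    have "submodule {v \<in> carrier ?F. \<phi> l v \<in> {\<zero>\<^bsub>regular_module R\<^esub>}} R ?F"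
      using F.submodule_vimage[OF reg \<phi>[OF l] module.submodule_zero[OF reg]] .
    moreover have "G \<subseteq> {v \<in> carrier ?F. \<phi> l v \<in> {\<zero>\<^bsub>regular_module R\<^esub>}}"
      using G(2) syz_orth[OF a[OF l]] by (auto simp: Gg \<phi>_def)
    ultimately have "module_span R ?F G \<subseteq> {v \<in> carrier ?F. \<phi> l v \<in> {\<zero>\<^bsub>regular_module R\<^esub>}}"
      by (rule module_span_minimal)
    then show ?thesis
      using v ker by (auto simp: a_kernel_def')
  qed
  have f_h: "f l (h v) = \<phi> l v" if l: "l < p" and v: "v \<in> carrier ?F" for l v
  proof -
    let ?w = "SOME w. w \<in> carrier ?F \<and> h w = h v"
    have w: "?w \<in> carrier ?F \<and> h ?w = h v"
      using v by (intro someI[of "\<lambda>w. w \<in> carrier ?F \<and> h w = h v" v]) simp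
    have "h (?w \<ominus>\<^bsub>?F\<^esub> v) = \<zero>\<^bsub>M\<^esub>"
      using w v linear_mapsD(1)[OF h v]
      by (simp add: a_minus_def linear_mapsD(2)[OF h] linear_maps_minus[OF F_module M_module h] M.r_neg)
    then have "\<phi> l (?w \<ominus>\<^bsub>?F\<^esub> v) = \<zero>\<^bsub>R\<^esub>"
      using w v by (intro \<phi>_ker[OF l] F.minus_closed) auto
    moreover have "\<phi> l (?w \<ominus>\<^bsub>?F\<^esub> v) = \<phi> l ?w \<ominus>\<^bsub>regular_module R\<^esub> \<phi> l v"
      using w v linear_mapsD(1)[OF \<phi>[OF l] v]
      by (simp add: a_minus_def linear_mapsD(2)[OF \<phi>[OF l], simplified]
          linear_maps_minus[OF F_module reg \<phi>[OF l]])
    ultimately show ?thesis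
      unfolding f_def using w v linear_mapsD(1)[OF \<phi>[OF l]]
        abelian_group.minus_eq_zero_iff[OF module.axioms(2)[OF reg], of "\<phi> l ?w" "\<phi> l v"] by auto
  qed
  show ?thesis
  proof (intro exI)
    show "dual_basis R M p y f"
      unfolding dual_basis_def
    proof (intro conjI allI impI ballI)
      fix l assume l: "l < p"
      show "y l \<in> carrier M"
        using y l .
      show "f l \<in> linear_maps R M (regular_module R)"
      proof (intro linear_mapsI)
        fix u v assume "u \<in> carrier M" "v \<in> carrier M"
        then obtain u' v' where u': "u' \<in> carrier ?F" "u = h u'" and v': "v' \<in> carrier ?F" "v = h v'"
          using surj by blast
        have "f l (u \<oplus>\<^bsub>M\<^esub> v) = f l (h (u' \<oplus>\<^bsub>?F\<^esub> v'))"
          using u' v' by (simp add: linear_mapsD(2)[OF h])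
        also have "\<dots> = \<phi> l u' \<oplus>\<^bsub>R\<^esub> \<phi> l v'"
          using u' v' linear_mapsD(2)[OF \<phi>[OF l]] by (simp add: f_h l)
        finally show "f l (u \<oplus>\<^bsub>M\<^esub> v) = f l u \<oplus>\<^bsub>regular_module R\<^esub> f l v"
          using u' v' l by (simp add: f_h)
      next
        fix r u assume r: "r \<in> carrier R" and "u \<in> carrier M"
        then obtain u' where u': "u' \<in> carrier ?F" "u = h u'"
          using surj by blast
        have "f l (r \<odot>\<^bsub>M\<^esub> u) = f l (h (r \<odot>\<^bsub>?F\<^esub> u'))"
          using u' r by (simp add: linear_mapsD(3)[OF h])
        also have "\<dots> = r \<otimes>\<^bsub>R\<^esub> \<phi> l u'"
          using u' r linear_mapsD(3)[OF \<phi>[OF l]] by (simp add: f_h l)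
        finally show "f l (r \<odot>\<^bsub>M\<^esub> u) = r \<odot>\<^bsub>regular_module R\<^esub> f l u"
          using u' l by (simp add: f_h)
      next
        fix u assume "u \<in> carrier M"
        then obtain u' where u': "u' \<in> carrier ?F" "u = h u'"
          using surj by blast
        then show "f l u \<in> carrier (regular_module R)"
          using linear_mapsD(1)[OF \<phi>[OF l]] by (simp add: f_h l)
      qed
    next
      fix u assume "u \<in> carrier M"
      then obtain v where v: "v \<in> carrier ?F" "u = h v"
        using surj by blast
      have vR: "v j \<in> carrier R" for j
        using v(1) by (rule M.free_module_coeff)
      \<comment> \<open>Each \<open>m j\<close> is replaced by its expansion in the
        \<open>y l\<close>; after the sums are exchanged, the coefficient of \<open>y l\<close> is
        the pairing of \<open>v\<close> with \<open>a l\<close>.\<close>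
      have "u = (\<Oplus>\<^bsub>M\<^esub>j\<in>{..<n}. v j \<odot>\<^bsub>M\<^esub> (\<Oplus>\<^bsub>M\<^esub>l\<in>{..<p}. a l j \<odot>\<^bsub>M\<^esub> y l))"
        unfolding v(2) h_eq[OF v(1)] using vR y aR by (intro M.finsum_cong') (auto simp: m_eq intro!: M.finsum_closed)
      also have "\<dots> = (\<Oplus>\<^bsub>M\<^esub>j\<in>{..<n}. \<Oplus>\<^bsub>M\<^esub>l\<in>{..<p}. (v j \<otimes>\<^bsub>R\<^esub> a l j) \<odot>\<^bsub>M\<^esub> y l)"
        using vR y aR by (intro M.finsum_cong')
          (auto simp: M.finsum_smult_ldistr Pi_def M.smult_assoc1 intro!: M.finsum_closed M.finsum_cong')
      also have "\<dots> = (\<Oplus>\<^bsub>M\<^esub>l\<in>{..<p}. \<Oplus>\<^bsub>M\<^esub>j\<in>{..<n}. (v j \<otimes>\<^bsub>R\<^esub> a l j) \<odot>\<^bsub>M\<^esub> y l)"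
        using vR y aR by (intro M.finsum_swap) auto
      also have "\<dots> = (\<Oplus>\<^bsub>M\<^esub>l\<in>{..<p}. f l u \<odot>\<^bsub>M\<^esub> y l)"
        unfolding v(2) using vR y aR v(1)
        by (intro M.finsum_cong')
          (auto simp: f_h \<phi>_def M.finsum_smult_rdistr Pi_def intro!: M.smult_closed M.R.finsum_closed)
      finally show "u = (\<Oplus>\<^bsub>M\<^esub>l\<in>{..<p}. f l u \<odot>\<^bsub>M\<^esub> y l)" .
    qed
  qed
qed

section \<open>Idempotent ideals and formally unramified algebras\<close>

lemma (in ring) ideal_finsum_closed:
  assumes "ideal J R" "finite X" "\<And>i. i \<in> X \<Longrightarrow> f i \<in> J"
  shows "(\<Oplus>i\<in>X. f i) \<in> J"
  using assms(2,3)
proof (induction X rule: finite_induct)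
  case empty
  show ?case
    using additive_subgroup.zero_closed[OF ideal.axioms(1)[OF assms(1)]] by simp
next
  case (insert i X)
  have "f \<in> insert i X \<rightarrow> carrier R"
    using insert.prems ideal.Icarr[OF assms(1)] by auto
  then show ?case
    using insert additive_subgroup.a_closed[OF ideal.axioms(1)[OF assms(1)], of "f i" "finsum R f X"]
    by (simp add: Pi_def)
qed

lemma (in cring) mem_genideal_insert:
  assumes "d \<in> carrier R" "D \<subseteq> carrier R" "x \<in> Idl (insert d D)"
  shows "\<exists>s\<in>carrier R. \<exists>w\<in>Idl D. x = s \<otimes> d \<oplus> w"
proof -
  interpret D: ideal "Idl D" R
    by (rule genideal_ideal[OF assms(2)])
  interpret P: ideal "PIdl d" R
    by (rule cgenideal_ideal[OF assms(1)])
  have "d \<oplus> \<zero> \<in> set_add R (PIdl d) (Idl D)"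
    unfolding set_add_def' using cgenideal_self[OF assms(1)] D.zero_closed by blast
  then have "d \<in> set_add R (PIdl d) (Idl D)"
    using assms(1) by simp
  moreover have "y \<in> set_add R (PIdl d) (Idl D)" if "y \<in> D" for y
  proof -
    have "\<zero> \<oplus> y \<in> set_add R (PIdl d) (Idl D)"
      unfolding set_add_def' using genideal_self[OF assms(2)] P.zero_closed that by blast
    then show ?thesis
      using that assms(2) by (simp add: subsetD)
  qed
  ultimately have "insert d D \<subseteq> set_add R (PIdl d) (Idl D)"
    by blast
  then have "Idl (insert d D) \<subseteq> set_add R (PIdl d) (Idl D)"
    by (rule genideal_minimal[OF add_ideals[OF P.ideal_axioms D.ideal_axioms]])
  then have "x \<in> set_add R (PIdl d) (Idl D)"
    using assms(3) by blast
  then obtain p w where "p \<in> PIdl d" "w \<in> Idl D" "x = p \<oplus> w"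
    unfolding set_add_def' by blast
  then show ?thesis
    unfolding cgenideal_def by blast
qed

text \<open>The gain over \<open>mem_genideal_insert\<close> is that the coefficient of
  \<open>d\<close> lies in \<open>J\<close>. It can then be subtracted from the multiplier in the
  elimination without leaving \<open>1 + J\<close>.\<close>

lemma (in cring) mem_ideal_prod_insert:
  assumes J: "ideal J R" and d: "d \<in> carrier R" and D: "D \<subseteq> carrier R"
    and x: "x \<in> ideal_prod R J (Idl (insert d D))"
  shows "\<exists>s\<in>J. \<exists>w\<in>Idl D. x = s \<otimes> d \<oplus> w"
  using x
proof (induction rule: ideal_prod.induct)
  interpret J: ideal J R by fact
  interpret D: ideal "Idl D" R
    by (rule genideal_ideal[OF D])
  case (prod i j)
  then obtain s w where sw: "s \<in> carrier R" "w \<in> Idl D" "j = s \<otimes> d \<oplus> w"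
    using mem_genideal_insert[OF d D] by blast
  have "i \<otimes> j = (i \<otimes> s) \<otimes> d \<oplus> i \<otimes> w"
    using prod sw d by (simp add: r_distr m_assoc)
  moreover have "i \<otimes> s \<in> J" "i \<otimes> w \<in> Idl D"
    using J.I_r_closed[OF prod(1) sw(1)] D.I_l_closed[OF sw(2) J.Icarr[OF prod(1)]] .
  ultimately show ?case
    by blast
next
  interpret J: ideal J R by fact
  interpret D: ideal "Idl D" R
    by (rule genideal_ideal[OF D])
  case (sum x1 x2)
  then obtain s1 w1 s2 w2 where *: "s1 \<in> J" "w1 \<in> Idl D" "x1 = s1 \<otimes> d \<oplus> w1"
    "s2 \<in> J" "w2 \<in> Idl D" "x2 = s2 \<otimes> d \<oplus> w2"
    by blast
  then have "x1 \<oplus> x2 = (s1 \<oplus> s2) \<otimes> d \<oplus> (w1 \<oplus> w2)"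
    using d by (simp add: l_distr a_ac)
  moreover have "s1 \<oplus> s2 \<in> J" "w1 \<oplus> w2 \<in> Idl D"
    using * by (auto intro: J.a_closed D.a_closed)
  ultimately show ?case
    by blast
qed

text \<open>In each product the factor \<open>e\<close> can be moved onto the second element, where
  \<open>eJ\<close> applies.\<close>

lemma (in cring) ideal_prod_scale:
  assumes J: "ideal J R" and K: "ideal K R" and e: "e \<in> carrier R" and eJ: "\<And>x. x \<in> J \<Longrightarrow> e \<otimes> x \<in> K"
    and x: "x \<in> ideal_prod R J J"
  shows "e \<otimes> x \<in> ideal_prod R J K"
  using x
proof (induction rule: ideal_prod.induct)
  case (prod i j)
  have "e \<otimes> (i \<otimes> j) = i \<otimes> (e \<otimes> j)"
    using prod ideal.Icarr[OF J] e by (simp add: m_lcomm)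
  then show ?case
    using ideal_prod.prod[OF prod(1) eJ[OF prod(2)], of R] by simp
next
  case (sum x1 x2)
  have "x1 \<in> carrier R" "x2 \<in> carrier R"
    using sum(1,2) ideal_prod_in_carrier[OF J J] by auto
  then show ?case
    using sum(3,4) e by (simp add: r_distr ideal_prod.sum)
qed

text \<open>Nakayama's argument without determinants: the generators are eliminated one at a time,
  multiplying the current element of \<open>1 + J\<close> by another one.\<close>

lemma (in cring) idempotent_ideal_annihilator_aux:
  assumes J: "ideal J R" and JJ: "J \<subseteq> ideal_prod R J J" and "finite D" "D \<subseteq> J"
    and "e \<in> carrier R" "\<one> \<ominus> e \<in> J" "\<And>x. x \<in> J \<Longrightarrow> e \<otimes> x \<in> Idl D"
  shows "\<exists>e'\<in>carrier R. \<one> \<ominus> e' \<in> J \<and> (\<forall>x\<in>J. e' \<otimes> x = \<zero>)"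
  using assms(3-)
proof (induction D arbitrary: e rule: finite_induct)
  case empty
  \<comment> \<open>With no generators left, \<open>e\<close> itself annihilates
    \<open>J\<close>.\<close>
  have "Idl {} \<subseteq> {\<zero>}"
    using zeroideal by (rule genideal_minimal) simp
  then show ?case
    using empty.prems by blast
next
  case (insert d D)
  interpret J: ideal J R by fact
  have D: "D \<subseteq> carrier R" and d: "d \<in> carrier R" and dJ: "d \<in> J"
    using insert.prems J.Icarr by auto
  interpret D: ideal "Idl D" R
    by (rule genideal_ideal[OF D])
  have iD: "ideal (Idl (insert d D)) R"
    using d D by (intro genideal_ideal) auto
  have e: "e \<in> carrier R"
    by fact
  \<comment> \<open>Here \<open>J \<subseteq> J\<^sup>2\<close> enters: \<open>d\<close> is a sum of
    products from \<open>J\<close>, and \<open>e\<close> carries each second factor into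
    \<open>Idl (insert d D)\<close>. Hence \<open>e d = c d + w\<close> with \<open>c\<close> in
    \<open>J\<close>, that is \<open>(e - c) d = w\<close>.\<close>
  have "e \<otimes> d \<in> ideal_prod R J (Idl (insert d D))"
    using dJ JJ by (intro ideal_prod_scale[OF J iD e insert.prems(4)]) auto
  then obtain c w where cw: "c \<in> J" "w \<in> Idl D" "e \<otimes> d = c \<otimes> d \<oplus> w"
    using mem_ideal_prod_insert[OF J d D] by blast
  have c: "c \<in> carrier R" and w: "w \<in> carrier R"
    using cw J.Icarr D.Icarr by auto
  have "(e \<ominus> c) \<otimes> d = e \<otimes> d \<ominus> c \<otimes> d"
    using c d e by algebra
  also have "\<dots> = w"
    unfolding cw(3) using c d w by algebra
  finally have ec: "(e \<ominus> c) \<otimes> d = w" .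
  \<comment> \<open>The new multiplier is \<open>(e - c) e\<close>: the factor \<open>e\<close>
    brings \<open>J\<close> into \<open>Idl (insert d D)\<close>, and \<open>e - c\<close> then
    pushes the part along \<open>d\<close> into \<open>Idl D\<close>.\<close>
  show ?case
  proof (rule insert.IH)
    show "D \<subseteq> J" "(e \<ominus> c) \<otimes> e \<in> carrier R"
      using insert.prems c by auto
    have "\<one> \<ominus> (e \<ominus> c) \<otimes> e = (\<one> \<ominus> e) \<oplus> (\<one> \<ominus> e) \<otimes> e \<oplus> c \<otimes> e"
      using c e by algebra
    then show "\<one> \<ominus> (e \<ominus> c) \<otimes> e \<in> J"
      using insert.prems(3) cw(1) e J.I_r_closed J.a_closed by simp
    fix x assume x: "x \<in> J"
    then obtain s v where sv: "s \<in> carrier R" "v \<in> Idl D" "e \<otimes> x = s \<otimes> d \<oplus> v"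
      using mem_genideal_insert[OF d D insert.prems(4)] by blast
    have v: "v \<in> carrier R" and xR: "x \<in> carrier R"
      using sv D.Icarr J.Icarr x by auto
    have "(e \<ominus> c) \<otimes> e \<otimes> x = (e \<ominus> c) \<otimes> (e \<otimes> x)"
      using c e xR by (simp add: m_assoc)
    also have "\<dots> = s \<otimes> ((e \<ominus> c) \<otimes> d) \<oplus> (e \<ominus> c) \<otimes> v"
      unfolding sv(3) using c e d v sv(1) by algebra
    also have "\<dots> \<in> Idl D"
      unfolding ec using cw(2) sv c e by (intro D.a_closed D.I_l_closed) auto
    finally show "(e \<ominus> c) \<otimes> e \<otimes> x \<in> Idl D" .
  qed
qed

text \<open>The elimination is started at \<open>e = 1\<close> with the full set of
  generators.\<close>

lemma (in cring) idempotent_ideal_annihilator: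
  assumes "finite D" "D \<subseteq> carrier R" "Idl D \<subseteq> ideal_prod R (Idl D) (Idl D)"
  shows "\<exists>e\<in>carrier R. \<one> \<ominus> e \<in> Idl D \<and> (\<forall>x\<in>Idl D. e \<otimes> x = \<zero>)"
proof -
  interpret D: ideal "Idl D" R
    by (rule genideal_ideal[OF assms(2)])
  show ?thesis
    using D.zero_closed D.Icarr
    by (intro idempotent_ideal_annihilator_aux[of "Idl D" D \<one>] D.ideal_axioms assms genideal_self)
      (simp_all add: a_minus_def r_neg)
qed

text \<open>\<open>L\<close> and \<open>R\<close> stand for \<open>b \<mapsto> b \<otimes> 1\<close>
  and \<open>b \<mapsto> 1 \<otimes> b\<close>, and \<open>LR\<close> says that scalars pass through
  the tensor sign. Keeping \<open>S\<close> abstract allows a substitute for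
  \<open>B \<otimes> B\<close>.\<close>

locale algebra_pair =
  fixes A :: "('a, 'm) ring_scheme" and B :: "('a, 'b, 'k) module_scheme"
    and S :: "('s, 'n) ring_scheme" and L R :: "'b \<Rightarrow> 's"
  assumes algebra: "algebra A B" and S_cring: "cring S"
    and L_hom: "L \<in> ring_hom B S" and R_hom: "R \<in> ring_hom B S"
    and LR: "a \<in> carrier A \<Longrightarrow> L (a \<odot>\<^bsub>B\<^esub> \<one>\<^bsub>B\<^esub>) = R (a \<odot>\<^bsub>B\<^esub> \<one>\<^bsub>B\<^esub>)"
begin

sublocale B: cring B
  using algebra by (rule algebra.M_cring)

sublocale S: cring S
  by (rule S_cring)

sublocale AB: algebra A B
  by (rule algebra)

sublocale L: ring_hom_cring B S L
  using L_hom B.is_cring S_cring by (simp add: ring_hom_cring_def ring_hom_cring_axioms_def)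

sublocale R: ring_hom_cring B S R
  using R_hom B.is_cring S_cring by (simp add: ring_hom_cring_def ring_hom_cring_axioms_def)

definition d :: "'b \<Rightarrow> 's" where
  "d b = L b \<ominus>\<^bsub>S\<^esub> R b"

text \<open>In \<open>B \<otimes> B\<close> the elements
  \<open>b \<otimes> 1 - 1 \<otimes> b\<close> generate the kernel of the multiplication
  map.\<close>

definition J :: "'s set" where
  "J = genideal S (d ` carrier B)"

lemma d_closed [simp]: "b \<in> carrier B \<Longrightarrow> d b \<in> carrier S"
  by (simp add: d_def)

lemma d_add: "\<lbrakk>x \<in> carrier B; y \<in> carrier B\<rbrakk> \<Longrightarrow> d (x \<oplus>\<^bsub>B\<^esub> y) = d x \<oplus>\<^bsub>S\<^esub> d y"
proof -
  assume "x \<in> carrier B" "y \<in> carrier B"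
  then have "L x \<in> carrier S" "R x \<in> carrier S" "L y \<in> carrier S" "R y \<in> carrier S"
    and "d (x \<oplus>\<^bsub>B\<^esub> y) = L x \<oplus>\<^bsub>S\<^esub> L y \<ominus>\<^bsub>S\<^esub> (R x \<oplus>\<^bsub>S\<^esub> R y)"
    by (auto simp: d_def)
  then show ?thesis
    unfolding d_def by algebra
qed

text \<open>The Leibniz rule with an explicit error term: when \<open>B\<close> acts through
  \<open>L\<close>, the map \<open>d\<close> is a derivation modulo
  \<open>J\<^sup>2\<close>.\<close>

lemma d_mult:
  assumes "x \<in> carrier B" "y \<in> carrier B"
  shows "d (x \<otimes>\<^bsub>B\<^esub> y) \<ominus>\<^bsub>S\<^esub> (L x \<otimes>\<^bsub>S\<^esub> d y \<oplus>\<^bsub>S\<^esub> L y \<otimes>\<^bsub>S\<^esub> d x) = \<ominus>\<^bsub>S\<^esub> (d x \<otimes>\<^bsub>S\<^esub> d y)"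
proof -
  have "L x \<in> carrier S" "R x \<in> carrier S" "L y \<in> carrier S" "R y \<in> carrier S"
    and *: "d (x \<otimes>\<^bsub>B\<^esub> y) = L x \<otimes>\<^bsub>S\<^esub> L y \<ominus>\<^bsub>S\<^esub> R x \<otimes>\<^bsub>S\<^esub> R y"
    using assms by (auto simp: d_def)
  then show ?thesis
    unfolding * unfolding d_def by algebra
qed

lemma d_scalar: "a \<in> carrier A \<Longrightarrow> d (a \<odot>\<^bsub>B\<^esub> \<one>\<^bsub>B\<^esub>) = \<zero>\<^bsub>S\<^esub>"
  using LR[of a] R.hom_closed[of "a \<odot>\<^bsub>B\<^esub> \<one>\<^bsub>B\<^esub>"] by (simp add: d_def a_minus_def S.r_neg)

lemma d_smult:
  assumes "a \<in> carrier A" "x \<in> carrier B"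
  shows "d (a \<odot>\<^bsub>B\<^esub> x) = L (a \<odot>\<^bsub>B\<^esub> \<one>\<^bsub>B\<^esub>) \<otimes>\<^bsub>S\<^esub> d x"
proof -
  let ?a = "a \<odot>\<^bsub>B\<^esub> \<one>\<^bsub>B\<^esub>"
  have a: "?a \<in> carrier B"
    using assms by simp
  have "a \<odot>\<^bsub>B\<^esub> x = ?a \<otimes>\<^bsub>B\<^esub> x"
    using assms by (simp add: AB.smult_assoc2)
  then have "d (a \<odot>\<^bsub>B\<^esub> x) = L ?a \<otimes>\<^bsub>S\<^esub> L x \<ominus>\<^bsub>S\<^esub> L ?a \<otimes>\<^bsub>S\<^esub> R x"
    using assms a LR[of a] by (simp add: d_def)
  moreover have "L ?a \<in> carrier S" "L x \<in> carrier S" "R x \<in> carrier S"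
    using assms a by auto
  ultimately show ?thesis
    unfolding d_def by (simp only:) algebra
qed

lemma J_ideal: "ideal J S"
  unfolding J_def by (intro S.genideal_ideal) auto

lemma d_J: "b \<in> carrier B \<Longrightarrow> d b \<in> J"
  using S.genideal_self[of "d ` carrier B"] d_closed unfolding J_def by blast

text \<open>Every \<open>b\<close> is an \<open>A\<close>-combination of the \<open>e l\<close>, and
  \<open>d\<close> is additive and compatible with scalars from \<open>A\<close>, so the
  \<open>d (e l)\<close> suffice.\<close>

lemma J_finitely_generated:
  assumes "dual_basis A B n e f"
  shows "J = genideal S (d ` e ` {..<n})"
proof
  have e: "e l \<in> carrier B" and f: "f l \<in> linear_maps A B (regular_module A)" if "l < n" for l
    using assms that by (auto simp: dual_basis_def)
  show "genideal S (d ` e ` {..<n}) \<subseteq> J"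
    using e d_J by (intro S.genideal_minimal J_ideal) auto
  have sub: "d ` e ` {..<n} \<subseteq> carrier S"
    using e by auto
  have I: "ideal (genideal S (d ` e ` {..<n})) S"
    by (rule S.genideal_ideal[OF sub])
  have "d b \<in> genideal S (d ` e ` {..<n})" if b: "b \<in> carrier B" for b
  proof -
    have fb: "f l b \<in> carrier A" if "l < n" for l
      using linear_mapsD(1)[OF f[OF that] b] by simp
    have "d b = d (\<Oplus>\<^bsub>B\<^esub>l\<in>{..<n}. f l b \<odot>\<^bsub>B\<^esub> e l)"
      using assms b by (simp add: dual_basis_def)
    also have "\<dots> = (\<Oplus>\<^bsub>S\<^esub>l\<in>{..<n}. d (f l b \<odot>\<^bsub>B\<^esub> e l))"
      using fb e B.abelian_group_axioms S.abelian_group_axioms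
      by (intro additive_finsum) (auto simp: hom_def d_add)
    also have "\<dots> \<in> genideal S (d ` e ` {..<n})"
      using fb e S.genideal_self[OF sub]
      by (intro S.ideal_finsum_closed[OF I]) (auto simp: d_smult intro!: ideal.I_l_closed[OF I])
    finally show ?thesis .
  qed
  then show "J \<subseteq> genideal S (d ` e ` {..<n})"
    unfolding J_def by (intro S.genideal_minimal I) auto
qed

text \<open>The \<open>B\<close>-linear map, with \<open>B\<close> acting on \<open>S\<close>
  through \<open>L\<close>, that sends the symbol \<open>free_gen B b\<close> to \<open>d b\<close>.
  Modulo \<open>J\<^sup>2\<close> it induces the standard map from the differentials to
  \<open>J / J\<^sup>2\<close>.\<close>

definition lift :: "('b \<Rightarrow> 'b) \<Rightarrow> 's" where
  "lift f = (\<Oplus>\<^bsub>S\<^esub>b\<in>{b. f b \<noteq> \<zero>\<^bsub>B\<^esub>}. L (f b) \<otimes>\<^bsub>S\<^esub> d b)"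

text \<open>Summing over any larger finite set gives the same value, so that functions with
  different supports can be compared on a common set.\<close>

lemma lift_eq:
  assumes "f \<in> carrier (free_module B (carrier B))" "finite X" "X \<subseteq> carrier B" "{b. f b \<noteq> \<zero>\<^bsub>B\<^esub>} \<subseteq> X"
  shows "lift f = (\<Oplus>\<^bsub>S\<^esub>b\<in>X. L (f b) \<otimes>\<^bsub>S\<^esub> d b)"
  unfolding lift_def
proof (rule S.add.finprod_mono_neutral_cong_left[OF assms(2,4)])
  have "f b \<in> carrier B" for b
    using assms(1) by (rule B.free_module_coeff)
  then show "(\<lambda>b. L (f b) \<otimes>\<^bsub>S\<^esub> d b) \<in> X \<rightarrow> carrier S"
    using assms(3) by auto
  show "L (f b) \<otimes>\<^bsub>S\<^esub> d b = \<zero>\<^bsub>S\<^esub>" if "b \<in> X - {b. f b \<noteq> \<zero>\<^bsub>B\<^esub>}" for b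
    using that assms(3) by auto
qed simp

lemma lift_linear:
  assumes f: "f \<in> carrier (free_module B (carrier B))"
  shows "lift f \<in> carrier S"
    and "g \<in> carrier (free_module B (carrier B)) \<Longrightarrow>
      lift (f \<oplus>\<^bsub>free_module B (carrier B)\<^esub> g) = lift f \<oplus>\<^bsub>S\<^esub> lift g"
    and "a \<in> carrier B \<Longrightarrow> lift (a \<odot>\<^bsub>free_module B (carrier B)\<^esub> f) = L a \<otimes>\<^bsub>S\<^esub> lift f"
    and "lift (\<ominus>\<^bsub>free_module B (carrier B)\<^esub> f) = \<ominus>\<^bsub>S\<^esub> lift f"
proof -
  let ?F = "free_module B (carrier B)"
  interpret F: module B ?F
    by (rule B.free_module_is_module)
  have supp: "finite {b. g b \<noteq> \<zero>\<^bsub>B\<^esub>}" "{b. g b \<noteq> \<zero>\<^bsub>B\<^esub>} \<subseteq> carrier B" "g b \<in> carrier B"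
    if "g \<in> carrier ?F" for g b
    using that B.free_module_coeff[OF that] by (auto simp: free_module_carrier)
  show closed: "lift f \<in> carrier S"
    unfolding lift_def using supp[OF f] by (intro S.finsum_closed) auto
  show "lift (f \<oplus>\<^bsub>?F\<^esub> g) = lift f \<oplus>\<^bsub>S\<^esub> lift g" if g: "g \<in> carrier ?F"
  proof -
    let ?X = "{b. f b \<noteq> \<zero>\<^bsub>B\<^esub>} \<union> {b. g b \<noteq> \<zero>\<^bsub>B\<^esub>}"
    have X: "finite ?X" "?X \<subseteq> carrier B"
      using supp f g by auto
    have "lift (f \<oplus>\<^bsub>?F\<^esub> g) = (\<Oplus>\<^bsub>S\<^esub>b\<in>?X. L ((f \<oplus>\<^bsub>?F\<^esub> g) b) \<otimes>\<^bsub>S\<^esub> d b)"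
      using f g by (intro lift_eq X F.a_closed) (auto simp: free_module_simps)
    also have "\<dots> = (\<Oplus>\<^bsub>S\<^esub>b\<in>?X. L (f b) \<otimes>\<^bsub>S\<^esub> d b \<oplus>\<^bsub>S\<^esub> L (g b) \<otimes>\<^bsub>S\<^esub> d b)"
      using supp(3)[OF f] supp(3)[OF g] X
      by (intro S.finsum_cong') (auto simp: free_module_simps S.l_distr)
    also have "\<dots> = (\<Oplus>\<^bsub>S\<^esub>b\<in>?X. L (f b) \<otimes>\<^bsub>S\<^esub> d b) \<oplus>\<^bsub>S\<^esub> (\<Oplus>\<^bsub>S\<^esub>b\<in>?X. L (g b) \<otimes>\<^bsub>S\<^esub> d b)"
      using supp(3)[OF f] supp(3)[OF g] X by (intro S.finsum_addf) auto
    also have "\<dots> = lift f \<oplus>\<^bsub>S\<^esub> lift g"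
      using lift_eq[OF f X] lift_eq[OF g X] by simp
    finally show ?thesis .
  qed
  show smult: "lift (a \<odot>\<^bsub>?F\<^esub> f) = L a \<otimes>\<^bsub>S\<^esub> lift f" if a: "a \<in> carrier B" for a
  proof -
    let ?X = "{b. f b \<noteq> \<zero>\<^bsub>B\<^esub>}"
    have X: "finite ?X" "?X \<subseteq> carrier B"
      using supp f by auto
    have "lift (a \<odot>\<^bsub>?F\<^esub> f) = (\<Oplus>\<^bsub>S\<^esub>b\<in>?X. L ((a \<odot>\<^bsub>?F\<^esub> f) b) \<otimes>\<^bsub>S\<^esub> d b)"
      using f a by (intro lift_eq X F.smult_closed) (auto simp: free_module_simps)
    also have "\<dots> = (\<Oplus>\<^bsub>S\<^esub>b\<in>?X. L a \<otimes>\<^bsub>S\<^esub> (L (f b) \<otimes>\<^bsub>S\<^esub> d b))"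
      using supp(3)[OF f] X a by (intro S.finsum_cong') (auto simp: free_module_simps S.m_assoc)
    also have "\<dots> = L a \<otimes>\<^bsub>S\<^esub> lift f"
      unfolding lift_def using supp(3)[OF f] X a by (subst S.finsum_rdistr) auto
    finally show ?thesis .
  qed
  have "\<ominus>\<^bsub>?F\<^esub> f = (\<ominus>\<^bsub>B\<^esub> \<one>\<^bsub>B\<^esub>) \<odot>\<^bsub>?F\<^esub> f"
    using f by (simp add: F.smult_l_minus)
  then show "lift (\<ominus>\<^bsub>?F\<^esub> f) = \<ominus>\<^bsub>S\<^esub> lift f"
    using closed by (simp add: smult S.l_minus)
qed

lemma lift_free_gen: "b \<in> carrier B \<Longrightarrow> lift (free_gen B b) = d b"
proof -
  assume b: "b \<in> carrier B"
  have "lift (free_gen B b) = (\<Oplus>\<^bsub>S\<^esub>c\<in>{b}. L (free_gen B b c) \<otimes>\<^bsub>S\<^esub> d c)"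
    using b by (intro lift_eq B.free_gen_closed) (auto simp: free_gen_def)
  then show ?thesis
    using b by (simp add: free_gen_def)
qed

text \<open>The preimage of \<open>J\<^sup>2\<close> under \<open>lift\<close> is a submodule
  containing all Kaehler relations, the Leibniz relation by \<open>d_mult\<close>. If the
  differentials vanish, every symbol is itself a relation, so its image \<open>d b\<close> lies in
  \<open>J\<^sup>2\<close>.\<close>

lemma formally_unramified_d:
  assumes "formally_unramified A B" "b \<in> carrier B"
  shows "d b \<in> ideal_prod S J J"
proof -
  let ?F = "free_module B (carrier B)"
  let ?Q = "ideal_prod S J J"
  interpret F: module B ?F
    by (rule B.free_module_is_module)
  interpret Q: ideal ?Q S
    by (rule S.ideal_prod_is_ideal[OF J_ideal J_ideal])
  let ?H = "{f \<in> carrier ?F. lift f \<in> ?Q}"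
  have gen: "free_gen B x \<in> carrier ?F" if "x \<in> carrier B" for x
    using that by (rule B.free_gen_closed)
  have H: "submodule ?H B ?F"
  proof (intro F.submoduleI)
    have "lift \<zero>\<^bsub>?F\<^esub> = \<zero>\<^bsub>S\<^esub>"
      by (simp add: lift_def free_module_simps)
    then show "\<zero>\<^bsub>?F\<^esub> \<in> ?H"
      using Q.zero_closed by simp
  qed (auto simp: lift_linear intro: Q.I_l_closed Q.a_inv_closed Q.a_closed)
  have "kaehler_relations A B \<subseteq> ?H"
    unfolding kaehler_relations_def Let_def
  proof (rule module_span_minimal[OF H], safe)
    fix x y assume x: "x \<in> carrier B" and y: "y \<in> carrier B"
    show "free_gen B (x \<oplus>\<^bsub>B\<^esub> y) \<ominus>\<^bsub>?F\<^esub> (free_gen B x \<oplus>\<^bsub>?F\<^esub> free_gen B y) \<in> carrier ?F"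
      "free_gen B (x \<otimes>\<^bsub>B\<^esub> y) \<ominus>\<^bsub>?F\<^esub> (x \<odot>\<^bsub>?F\<^esub> free_gen B y \<oplus>\<^bsub>?F\<^esub> y \<odot>\<^bsub>?F\<^esub> free_gen B x) \<in> carrier ?F"
      using x y gen by auto
    have "lift (free_gen B (x \<oplus>\<^bsub>B\<^esub> y) \<ominus>\<^bsub>?F\<^esub> (free_gen B x \<oplus>\<^bsub>?F\<^esub> free_gen B y)) =
        d (x \<oplus>\<^bsub>B\<^esub> y) \<ominus>\<^bsub>S\<^esub> (d x \<oplus>\<^bsub>S\<^esub> d y)"
      using x y gen by (simp add: a_minus_def lift_linear lift_free_gen)
    then show "lift (free_gen B (x \<oplus>\<^bsub>B\<^esub> y) \<ominus>\<^bsub>?F\<^esub> (free_gen B x \<oplus>\<^bsub>?F\<^esub> free_gen B y)) \<in> ?Q"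
      using x y Q.zero_closed by (simp add: d_add a_minus_def S.r_neg)
    have "lift (free_gen B (x \<otimes>\<^bsub>B\<^esub> y) \<ominus>\<^bsub>?F\<^esub> (x \<odot>\<^bsub>?F\<^esub> free_gen B y \<oplus>\<^bsub>?F\<^esub> y \<odot>\<^bsub>?F\<^esub> free_gen B x)) =
        d (x \<otimes>\<^bsub>B\<^esub> y) \<ominus>\<^bsub>S\<^esub> (L x \<otimes>\<^bsub>S\<^esub> d y \<oplus>\<^bsub>S\<^esub> L y \<otimes>\<^bsub>S\<^esub> d x)"
      using x y gen by (simp add: a_minus_def lift_linear lift_free_gen)
    also have "\<dots> = \<ominus>\<^bsub>S\<^esub> (d x \<otimes>\<^bsub>S\<^esub> d y)"
      by (rule d_mult[OF x y])
    also have "\<dots> \<in> ?Q"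
      using x y d_J by (intro Q.a_inv_closed ideal_prod.prod)
    finally show "lift (free_gen B (x \<otimes>\<^bsub>B\<^esub> y) \<ominus>\<^bsub>?F\<^esub>
        (x \<odot>\<^bsub>?F\<^esub> free_gen B y \<oplus>\<^bsub>?F\<^esub> y \<odot>\<^bsub>?F\<^esub> free_gen B x)) \<in> ?Q" .
  next
    fix a assume a: "a \<in> carrier A"
    then show "free_gen B (a \<odot>\<^bsub>B\<^esub> \<one>\<^bsub>B\<^esub>) \<in> carrier ?F"
      using gen by simp
    show "lift (free_gen B (a \<odot>\<^bsub>B\<^esub> \<one>\<^bsub>B\<^esub>)) \<in> ?Q"
      using a Q.zero_closed by (simp add: lift_free_gen d_scalar)
  qed
  moreover have "free_gen B b \<in> kaehler_relations A B"
  proof -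
    let ?K = "kaehler_relations A B"
    \<comment> \<open>A one-element quotient forces the coset of the symbol to be \<open>?K\<close>;
      since \<open>?K\<close> contains zero, the symbol belongs to its own coset and hence to
      \<open>?K\<close>.\<close>
    have "?K #>\<^bsub>add_monoid ?F\<^esub> free_gen B b \<in> carrier (kaehler_differentials A B)"
      unfolding kaehler_differentials_def A_FactGroup_def carrier_FactGroup
      using gen[OF assms(2)] by auto
    then have "?K #>\<^bsub>add_monoid ?F\<^esub> free_gen B b = ?K"
      using assms(1) unfolding formally_unramified_def
      by (simp add: kaehler_differentials_def A_FactGroup_def)
    moreover have "\<zero>\<^bsub>?F\<^esub> \<in> ?K"
      unfolding kaehler_relations_def Let_def by (rule module_span_zero)
    then have "\<zero>\<^bsub>?F\<^esub> \<oplus>\<^bsub>?F\<^esub> free_gen B b \<in> ?K #>\<^bsub>add_monoid ?F\<^esub> free_gen B b"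
      unfolding r_coset_def by force
    ultimately have "\<zero>\<^bsub>?F\<^esub> \<oplus>\<^bsub>?F\<^esub> free_gen B b \<in> ?K"
      by simp
    then show ?thesis
      using gen[OF assms(2)] by simp
  qed
  ultimately show ?thesis
    using lift_free_gen[OF assms(2)] by auto
qed

theorem unramified_annihilator:
  assumes "formally_unramified A B" "dual_basis A B n e f"
  shows "\<exists>\<epsilon>\<in>carrier S. \<one>\<^bsub>S\<^esub> \<ominus>\<^bsub>S\<^esub> \<epsilon> \<in> J \<and> (\<forall>b\<in>carrier B. \<epsilon> \<otimes>\<^bsub>S\<^esub> d b = \<zero>\<^bsub>S\<^esub>)"
proof -
  let ?D = "d ` e ` {..<n}"
  have J: "J = genideal S ?D"
    by (rule J_finitely_generated[OF assms(2)])
  have "genideal S (d ` carrier B) \<subseteq> ideal_prod S J J"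
    using formally_unramified_d[OF assms(1)]
    by (intro S.genideal_minimal S.ideal_prod_is_ideal J_ideal) auto
  then have "J \<subseteq> ideal_prod S J J"
    by (simp only: J_def[symmetric])
  moreover have "?D \<subseteq> carrier S"
    using assms(2) by (auto simp: dual_basis_def)
  ultimately obtain \<epsilon> where "\<epsilon> \<in> carrier S" "\<one>\<^bsub>S\<^esub> \<ominus>\<^bsub>S\<^esub> \<epsilon> \<in> J" "\<forall>x\<in>J. \<epsilon> \<otimes>\<^bsub>S\<^esub> x = \<zero>\<^bsub>S\<^esub>"
    using S.idempotent_ideal_annihilator[of ?D] unfolding J[symmetric] by auto
  then show ?thesis
    using d_J by blast
qed

end

section \<open>The separability element\<close>

text \<open>The commutative ring generated by the operators \<open>u \<mapsto> x \<cdot> u(y \<cdot> _)\<close> on the \<open>A\<close>-linear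
  endomorphisms of \<open>B\<close>; it plays the role of \<open>B \<otimes> B\<close>.\<close>

locale operator_ring =
  fixes A :: "('a, 'm) ring_scheme" and B :: "('a, 'b, 'k) module_scheme"
  assumes algebra: "algebra A B"
begin

sublocale B: cring B
  using algebra by (rule algebra.M_cring)

sublocale A: cring A
  using algebra by (rule algebra.R_cring)

sublocale AB: algebra A B
  by (rule algebra)

text \<open>Extensionality makes endomorphisms equal as soon as they agree on the carrier. The
  operators are restricted to \<open>W\<close> for the same reason.\<close>

definition W :: "('b \<Rightarrow> 'b) set" where
  "W = linear_maps A B B \<inter> extensional (carrier B)"

definition sandwich :: "'b \<Rightarrow> 'b \<Rightarrow> ('b \<Rightarrow> 'b) \<Rightarrow> 'b \<Rightarrow> 'b" where
  "sandwich x y u = (\<lambda>b\<in>carrier B. x \<otimes>\<^bsub>B\<^esub> u (y \<otimes>\<^bsub>B\<^esub> b))"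

definition W_add :: "('b \<Rightarrow> 'b) \<Rightarrow> ('b \<Rightarrow> 'b) \<Rightarrow> 'b \<Rightarrow> 'b" where
  "W_add u v = (\<lambda>b\<in>carrier B. u b \<oplus>\<^bsub>B\<^esub> v b)"

definition op :: "'b \<Rightarrow> 'b \<Rightarrow> ('b \<Rightarrow> 'b) \<Rightarrow> 'b \<Rightarrow> 'b" where
  "op x y = restrict (sandwich x y) W"

definition op_add where
  "op_add S T = (\<lambda>u\<in>W. W_add (S u) (T u))"

definition op_mult where
  "op_mult S T = (\<lambda>u\<in>W. S (T u))"

text \<open>Closure under addition already gives a ring: a product of generators is a generator,
  with the second arguments multiplied in reverse order, and negatives come from
  \<open>op (-1) 1\<close>. Membership thus means being a finite sum of elementary tensors.\<close>

inductive_set Ops :: "(('b \<Rightarrow> 'b) \<Rightarrow> 'b \<Rightarrow> 'b) set" where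
  gen: "\<lbrakk>x \<in> carrier B; y \<in> carrier B\<rbrakk> \<Longrightarrow> op x y \<in> Ops"
| add: "\<lbrakk>S \<in> Ops; T \<in> Ops\<rbrakk> \<Longrightarrow> op_add S T \<in> Ops"

definition op_ring :: "(('b \<Rightarrow> 'b) \<Rightarrow> 'b \<Rightarrow> 'b) ring" where
  "op_ring = \<lparr>carrier = Ops, mult = op_mult, one = op \<one>\<^bsub>B\<^esub> \<one>\<^bsub>B\<^esub>, zero = op \<zero>\<^bsub>B\<^esub> \<zero>\<^bsub>B\<^esub>, add = op_add\<rparr>"

lemma apply_simps [simp]:
  "b \<in> carrier B \<Longrightarrow> sandwich x y u b = x \<otimes>\<^bsub>B\<^esub> u (y \<otimes>\<^bsub>B\<^esub> b)"
  "b \<in> carrier B \<Longrightarrow> W_add u v b = u b \<oplus>\<^bsub>B\<^esub> v b"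
  "u \<in> W \<Longrightarrow> op x y u = sandwich x y u"
  "u \<in> W \<Longrightarrow> op_add S T u = W_add (S u) (T u)"
  "u \<in> W \<Longrightarrow> op_mult S T u = S (T u)"
  by (simp_all add: sandwich_def W_add_def op_def op_add_def op_mult_def)

lemma W_linear:
  assumes "u \<in> W"
  shows "b \<in> carrier B \<Longrightarrow> u b \<in> carrier B"
    and "\<lbrakk>b \<in> carrier B; c \<in> carrier B\<rbrakk> \<Longrightarrow> u (b \<oplus>\<^bsub>B\<^esub> c) = u b \<oplus>\<^bsub>B\<^esub> u c"
    and "\<lbrakk>a \<in> carrier A; b \<in> carrier B\<rbrakk> \<Longrightarrow> u (a \<odot>\<^bsub>B\<^esub> b) = a \<odot>\<^bsub>B\<^esub> u b"
    and "u \<zero>\<^bsub>B\<^esub> = \<zero>\<^bsub>B\<^esub>"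
  using assms linear_mapsD[of u A B B] linear_maps_zero[OF AB.module_axioms AB.module_axioms, of u]
  by (auto simp: W_def)

lemma W_eqI: "\<lbrakk>u \<in> W; v \<in> W; \<And>b. b \<in> carrier B \<Longrightarrow> u b = v b\<rbrakk> \<Longrightarrow> u = v"
  by (rule extensionalityI[of _ "carrier B"]) (auto simp: W_def)

lemma W_restrict: "u \<in> linear_maps A B B \<Longrightarrow> restrict u (carrier B) \<in> W"
  using linear_mapsD[of u A B B] unfolding W_def by (intro IntI linear_mapsI) auto

lemma sandwich_W:
  assumes "x \<in> carrier B" "y \<in> carrier B" "u \<in> W"
  shows "sandwich x y u \<in> W"
  unfolding sandwich_def
proof (intro W_restrict linear_mapsI)
  fix a b assume ab: "a \<in> carrier A" "b \<in> carrier B"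
  have "y \<otimes>\<^bsub>B\<^esub> (a \<odot>\<^bsub>B\<^esub> b) = a \<odot>\<^bsub>B\<^esub> (y \<otimes>\<^bsub>B\<^esub> b)"
    using ab assms AB.smult_assoc2[of a b y] by (simp add: B.m_comm)
  moreover have "x \<otimes>\<^bsub>B\<^esub> (a \<odot>\<^bsub>B\<^esub> u (y \<otimes>\<^bsub>B\<^esub> b)) = a \<odot>\<^bsub>B\<^esub> (x \<otimes>\<^bsub>B\<^esub> u (y \<otimes>\<^bsub>B\<^esub> b))"
    using ab assms AB.smult_assoc2[of a "u (y \<otimes>\<^bsub>B\<^esub> b)" x] by (simp add: B.m_comm W_linear)
  ultimately show "x \<otimes>\<^bsub>B\<^esub> u (y \<otimes>\<^bsub>B\<^esub> (a \<odot>\<^bsub>B\<^esub> b)) = a \<odot>\<^bsub>B\<^esub> (x \<otimes>\<^bsub>B\<^esub> u (y \<otimes>\<^bsub>B\<^esub> b))"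
    using ab assms by (simp add: W_linear)
qed (use assms in \<open>simp_all add: W_linear B.r_distr\<close>)

lemma W_add_W:
  assumes u: "u \<in> W" and v: "v \<in> W"
  shows "W_add u v \<in> W"
  unfolding W_add_def using W_linear(1)[OF u] W_linear(1)[OF v]
  by (intro W_restrict linear_mapsI)
    (simp_all add: W_linear(2,3)[OF u] W_linear(2,3)[OF v] AB.smult_r_distr B.a_ac)

lemma Ops_W: "T \<in> Ops \<Longrightarrow> u \<in> W \<Longrightarrow> T u \<in> W"
  by (induction rule: Ops.induct) (simp_all add: sandwich_W W_add_W)

lemma Ops_extensional: "T \<in> Ops \<Longrightarrow> T \<in> extensional W"
  by (induction rule: Ops.induct) (simp_all only: op_def op_add_def restrict_extensional)

lemma Ops_closed: "\<lbrakk>T \<in> Ops; u \<in> W; b \<in> carrier B\<rbrakk> \<Longrightarrow> T u b \<in> carrier B"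
  using W_linear(1)[of "T u" b] Ops_W[of T u] by blast

text \<open>Phrased without membership in \<open>Ops\<close>, so that \<open>op_mult S T\<close> can
  be identified before it is known to be an element of \<open>Ops\<close>.\<close>

lemma Ops_eqI_aux:
  assumes "S \<in> extensional W" "T \<in> extensional W" "\<And>u. u \<in> W \<Longrightarrow> S u \<in> W" "\<And>u. u \<in> W \<Longrightarrow> T u \<in> W"
    and "\<And>u b. \<lbrakk>u \<in> W; b \<in> carrier B\<rbrakk> \<Longrightarrow> S u b = T u b"
  shows "S = T"
  using assms by (intro extensionalityI[of S W T] W_eqI)

lemma Ops_eqI:
  assumes "S \<in> Ops" "T \<in> Ops" "\<And>u b. \<lbrakk>u \<in> W; b \<in> carrier B\<rbrakk> \<Longrightarrow> S u b = T u b"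
  shows "S = T"
  using assms by (simp add: Ops_eqI_aux Ops_extensional Ops_W)

lemma Ops_additive:
  assumes "T \<in> Ops" "u \<in> W" "v \<in> W" "b \<in> carrier B"
  shows "T (W_add u v) b = T u b \<oplus>\<^bsub>B\<^esub> T v b"
  using assms(1)
proof (induction rule: Ops.induct)
  case (gen x y)
  then show ?case
    using assms(2-) by (simp add: W_add_W W_linear B.r_distr)
next
  case (add S T)
  then show ?case
    using assms(2-) by (simp add: W_add_W Ops_closed B.a_ac)
qed

lemma Ops_commute_sandwich:
  assumes "T \<in> Ops" "x \<in> carrier B" "y \<in> carrier B" "u \<in> W" "b \<in> carrier B"
  shows "T (sandwich x y u) b = x \<otimes>\<^bsub>B\<^esub> T u (y \<otimes>\<^bsub>B\<^esub> b)"
  using assms(1)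
proof (induction rule: Ops.induct)
  case (gen x' y')
  then show ?case
    using assms(2-) by (simp add: sandwich_W W_linear B.m_ac)
next
  case (add S T)
  then show ?case
    using assms(2-) by (simp add: sandwich_W W_linear Ops_closed B.r_distr)
qed

text \<open>On generators this is commutativity of \<open>B\<close>. The induction here reduces
  \<open>S\<close> to a generator, and \<open>Ops_commute_sandwich\<close> has done the same for
  \<open>T\<close>.\<close>

lemma Ops_commute:
  assumes "S \<in> Ops" "T \<in> Ops" "u \<in> W" "b \<in> carrier B"
  shows "S (T u) b = T (S u) b"
  using assms(1)
proof (induction rule: Ops.induct)
  case (gen x y)
  then show ?case
    using assms(2-) by (simp add: Ops_W Ops_commute_sandwich)
next
  case (add S S')
  then show ?case
    using assms(2-) by (simp add: Ops_W Ops_additive)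
qed

lemma op_mult_eqI:
  assumes "S \<in> Ops" "T \<in> Ops" "U \<in> Ops" "\<And>u b. \<lbrakk>u \<in> W; b \<in> carrier B\<rbrakk> \<Longrightarrow> U u b = S (T u) b"
  shows "op_mult S T = U"
proof (rule Ops_eqI_aux)
  show "op_mult S T \<in> extensional W"
    unfolding op_mult_def by (rule restrict_extensional)
qed (use assms in \<open>simp_all add: Ops_extensional Ops_W\<close>)

lemma Ops_mult:
  assumes "S \<in> Ops" "T \<in> Ops"
  shows "op_mult S T \<in> Ops"
  using assms(1)
proof (induction rule: Ops.induct)
  case (gen x y)
  note xy = gen
  show ?case
    using assms(2)
  proof (induction rule: Ops.induct)
    case (gen x' y')
    have "op_mult (op x y) (op x' y') = op (x \<otimes>\<^bsub>B\<^esub> x') (y' \<otimes>\<^bsub>B\<^esub> y)"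
      using gen xy by (intro op_mult_eqI Ops.gen) (simp_all add: sandwich_W W_linear B.m_assoc)
    then show ?case
      using gen xy by (simp add: Ops.gen)
  next
    case (add T T')
    have "op_mult (op x y) (op_add T T') = op_add (op_mult (op x y) T) (op_mult (op x y) T')"
      using add xy by (intro op_mult_eqI Ops.gen Ops.add)
        (simp_all add: W_add_W Ops_W Ops_closed B.r_distr)
    then show ?case
      using Ops.add[OF add.IH] by simp
  qed
next
  case (add S S')
  have "op_mult (op_add S S') T = op_add (op_mult S T) (op_mult S' T)"
    using add assms(2) by (intro op_mult_eqI Ops.add) (simp_all add: Ops_W)
  then show ?case
    using Ops.add[OF add.IH] by simp
qed

lemma op_ring_simps [simp]:
  "carrier op_ring = Ops" "mult op_ring = op_mult" "\<one>\<^bsub>op_ring\<^esub> = op \<one>\<^bsub>B\<^esub> \<one>\<^bsub>B\<^esub>"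
  "\<zero>\<^bsub>op_ring\<^esub> = op \<zero>\<^bsub>B\<^esub> \<zero>\<^bsub>B\<^esub>" "add op_ring = op_add"
  by (simp_all add: op_ring_def)

lemma op_ring_cring: "cring op_ring"
proof (intro cringI abelian_groupI comm_monoidI; unfold op_ring_simps)
  fix S T U
  assume *: "S \<in> Ops" "T \<in> Ops" "U \<in> Ops"
  show "op_add S T \<in> Ops" "op_mult S T \<in> Ops"
    using * by (simp_all add: Ops.add Ops_mult)
  show "op_add (op_add S T) U = op_add S (op_add T U)"
    using * by (intro Ops_eqI Ops.add) (simp_all add: Ops_closed B.a_assoc)
  show "op_add S T = op_add T S"
    using * by (intro Ops_eqI Ops.add) (simp_all add: Ops_closed B.a_comm)
  show "op_mult (op_mult S T) U = op_mult S (op_mult T U)"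
    using * by (intro Ops_eqI Ops_mult) (simp_all add: Ops_W)
  show "op_mult S T = op_mult T S"
    using * by (intro Ops_eqI Ops_mult) (simp_all add: Ops_commute)
  show "op_mult (op_add S T) U = op_add (op_mult S U) (op_mult T U)"
    using * by (intro Ops_eqI Ops_mult Ops.add) (simp_all add: Ops_W)
next
  fix T
  assume T: "T \<in> Ops"
  show "op_add (op \<zero>\<^bsub>B\<^esub> \<zero>\<^bsub>B\<^esub>) T = T"
    using T by (intro Ops_eqI Ops.add Ops.gen) (simp_all add: Ops_closed W_linear)
  show "op_mult (op \<one>\<^bsub>B\<^esub> \<one>\<^bsub>B\<^esub>) T = T"
    using T by (intro op_mult_eqI Ops.gen) (simp_all add: Ops_W Ops_closed)
  show "\<exists>T'\<in>Ops. op_add T' T = op \<zero>\<^bsub>B\<^esub> \<zero>\<^bsub>B\<^esub>"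
  proof
    show N: "op_mult (op (\<ominus>\<^bsub>B\<^esub> \<one>\<^bsub>B\<^esub>) \<one>\<^bsub>B\<^esub>) T \<in> Ops"
      using T by (intro Ops_mult Ops.gen) auto
    show "op_add (op_mult (op (\<ominus>\<^bsub>B\<^esub> \<one>\<^bsub>B\<^esub>) \<one>\<^bsub>B\<^esub>) T) T = op \<zero>\<^bsub>B\<^esub> \<zero>\<^bsub>B\<^esub>"
      using T N by (intro Ops_eqI Ops.add Ops.gen)
        (simp_all add: Ops_W Ops_closed W_linear B.l_minus B.l_neg)
  qed
qed (simp_all add: Ops.gen)

lemma op_ring_homs:
  "(\<lambda>x. op x \<one>\<^bsub>B\<^esub>) \<in> ring_hom B op_ring" "(\<lambda>y. op \<one>\<^bsub>B\<^esub> y) \<in> ring_hom B op_ring"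
proof -
  show "(\<lambda>x. op x \<one>\<^bsub>B\<^esub>) \<in> ring_hom B op_ring"
  proof (intro ring_hom_memI; unfold op_ring_simps)
    fix x y assume xy: "x \<in> carrier B" "y \<in> carrier B"
    show "op (x \<otimes>\<^bsub>B\<^esub> y) \<one>\<^bsub>B\<^esub> = op_mult (op x \<one>\<^bsub>B\<^esub>) (op y \<one>\<^bsub>B\<^esub>)"
      using xy by (intro Ops_eqI Ops.gen Ops_mult) (simp_all add: sandwich_W W_linear B.m_assoc)
    show "op (x \<oplus>\<^bsub>B\<^esub> y) \<one>\<^bsub>B\<^esub> = op_add (op x \<one>\<^bsub>B\<^esub>) (op y \<one>\<^bsub>B\<^esub>)"
      using xy by (intro Ops_eqI Ops.gen Ops.add) (simp_all add: W_linear B.l_distr)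
  qed (simp_all add: Ops.gen)
  show "(\<lambda>y. op \<one>\<^bsub>B\<^esub> y) \<in> ring_hom B op_ring"
  proof (intro ring_hom_memI; unfold op_ring_simps)
    fix x y assume xy: "x \<in> carrier B" "y \<in> carrier B"
    show "op \<one>\<^bsub>B\<^esub> (x \<otimes>\<^bsub>B\<^esub> y) = op_mult (op \<one>\<^bsub>B\<^esub> x) (op \<one>\<^bsub>B\<^esub> y)"
      using xy by (intro Ops_eqI Ops.gen Ops_mult) (simp_all add: sandwich_W W_linear B.m_ac)
    show "op \<one>\<^bsub>B\<^esub> (x \<oplus>\<^bsub>B\<^esub> y) = op_add (op \<one>\<^bsub>B\<^esub> x) (op \<one>\<^bsub>B\<^esub> y)"
      using xy by (intro Ops_eqI Ops.gen Ops.add) (simp_all add: W_linear B.l_distr)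
  qed (simp_all add: Ops.gen)
qed

text \<open>The two homomorphisms agree on scalars because the elements of \<open>W\<close> are
  \<open>A\<close>-linear: a scalar may be applied before or after \<open>u\<close>.\<close>

sublocale pair: algebra_pair A B op_ring "\<lambda>x. op x \<one>\<^bsub>B\<^esub>" "\<lambda>y. op \<one>\<^bsub>B\<^esub> y"
proof (intro algebra_pair.intro algebra op_ring_cring op_ring_homs)
  fix a assume a: "a \<in> carrier A"
  show "op (a \<odot>\<^bsub>B\<^esub> \<one>\<^bsub>B\<^esub>) \<one>\<^bsub>B\<^esub> = op \<one>\<^bsub>B\<^esub> (a \<odot>\<^bsub>B\<^esub> \<one>\<^bsub>B\<^esub>)"
    using a by (intro Ops_eqI Ops.gen) (simp_all add: AB.smult_assoc2 W_linear)
qed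

text \<open>The elementary tensors are chosen once and serve all \<open>u\<close> and
  \<open>b\<close>; a sum of operators corresponds to concatenating the two families.\<close>

lemma Ops_decomp:
  assumes "T \<in> Ops"
  shows "\<exists>(p::nat) x y. (\<forall>i<p. x i \<in> carrier B \<and> y i \<in> carrier B) \<and>
    (\<forall>u\<in>W. \<forall>b\<in>carrier B. T u b = (\<Oplus>\<^bsub>B\<^esub>i\<in>{..<p}. x i \<otimes>\<^bsub>B\<^esub> u (y i \<otimes>\<^bsub>B\<^esub> b)))"
  using assms
proof (induction rule: Ops.induct)
  case (gen x y)
  show ?case
    by (rule exI[of _ 1], rule exI[of _ "\<lambda>_. x"], rule exI[of _ "\<lambda>_. y"])
      (use gen in \<open>simp add: lessThan_Suc W_linear\<close>)
next
  case (add S T)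
  obtain p :: nat and x y where xy: "\<forall>i<p. x i \<in> carrier B \<and> y i \<in> carrier B"
    and S: "\<forall>u\<in>W. \<forall>b\<in>carrier B. S u b = (\<Oplus>\<^bsub>B\<^esub>i\<in>{..<p}. x i \<otimes>\<^bsub>B\<^esub> u (y i \<otimes>\<^bsub>B\<^esub> b))"
    using add.IH(1) by blast
  obtain q :: nat and x' y' where xy': "\<forall>i<q. x' i \<in> carrier B \<and> y' i \<in> carrier B"
    and T: "\<forall>u\<in>W. \<forall>b\<in>carrier B. T u b = (\<Oplus>\<^bsub>B\<^esub>i\<in>{..<q}. x' i \<otimes>\<^bsub>B\<^esub> u (y' i \<otimes>\<^bsub>B\<^esub> b))"
    using add.IH(2) by blast
  let ?x = "\<lambda>i. if i < p then x i else x' (i - p)"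
  let ?y = "\<lambda>i. if i < p then y i else y' (i - p)"
  have "S u b \<oplus>\<^bsub>B\<^esub> T u b = (\<Oplus>\<^bsub>B\<^esub>i\<in>{..<p + q}. ?x i \<otimes>\<^bsub>B\<^esub> u (?y i \<otimes>\<^bsub>B\<^esub> b))"
    if u: "u \<in> W" and b: "b \<in> carrier B" for u b
  proof -
    have "S u b \<oplus>\<^bsub>B\<^esub> T u b = (\<Oplus>\<^bsub>B\<^esub>i\<in>{..<p + q}. if i < p then x i \<otimes>\<^bsub>B\<^esub> u (y i \<otimes>\<^bsub>B\<^esub> b)
        else x' (i - p) \<otimes>\<^bsub>B\<^esub> u (y' (i - p) \<otimes>\<^bsub>B\<^esub> b))"
      using S T u b xy xy' W_linear(1)[OF u] by (subst B.finsum_append) simp_all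
    also have "\<dots> = (\<Oplus>\<^bsub>B\<^esub>i\<in>{..<p + q}. ?x i \<otimes>\<^bsub>B\<^esub> u (?y i \<otimes>\<^bsub>B\<^esub> b))"
      using b xy xy' W_linear(1)[OF u] by (intro B.finsum_cong') auto
    finally show ?thesis .
  qed
  moreover have "\<forall>i<p + q. ?x i \<in> carrier B \<and> ?y i \<in> carrier B"
    using xy xy' by auto
  ultimately show ?case
    by (intro exI[of _ "p + q"] exI[of _ ?x] exI[of _ ?y]) simp
qed

text \<open>Evaluation at the identity realises the multiplication
  \<open>B \<otimes> B \<rightarrow> B\<close>: it turns \<open>op x y\<close> into multiplication
  by the product of \<open>x\<close> and \<open>y\<close>.\<close>

definition W_id :: "'b \<Rightarrow> 'b" where
  "W_id = restrict (\<lambda>b. b) (carrier B)"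

lemma W_id [simp]: "W_id \<in> W" "b \<in> carrier B \<Longrightarrow> W_id b = b"
  unfolding W_id_def by (intro W_restrict linear_mapsI) simp_all

text \<open>The operators that kill \<open>W_id\<close> form an ideal, and each
  \<open>pair.d b\<close> is among them because left and right multiplication by \<open>b\<close>
  agree on the identity.\<close>

lemma J_id:
  assumes "T \<in> pair.J" "b \<in> carrier B"
  shows "T W_id b = \<zero>\<^bsub>B\<^esub>"
proof -
  let ?K = "{T \<in> Ops. \<forall>b\<in>carrier B. T W_id b = \<zero>\<^bsub>B\<^esub>}"
  have mult: "op_mult S T \<in> ?K" if S: "S \<in> Ops" and T: "T \<in> ?K" for S T
  proof -
    \<comment> \<open>The zero function is written as a sandwich so that
      \<open>Ops_commute_sandwich\<close> evaluates \<open>S\<close> on it.\<close>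
    have "sandwich \<zero>\<^bsub>B\<^esub> \<zero>\<^bsub>B\<^esub> W_id = T W_id"
      using T sandwich_W[of "\<zero>\<^bsub>B\<^esub>" "\<zero>\<^bsub>B\<^esub>" W_id] Ops_W[of T W_id]
      by (intro W_eqI) auto
    moreover have "S (sandwich \<zero>\<^bsub>B\<^esub> \<zero>\<^bsub>B\<^esub> W_id) b = \<zero>\<^bsub>B\<^esub>" if "b \<in> carrier B" for b
      using that S by (simp add: Ops_commute_sandwich Ops_closed)
    ultimately show ?thesis
      using S T by (simp add: Ops_mult)
  qed
  then have mult': "S \<otimes>\<^bsub>op_ring\<^esub> T \<in> ?K" if "S \<in> carrier op_ring" "T \<in> ?K" for S T
    using that unfolding op_ring_simps(1,2) by blast
  have "ideal ?K op_ring"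
  proof (rule idealI)
    show "ring op_ring"
      using op_ring_cring by (rule cring.axioms)
    show "subgroup ?K (add_monoid op_ring)"
    proof (rule group.subgroupI)
      show "group (add_monoid op_ring)"
        by (rule pair.S.a_group)
      show "?K \<noteq> {}"
        using Ops.gen[of "\<zero>\<^bsub>B\<^esub>" "\<zero>\<^bsub>B\<^esub>"] by auto
      show "inv\<^bsub>add_monoid op_ring\<^esub> T \<in> ?K" if T: "T \<in> ?K" for T
      proof -
        have Tc: "T \<in> carrier op_ring"
          using T by simp
        have "(\<ominus>\<^bsub>op_ring\<^esub> \<one>\<^bsub>op_ring\<^esub>) \<otimes>\<^bsub>op_ring\<^esub> T = \<ominus>\<^bsub>op_ring\<^esub> T"
          using Tc by algebra
        moreover have "(\<ominus>\<^bsub>op_ring\<^esub> \<one>\<^bsub>op_ring\<^esub>) \<otimes>\<^bsub>op_ring\<^esub> T \<in> ?K"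
          using T by (intro mult' pair.S.a_inv_closed pair.S.one_closed)
        ultimately show ?thesis
          unfolding a_inv_def by argo
      qed
    qed (auto simp: Ops.add)
    fix S T
    assume T: "T \<in> ?K" and S: "S \<in> carrier op_ring"
    show "S \<otimes>\<^bsub>op_ring\<^esub> T \<in> ?K"
      using S T by (rule mult')
    moreover have "T \<otimes>\<^bsub>op_ring\<^esub> S = S \<otimes>\<^bsub>op_ring\<^esub> T"
      using S T by (intro pair.S.m_comm) simp_all
    ultimately show "T \<otimes>\<^bsub>op_ring\<^esub> S \<in> ?K"
      by argo
  qed
  moreover have "pair.d b \<in> ?K" if b: "b \<in> carrier B" for b
  proof -
    have d: "pair.d b \<in> Ops"
      using pair.d_closed[OF b] by simp
    have "op b \<one>\<^bsub>B\<^esub> \<in> carrier op_ring" "op \<one>\<^bsub>B\<^esub> b \<in> carrier op_ring"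
      using b by (simp_all add: Ops.gen)
    \<comment> \<open>Values of the difference \<open>pair.d b\<close> are read off from an equation
      between sums, since sums in \<open>op_ring\<close> are pointwise.\<close>
    then have "pair.d b \<oplus>\<^bsub>op_ring\<^esub> op \<one>\<^bsub>B\<^esub> b = op b \<one>\<^bsub>B\<^esub>"
      unfolding pair.d_def by algebra
    then have eq: "(pair.d b \<oplus>\<^bsub>op_ring\<^esub> op \<one>\<^bsub>B\<^esub> b) W_id c = op b \<one>\<^bsub>B\<^esub> W_id c" for c
      by simp
    have "pair.d b W_id c \<oplus>\<^bsub>B\<^esub> b \<otimes>\<^bsub>B\<^esub> c = b \<otimes>\<^bsub>B\<^esub> c" if "c \<in> carrier B" for c
      using eq[of c] that b by simp
    then show ?thesis
      using d b Ops_closed[OF d W_id(1)] by simp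
  qed
  ultimately have "pair.J \<subseteq> ?K"
    unfolding pair.J_def by (intro pair.S.genideal_minimal) auto
  then show ?thesis
    using assms by blast
qed

text \<open>The first identity is the image of \<open>\<epsilon>\<close> under multiplication. The
  second applies \<open>1 \<otimes> g\<close>, that is
  \<open>x \<otimes> y \<mapsto> g y \<odot> x\<close>, to
  \<open>(1 \<otimes> b) \<epsilon> = (b \<otimes> 1) \<epsilon>\<close>.\<close>

theorem separability_element:
  assumes "formally_unramified A B" "dual_basis A B n e f"
  shows "\<exists>(p::nat) x y. (\<forall>i<p. x i \<in> carrier B \<and> y i \<in> carrier B) \<and>
    (\<Oplus>\<^bsub>B\<^esub>i\<in>{..<p}. x i \<otimes>\<^bsub>B\<^esub> y i) = \<one>\<^bsub>B\<^esub> \<and>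
    (\<forall>g\<in>linear_maps A B (regular_module A). \<forall>b\<in>carrier B.
      (\<Oplus>\<^bsub>B\<^esub>i\<in>{..<p}. g (y i \<otimes>\<^bsub>B\<^esub> b) \<odot>\<^bsub>B\<^esub> x i) = b \<otimes>\<^bsub>B\<^esub> (\<Oplus>\<^bsub>B\<^esub>i\<in>{..<p}. g (y i) \<odot>\<^bsub>B\<^esub> x i))"
proof -
  obtain \<epsilon> where \<epsilon>: "\<epsilon> \<in> Ops" "\<one>\<^bsub>op_ring\<^esub> \<ominus>\<^bsub>op_ring\<^esub> \<epsilon> \<in> pair.J"
    "\<And>b. b \<in> carrier B \<Longrightarrow> \<epsilon> \<otimes>\<^bsub>op_ring\<^esub> pair.d b = \<zero>\<^bsub>op_ring\<^esub>"
    using pair.unramified_annihilator[OF assms] by (auto simp del: op_ring_simps(2-))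
  obtain p :: nat and x y where xy: "\<forall>i<p. x i \<in> carrier B \<and> y i \<in> carrier B"
    and \<epsilon>_eq': "\<forall>u\<in>W. \<forall>b\<in>carrier B. \<epsilon> u b = (\<Oplus>\<^bsub>B\<^esub>i\<in>{..<p}. x i \<otimes>\<^bsub>B\<^esub> u (y i \<otimes>\<^bsub>B\<^esub> b))"
    using Ops_decomp[OF \<epsilon>(1)] by blast
  note \<epsilon>_eq = \<epsilon>_eq'[rule_format]
  have x: "x i \<in> carrier B" and y: "y i \<in> carrier B" if "i < p" for i
    using xy that by auto
  have one: "(\<Oplus>\<^bsub>B\<^esub>i\<in>{..<p}. x i \<otimes>\<^bsub>B\<^esub> y i) = \<one>\<^bsub>B\<^esub>"
  proof -
    \<comment> \<open>\<open>\<delta>\<close> lies in \<open>J\<close> and kills the identity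
      endomorphism, so \<open>\<epsilon>\<close> acts on it like the unit of the ring.\<close>
    define \<delta> where "\<delta> = \<one>\<^bsub>op_ring\<^esub> \<ominus>\<^bsub>op_ring\<^esub> \<epsilon>"
    have "\<epsilon> \<in> carrier op_ring"
      using \<epsilon>(1) by simp
    then have "\<epsilon> \<oplus>\<^bsub>op_ring\<^esub> \<delta> = \<one>\<^bsub>op_ring\<^esub>"
      unfolding \<delta>_def using pair.S.one_closed by algebra
    then have eq: "op_add \<epsilon> \<delta> = op \<one>\<^bsub>B\<^esub> \<one>\<^bsub>B\<^esub>"
      unfolding op_ring_simps .
    have "op_add \<epsilon> \<delta> W_id \<one>\<^bsub>B\<^esub> = op \<one>\<^bsub>B\<^esub> \<one>\<^bsub>B\<^esub> W_id \<one>\<^bsub>B\<^esub>"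
      unfolding eq ..
    then have "\<epsilon> W_id \<one>\<^bsub>B\<^esub> \<oplus>\<^bsub>B\<^esub> \<delta> W_id \<one>\<^bsub>B\<^esub> = \<one>\<^bsub>B\<^esub>"
      by (simp only: apply_simps W_id B.one_closed B.l_one)
    moreover have "\<delta> W_id \<one>\<^bsub>B\<^esub> = \<zero>\<^bsub>B\<^esub>"
      using J_id[OF \<epsilon>(2)] unfolding \<delta>_def by blast
    moreover have "\<epsilon> W_id \<one>\<^bsub>B\<^esub> \<in> carrier B"
      by (rule Ops_closed[OF \<epsilon>(1) W_id(1) B.one_closed])
    ultimately have "\<epsilon> W_id \<one>\<^bsub>B\<^esub> = \<one>\<^bsub>B\<^esub>"
      by simp
    moreover have "\<epsilon> W_id \<one>\<^bsub>B\<^esub> = (\<Oplus>\<^bsub>B\<^esub>i\<in>{..<p}. x i \<otimes>\<^bsub>B\<^esub> y i)"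
      unfolding \<epsilon>_eq[OF W_id(1) B.one_closed] using x y by (intro B.finsum_cong') auto
    ultimately show ?thesis
      by simp
  qed
  have comm: "(\<Oplus>\<^bsub>B\<^esub>i\<in>{..<p}. g (y i \<otimes>\<^bsub>B\<^esub> b) \<odot>\<^bsub>B\<^esub> x i) = b \<otimes>\<^bsub>B\<^esub> (\<Oplus>\<^bsub>B\<^esub>i\<in>{..<p}. g (y i) \<odot>\<^bsub>B\<^esub> x i)"
    if g: "g \<in> linear_maps A B (regular_module A)" and b: "b \<in> carrier B" for g b
  proof -
    have gA: "g c \<in> carrier A" if "c \<in> carrier B" for c
      using linear_mapsD(1)[OF g that] by simp
    \<comment> \<open>Evaluating an operator at this endomorphism, and then at \<open>1\<close>, is
      the map \<open>1 \<otimes> g\<close>.\<close>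
    define u where "u = (\<lambda>c\<in>carrier B. g c \<odot>\<^bsub>B\<^esub> \<one>\<^bsub>B\<^esub>)"
    have u: "u \<in> W"
      unfolding u_def using gA linear_mapsD[OF g]
      by (intro W_restrict linear_mapsI) (simp_all add: AB.smult_l_distr AB.smult_assoc1)
    have u_eq: "x i \<otimes>\<^bsub>B\<^esub> u c = g c \<odot>\<^bsub>B\<^esub> x i" if "i < p" "c \<in> carrier B" for i c
    proof -
      have "x i \<otimes>\<^bsub>B\<^esub> (g c \<odot>\<^bsub>B\<^esub> \<one>\<^bsub>B\<^esub>) = (g c \<odot>\<^bsub>B\<^esub> \<one>\<^bsub>B\<^esub>) \<otimes>\<^bsub>B\<^esub> x i"
        using that x gA by (intro B.m_comm) auto
      then show ?thesis
        using that x gA by (simp add: u_def AB.smult_assoc2)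
    qed
    have c: "\<epsilon> \<in> carrier op_ring" "op b \<one>\<^bsub>B\<^esub> \<in> carrier op_ring" "op \<one>\<^bsub>B\<^esub> b \<in> carrier op_ring"
      using \<epsilon>(1) b by (simp_all add: Ops.gen)
    have "\<epsilon> \<otimes>\<^bsub>op_ring\<^esub> op b \<one>\<^bsub>B\<^esub> = \<epsilon> \<otimes>\<^bsub>op_ring\<^esub> pair.d b \<oplus>\<^bsub>op_ring\<^esub> \<epsilon> \<otimes>\<^bsub>op_ring\<^esub> op \<one>\<^bsub>B\<^esub> b"
      unfolding pair.d_def using c by algebra
    also have "\<dots> = \<epsilon> \<otimes>\<^bsub>op_ring\<^esub> op \<one>\<^bsub>B\<^esub> b"
      unfolding \<epsilon>(3)[OF b] using c by algebra
    finally have "(\<epsilon> \<otimes>\<^bsub>op_ring\<^esub> op b \<one>\<^bsub>B\<^esub>) u \<one>\<^bsub>B\<^esub> = (\<epsilon> \<otimes>\<^bsub>op_ring\<^esub> op \<one>\<^bsub>B\<^esub> b) u \<one>\<^bsub>B\<^esub>"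
      by simp
    then have eq: "\<epsilon> (op b \<one>\<^bsub>B\<^esub> u) \<one>\<^bsub>B\<^esub> = \<epsilon> (op \<one>\<^bsub>B\<^esub> b u) \<one>\<^bsub>B\<^esub>"
      using u by simp
    have opW: "op b \<one>\<^bsub>B\<^esub> u \<in> W" "op \<one>\<^bsub>B\<^esub> b u \<in> W"
      using b u by (simp_all add: sandwich_W)
    have "\<epsilon> (op b \<one>\<^bsub>B\<^esub> u) \<one>\<^bsub>B\<^esub> = (\<Oplus>\<^bsub>B\<^esub>i\<in>{..<p}. b \<otimes>\<^bsub>B\<^esub> (g (y i) \<odot>\<^bsub>B\<^esub> x i))"
      unfolding \<epsilon>_eq[OF opW(1) B.one_closed] using x y b u gA
      by (intro B.finsum_cong') (auto simp: u_eq[symmetric] W_linear B.m_lcomm)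
    also have "\<dots> = b \<otimes>\<^bsub>B\<^esub> (\<Oplus>\<^bsub>B\<^esub>i\<in>{..<p}. g (y i) \<odot>\<^bsub>B\<^esub> x i)"
      using x y b gA by (intro B.finsum_rdistr[symmetric]) auto
    moreover have "\<epsilon> (op \<one>\<^bsub>B\<^esub> b u) \<one>\<^bsub>B\<^esub> = (\<Oplus>\<^bsub>B\<^esub>i\<in>{..<p}. g (y i \<otimes>\<^bsub>B\<^esub> b) \<odot>\<^bsub>B\<^esub> x i)"
      unfolding \<epsilon>_eq[OF opW(2) B.one_closed] using x y b u gA
      by (intro B.finsum_cong') (auto simp: u_eq[symmetric] W_linear B.m_comm)
    ultimately show ?thesis
      using eq by simp
  qed
  show ?thesis
    using x y one comm by (intro exI[of _ p] exI[of _ x] exI[of _ y]) blast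
qed

end

section \<open>The trace form of a finite etale algebra\<close>

lemma dual_basisD:
  assumes "dual_basis R M n x f"
  shows "i < n \<Longrightarrow> x i \<in> carrier M" "i < n \<Longrightarrow> f i \<in> linear_maps R M (regular_module R)"
    "m \<in> carrier M \<Longrightarrow> (\<Oplus>\<^bsub>M\<^esub>i\<in>{..<n}. f i m \<odot>\<^bsub>M\<^esub> x i) = m"
  using assms by (auto simp: dual_basis_def)

text \<open>Both sides equal the double sum of \<open>g j (u (x i)) \<otimes> f i (y j)\<close>:
  expand \<open>u (x i)\<close> in the second basis and \<open>y j\<close> in the first. This makes
  the definite description in \<open>endo_trace\<close> meaningful.\<close>

lemma (in module) dual_basis_trace_unique:
  assumes x: "dual_basis R M n x f" and y: "dual_basis R M p y g" and u: "u \<in> linear_maps R M M"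
  shows "(\<Oplus>i\<in>{..<n}. f i (u (x i))) = (\<Oplus>j\<in>{..<p}. g j (u (y j)))"
proof -
  note reg = regular_module_is_module
  note dx = dual_basisD[OF x] and dy = dual_basisD[OF y]
  have fR: "f i m \<in> carrier R" if "i < n" "m \<in> carrier M" for i m
    using linear_mapsD(1)[OF dx(2)] that by simp
  have gR: "g j m \<in> carrier R" if "j < p" "m \<in> carrier M" for j m
    using linear_mapsD(1)[OF dy(2)] that by simp
  note uM = linear_mapsD(1)[OF u]
  have f_sum: "f i (\<Oplus>\<^bsub>M\<^esub>j\<in>{..<p}. r j \<odot>\<^bsub>M\<^esub> y j) = (\<Oplus>j\<in>{..<p}. r j \<otimes> f i (y j))"
    if "i < n" "\<And>j. j < p \<Longrightarrow> r j \<in> carrier R" for i r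
  proof -
    have "f i (\<Oplus>\<^bsub>M\<^esub>j\<in>{..<p}. r j \<odot>\<^bsub>M\<^esub> y j) = (\<Oplus>j\<in>{..<p}. f i (r j \<odot>\<^bsub>M\<^esub> y j))"
      using linear_maps_finsum[OF module_axioms reg dx(2)[OF that(1)], of "{..<p}" "\<lambda>j. r j \<odot>\<^bsub>M\<^esub> y j"]
        that dy(1) by auto
    also have "\<dots> = (\<Oplus>j\<in>{..<p}. r j \<otimes> f i (y j))"
      using that dy(1) fR by (intro R.finsum_cong') (auto simp: linear_mapsD(3)[OF dx(2)[OF that(1)]])
    finally show ?thesis .
  qed
  have g_sum: "g j (u (\<Oplus>\<^bsub>M\<^esub>i\<in>{..<n}. r i \<odot>\<^bsub>M\<^esub> x i)) = (\<Oplus>i\<in>{..<n}. r i \<otimes> g j (u (x i)))"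
    if "j < p" "\<And>i. i < n \<Longrightarrow> r i \<in> carrier R" for j r
  proof -
    have "g j (u (\<Oplus>\<^bsub>M\<^esub>i\<in>{..<n}. r i \<odot>\<^bsub>M\<^esub> x i)) = g j (\<Oplus>\<^bsub>M\<^esub>i\<in>{..<n}. u (r i \<odot>\<^bsub>M\<^esub> x i))"
      using linear_maps_finsum[OF module_axioms module_axioms u, of "{..<n}" "\<lambda>i. r i \<odot>\<^bsub>M\<^esub> x i"]
        that dx(1) by auto
    also have "\<dots> = (\<Oplus>i\<in>{..<n}. g j (u (r i \<odot>\<^bsub>M\<^esub> x i)))"
      using linear_maps_finsum[OF module_axioms reg dy(2)[OF that(1)], of "{..<n}" "\<lambda>i. u (r i \<odot>\<^bsub>M\<^esub> x i)"]
        that dx(1) uM by auto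
    also have "\<dots> = (\<Oplus>i\<in>{..<n}. r i \<otimes> g j (u (x i)))"
      using that dx(1) gR uM
      by (intro R.finsum_cong') (auto simp: linear_mapsD(3)[OF u] linear_mapsD(3)[OF dy(2)[OF that(1)]])
    finally show ?thesis .
  qed
  have "(\<Oplus>i\<in>{..<n}. f i (u (x i))) = (\<Oplus>i\<in>{..<n}. f i (\<Oplus>\<^bsub>M\<^esub>j\<in>{..<p}. g j (u (x i)) \<odot>\<^bsub>M\<^esub> y j))"
    using dx(1) dy(3) uM fR by (intro R.finsum_cong') auto
  also have "\<dots> = (\<Oplus>i\<in>{..<n}. \<Oplus>j\<in>{..<p}. g j (u (x i)) \<otimes> f i (y j))"
    using dx(1) dy(1) uM fR gR by (intro R.finsum_cong') (auto intro!: R.finsum_closed f_sum)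
  also have "\<dots> = (\<Oplus>j\<in>{..<p}. \<Oplus>i\<in>{..<n}. g j (u (x i)) \<otimes> f i (y j))"
    using dx(1) dy(1) uM fR gR by (intro R.finsum_swap) auto
  also have "\<dots> = (\<Oplus>j\<in>{..<p}. \<Oplus>i\<in>{..<n}. f i (y j) \<otimes> g j (u (x i)))"
    using dx(1) dy(1) uM fR gR by (intro R.finsum_cong') (auto intro!: R.finsum_closed R.finsum_cong' R.m_comm)
  also have "\<dots> = (\<Oplus>j\<in>{..<p}. g j (u (\<Oplus>\<^bsub>M\<^esub>i\<in>{..<n}. f i (y j) \<odot>\<^bsub>M\<^esub> x i)))"
    using dx(1) dy(1) uM fR gR
    by (intro R.finsum_cong') (auto intro!: g_sum[symmetric] M.finsum_closed)
  also have "\<dots> = (\<Oplus>j\<in>{..<p}. g j (u (y j)))"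
    using dx(3) dy(1) uM gR by (intro R.finsum_cong') auto
  finally show ?thesis .
qed

lemma (in module) endo_trace_eq:
  assumes "dual_basis R M n x f" "u \<in> linear_maps R M M"
  shows "endo_trace R M u = (\<Oplus>i\<in>{..<n}. f i (u (x i)))"
  unfolding endo_trace_def
  using assms dual_basis_trace_unique[OF _ assms(1) assms(2)] by (intro the_equality) blast+

context operator_ring
begin

lemma mult_linear:
  assumes "b \<in> carrier B"
  shows "(\<lambda>x. b \<otimes>\<^bsub>B\<^esub> x) \<in> linear_maps A B B"
proof (intro linear_mapsI)
  fix a x assume "a \<in> carrier A" "x \<in> carrier B"
  then show "b \<otimes>\<^bsub>B\<^esub> (a \<odot>\<^bsub>B\<^esub> x) = a \<odot>\<^bsub>B\<^esub> (b \<otimes>\<^bsub>B\<^esub> x)"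
    using assms AB.smult_assoc2[of a x b] by (simp add: B.m_comm)
qed (use assms in \<open>simp_all add: B.r_distr\<close>)

lemma algebra_trace_eq:
  assumes "dual_basis A B n e f" "b \<in> carrier B"
  shows "algebra_trace A B b = (\<Oplus>\<^bsub>A\<^esub>i\<in>{..<n}. f i (b \<otimes>\<^bsub>B\<^esub> e i))"
  unfolding algebra_trace_def using AB.endo_trace_eq[OF assms(1) mult_linear[OF assms(2)]] .

lemma algebra_trace_linear:
  assumes d: "dual_basis A B n e f"
  shows "algebra_trace A B \<in> linear_maps A B (regular_module A)"
proof (intro linear_mapsI)
  note db = dual_basisD[OF d]
  note lin = linear_mapsD[OF db(2)]
  have fA: "f i b \<in> carrier A" if "i < n" "b \<in> carrier B" for i b
    using lin(1) that by simp
  fix b assume b: "b \<in> carrier B"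
  show "algebra_trace A B b \<in> carrier (regular_module A)"
    using b fA db(1) by (auto simp: algebra_trace_eq[OF d] intro!: A.finsum_closed)
  show "algebra_trace A B (b \<oplus>\<^bsub>B\<^esub> c) = algebra_trace A B b \<oplus>\<^bsub>regular_module A\<^esub> algebra_trace A B c"
    if c: "c \<in> carrier B" for c
  proof -
    have "(\<Oplus>\<^bsub>A\<^esub>i\<in>{..<n}. f i ((b \<oplus>\<^bsub>B\<^esub> c) \<otimes>\<^bsub>B\<^esub> e i)) =
        (\<Oplus>\<^bsub>A\<^esub>i\<in>{..<n}. f i (b \<otimes>\<^bsub>B\<^esub> e i) \<oplus>\<^bsub>A\<^esub> f i (c \<otimes>\<^bsub>B\<^esub> e i))"
      using b c db(1) fA by (intro A.finsum_cong') (auto simp: B.l_distr lin(2))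
    also have "\<dots> = (\<Oplus>\<^bsub>A\<^esub>i\<in>{..<n}. f i (b \<otimes>\<^bsub>B\<^esub> e i)) \<oplus>\<^bsub>A\<^esub> (\<Oplus>\<^bsub>A\<^esub>i\<in>{..<n}. f i (c \<otimes>\<^bsub>B\<^esub> e i))"
      using b c db(1) fA by (intro A.finsum_addf) auto
    finally show ?thesis
      using b c by (simp add: algebra_trace_eq[OF d])
  qed
  show "algebra_trace A B (a \<odot>\<^bsub>B\<^esub> b) = a \<odot>\<^bsub>regular_module A\<^esub> algebra_trace A B b"
    if a: "a \<in> carrier A" for a
  proof -
    have "(\<Oplus>\<^bsub>A\<^esub>i\<in>{..<n}. f i ((a \<odot>\<^bsub>B\<^esub> b) \<otimes>\<^bsub>B\<^esub> e i)) = (\<Oplus>\<^bsub>A\<^esub>i\<in>{..<n}. a \<otimes>\<^bsub>A\<^esub> f i (b \<otimes>\<^bsub>B\<^esub> e i))"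
      using a b db(1) fA by (intro A.finsum_cong') (auto simp: AB.smult_assoc2 lin(3))
    also have "\<dots> = a \<otimes>\<^bsub>A\<^esub> (\<Oplus>\<^bsub>A\<^esub>i\<in>{..<n}. f i (b \<otimes>\<^bsub>B\<^esub> e i))"
      using a b db(1) fA by (intro A.finsum_rdistr[symmetric]) auto
    finally show ?thesis
      using a b by (simp add: algebra_trace_eq[OF d])
  qed
qed

theorem trace_reconstruction:
  assumes unr: "formally_unramified A B" and d: "dual_basis A B n e f"
  shows "\<exists>(p::nat) x y. (\<forall>i<p. x i \<in> carrier B \<and> y i \<in> carrier B) \<and>
    (\<forall>b\<in>carrier B. b = (\<Oplus>\<^bsub>B\<^esub>i\<in>{..<p}. algebra_trace A B (y i \<otimes>\<^bsub>B\<^esub> b) \<odot>\<^bsub>B\<^esub> x i))"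
proof -
  obtain p :: nat and x y where xy: "\<forall>i<p. x i \<in> carrier B \<and> y i \<in> carrier B"
    and one: "(\<Oplus>\<^bsub>B\<^esub>i\<in>{..<p}. x i \<otimes>\<^bsub>B\<^esub> y i) = \<one>\<^bsub>B\<^esub>"
    and comm: "\<forall>g\<in>linear_maps A B (regular_module A). \<forall>b\<in>carrier B.
      (\<Oplus>\<^bsub>B\<^esub>i\<in>{..<p}. g (y i \<otimes>\<^bsub>B\<^esub> b) \<odot>\<^bsub>B\<^esub> x i) = b \<otimes>\<^bsub>B\<^esub> (\<Oplus>\<^bsub>B\<^esub>i\<in>{..<p}. g (y i) \<odot>\<^bsub>B\<^esub> x i)"
    using separability_element[OF unr d] by blast
  have x: "x i \<in> carrier B" and y: "y i \<in> carrier B" if "i < p" for i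
    using xy that by auto
  note db = dual_basisD[OF d]
  have fA: "f l b \<in> carrier A" if "l < n" "b \<in> carrier B" for l b
    using linear_mapsD(1)[OF db(2)] that by simp
  have "b = (\<Oplus>\<^bsub>B\<^esub>i\<in>{..<p}. algebra_trace A B (y i \<otimes>\<^bsub>B\<^esub> b) \<odot>\<^bsub>B\<^esub> x i)" if b: "b \<in> carrier B" for b
  proof -
    have "(\<Oplus>\<^bsub>B\<^esub>i\<in>{..<p}. algebra_trace A B (y i \<otimes>\<^bsub>B\<^esub> b) \<odot>\<^bsub>B\<^esub> x i) =
        (\<Oplus>\<^bsub>B\<^esub>i\<in>{..<p}. \<Oplus>\<^bsub>B\<^esub>l\<in>{..<n}. f l (y i \<otimes>\<^bsub>B\<^esub> (b \<otimes>\<^bsub>B\<^esub> e l)) \<odot>\<^bsub>B\<^esub> x i)"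
    proof (rule B.finsum_cong')
      fix i assume "i \<in> {..<p}"
      then have i: "i < p" by simp
      have "algebra_trace A B (y i \<otimes>\<^bsub>B\<^esub> b) = (\<Oplus>\<^bsub>A\<^esub>l\<in>{..<n}. f l (y i \<otimes>\<^bsub>B\<^esub> (b \<otimes>\<^bsub>B\<^esub> e l)))"
        using b y[OF i] db(1) fA
        by (subst algebra_trace_eq[OF d]) (auto intro!: A.finsum_cong' simp: B.m_assoc)
      then show "algebra_trace A B (y i \<otimes>\<^bsub>B\<^esub> b) \<odot>\<^bsub>B\<^esub> x i =
          (\<Oplus>\<^bsub>B\<^esub>l\<in>{..<n}. f l (y i \<otimes>\<^bsub>B\<^esub> (b \<otimes>\<^bsub>B\<^esub> e l)) \<odot>\<^bsub>B\<^esub> x i)"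
        using b x[OF i] y[OF i] db(1) fA by (simp add: AB.finsum_smult_rdistr Pi_def)
    qed (use b x y db(1) fA in \<open>auto intro!: B.finsum_closed\<close>)
    also have "\<dots> = (\<Oplus>\<^bsub>B\<^esub>l\<in>{..<n}. \<Oplus>\<^bsub>B\<^esub>i\<in>{..<p}. f l (y i \<otimes>\<^bsub>B\<^esub> (b \<otimes>\<^bsub>B\<^esub> e l)) \<odot>\<^bsub>B\<^esub> x i)"
      using b x y db(1) fA by (intro B.finsum_swap) auto
    also have "\<dots> = (\<Oplus>\<^bsub>B\<^esub>l\<in>{..<n}. \<Oplus>\<^bsub>B\<^esub>i\<in>{..<p}. (b \<otimes>\<^bsub>B\<^esub> x i) \<otimes>\<^bsub>B\<^esub> (f l (y i) \<odot>\<^bsub>B\<^esub> e l))"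
    proof (rule B.finsum_cong')
      fix l assume "l \<in> {..<n}"
      then have l: "l < n" by simp
      \<comment> \<open>The commutation property of the separability element, used for the
        functional \<open>f l\<close> and the element \<open>b \<otimes> e l\<close>.\<close>
      have "(\<Oplus>\<^bsub>B\<^esub>i\<in>{..<p}. f l (y i \<otimes>\<^bsub>B\<^esub> (b \<otimes>\<^bsub>B\<^esub> e l)) \<odot>\<^bsub>B\<^esub> x i) =
          (b \<otimes>\<^bsub>B\<^esub> e l) \<otimes>\<^bsub>B\<^esub> (\<Oplus>\<^bsub>B\<^esub>i\<in>{..<p}. f l (y i) \<odot>\<^bsub>B\<^esub> x i)"
        using comm db(1,2)[OF l] b by simp
      also have "\<dots> = (\<Oplus>\<^bsub>B\<^esub>i\<in>{..<p}. (b \<otimes>\<^bsub>B\<^esub> e l) \<otimes>\<^bsub>B\<^esub> (f l (y i) \<odot>\<^bsub>B\<^esub> x i))"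
        using b x y db(1) fA l by (intro B.finsum_rdistr) auto
      also have "\<dots> = (\<Oplus>\<^bsub>B\<^esub>i\<in>{..<p}. (b \<otimes>\<^bsub>B\<^esub> x i) \<otimes>\<^bsub>B\<^esub> (f l (y i) \<odot>\<^bsub>B\<^esub> e l))"
      proof (rule B.finsum_cong')
        fix i assume "i \<in> {..<p}"
        then have i: "i < p" by simp
        have "(b \<otimes>\<^bsub>B\<^esub> e l) \<otimes>\<^bsub>B\<^esub> (f l (y i) \<odot>\<^bsub>B\<^esub> x i) = f l (y i) \<odot>\<^bsub>B\<^esub> ((b \<otimes>\<^bsub>B\<^esub> e l) \<otimes>\<^bsub>B\<^esub> x i)"
          using b x[OF i] y[OF i] db(1)[OF l] fA[OF l]
          by (intro linear_mapsD(3)[OF mult_linear]) auto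
        also have "(b \<otimes>\<^bsub>B\<^esub> e l) \<otimes>\<^bsub>B\<^esub> x i = (b \<otimes>\<^bsub>B\<^esub> x i) \<otimes>\<^bsub>B\<^esub> e l"
          using b x[OF i] db(1)[OF l] by (simp add: B.m_ac)
        also have "f l (y i) \<odot>\<^bsub>B\<^esub> ((b \<otimes>\<^bsub>B\<^esub> x i) \<otimes>\<^bsub>B\<^esub> e l) = (b \<otimes>\<^bsub>B\<^esub> x i) \<otimes>\<^bsub>B\<^esub> (f l (y i) \<odot>\<^bsub>B\<^esub> e l)"
          using b x[OF i] y[OF i] db(1)[OF l] fA[OF l]
          by (intro linear_mapsD(3)[OF mult_linear, symmetric]) auto
        finally show "(b \<otimes>\<^bsub>B\<^esub> e l) \<otimes>\<^bsub>B\<^esub> (f l (y i) \<odot>\<^bsub>B\<^esub> x i) = (b \<otimes>\<^bsub>B\<^esub> x i) \<otimes>\<^bsub>B\<^esub> (f l (y i) \<odot>\<^bsub>B\<^esub> e l)" .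
      qed (use b x y db(1) fA l in auto)
      finally show "(\<Oplus>\<^bsub>B\<^esub>i\<in>{..<p}. f l (y i \<otimes>\<^bsub>B\<^esub> (b \<otimes>\<^bsub>B\<^esub> e l)) \<odot>\<^bsub>B\<^esub> x i) =
          (\<Oplus>\<^bsub>B\<^esub>i\<in>{..<p}. (b \<otimes>\<^bsub>B\<^esub> x i) \<otimes>\<^bsub>B\<^esub> (f l (y i) \<odot>\<^bsub>B\<^esub> e l))" .
    qed (use b x y db(1) fA in \<open>auto intro!: B.finsum_closed\<close>)
    also have "\<dots> = (\<Oplus>\<^bsub>B\<^esub>i\<in>{..<p}. \<Oplus>\<^bsub>B\<^esub>l\<in>{..<n}. (b \<otimes>\<^bsub>B\<^esub> x i) \<otimes>\<^bsub>B\<^esub> (f l (y i) \<odot>\<^bsub>B\<^esub> e l))"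
      using b x y db(1) fA by (intro B.finsum_swap) auto
    also have "\<dots> = (\<Oplus>\<^bsub>B\<^esub>i\<in>{..<p}. b \<otimes>\<^bsub>B\<^esub> (x i \<otimes>\<^bsub>B\<^esub> y i))"
    proof (rule B.finsum_cong')
      fix i assume "i \<in> {..<p}"
      then have i: "i < p" by simp
      \<comment> \<open>Summing over \<open>l\<close> reassembles \<open>y i\<close> from its
        coordinates \<open>f l (y i)\<close>; what remains is \<open>b\<close> times the sum of the
        \<open>x i \<otimes> y i\<close>, which is \<open>1\<close>.\<close>
      have "(\<Oplus>\<^bsub>B\<^esub>l\<in>{..<n}. (b \<otimes>\<^bsub>B\<^esub> x i) \<otimes>\<^bsub>B\<^esub> (f l (y i) \<odot>\<^bsub>B\<^esub> e l)) =
          (b \<otimes>\<^bsub>B\<^esub> x i) \<otimes>\<^bsub>B\<^esub> (\<Oplus>\<^bsub>B\<^esub>l\<in>{..<n}. f l (y i) \<odot>\<^bsub>B\<^esub> e l)"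
        using b x[OF i] y[OF i] db(1) fA by (intro B.finsum_rdistr[symmetric]) auto
      then show "(\<Oplus>\<^bsub>B\<^esub>l\<in>{..<n}. (b \<otimes>\<^bsub>B\<^esub> x i) \<otimes>\<^bsub>B\<^esub> (f l (y i) \<odot>\<^bsub>B\<^esub> e l)) = b \<otimes>\<^bsub>B\<^esub> (x i \<otimes>\<^bsub>B\<^esub> y i)"
        using db(3)[OF y[OF i]] b x[OF i] y[OF i] by (simp add: B.m_assoc)
    qed (use b x y in auto)
    also have "\<dots> = b \<otimes>\<^bsub>B\<^esub> (\<Oplus>\<^bsub>B\<^esub>i\<in>{..<p}. x i \<otimes>\<^bsub>B\<^esub> y i)"
      using b x y by (intro B.finsum_rdistr[symmetric]) auto
    finally show ?thesis
      using one b by simp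
  qed
  then have "\<forall>b\<in>carrier B. b = (\<Oplus>\<^bsub>B\<^esub>i\<in>{..<p}. algebra_trace A B (y i \<otimes>\<^bsub>B\<^esub> b) \<odot>\<^bsub>B\<^esub> x i)"
    by (rule ballI)
  with xy show ?thesis
    by (intro exI[of _ p] exI[of _ x] exI[of _ y] conjI)
qed

end

section \<open>Adic topologies\<close>

context cring
begin

lemma minus_identities:
  assumes "x \<in> carrier R" "y \<in> carrier R" "z \<in> carrier R"
  shows "(x \<ominus> z) \<ominus> (y \<ominus> z) = x \<ominus> y" "(x \<ominus> y) \<oplus> y = x" "(x \<oplus> y) \<ominus> y = x"
    "x \<oplus> \<ominus> (x \<ominus> y) = y" "x \<ominus> (y \<oplus> z) = (x \<ominus> y) \<ominus> z"
  using assms by algebra+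

lemma ideal_power_ideal: "ideal I R \<Longrightarrow> ideal (ideal_power R I n) R"
  using monoid.nat_pow_closed[OF comm_monoid.axioms(1)[OF ideals_set_is_comm_monoid], of I n]
  by (simp add: ideal_power_def ideals_set_def)

lemma ideal_power_add:
  assumes "ideal I R"
  shows "ideal_power R I (m + n) = ideal_prod R (ideal_power R I m) (ideal_power R I n)"
  using monoid.nat_pow_mult[OF comm_monoid.axioms(1)[OF ideals_set_is_comm_monoid], of I m n] assms
  by (simp add: ideal_power_def ideals_set_def)

lemma ideal_power_antimono:
  assumes "ideal I R" "m \<le> n"
  shows "ideal_power R I n \<subseteq> ideal_power R I m"
proof -
  have "ideal_power R I n = ideal_prod R (ideal_power R I m) (ideal_power R I (n - m))"
    using ideal_power_add[OF assms(1), of m "n - m"] assms(2) by simp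
  then show ?thesis
    using ideal_prod_inter[OF ideal_power_ideal ideal_power_ideal, OF assms(1) assms(1), of m "n - m"]
    by simp
qed

lemma ideal_submodule:
  assumes "ideal J R"
  shows "submodule J R (regular_module R)"
proof -
  interpret J: ideal J R by fact
  have "\<ominus>\<^bsub>regular_module R\<^esub> x = \<ominus> x" for x
    by (simp add: a_inv_def m_inv_def)
  then show ?thesis
    using J.Icarr J.I_l_closed J.a_closed J.a_inv_closed
    by (intro module.submoduleI regular_module_is_module) auto
qed

text \<open>Separatedness and completeness of \<open>A0\<close> are phrased for its regular module;
  writing \<open>t\<close> as \<open>t\<close> times \<open>1\<close> identifies the filtration
  there with the powers of the ideal.\<close>

lemma ideal_power_smult_regular:
  assumes "ideal I R"
  shows "ideal_power_smult R I n (regular_module R) = ideal_power R I n"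
proof
  interpret P: ideal "ideal_power R I n" R
    using assms by (rule ideal_power_ideal)
  show "ideal_power_smult R I n (regular_module R) \<subseteq> ideal_power R I n"
    unfolding ideal_power_smult_def
    by (intro module_span_minimal ideal_submodule P.ideal_axioms) (auto intro: P.I_r_closed)
  show "ideal_power R I n \<subseteq> ideal_power_smult R I n (regular_module R)"
  proof
    fix t assume t: "t \<in> ideal_power R I n"
    have "t \<odot>\<^bsub>regular_module R\<^esub> \<one> \<in>
        {t \<odot>\<^bsub>regular_module R\<^esub> x |t x. t \<in> ideal_power R I n \<and> x \<in> carrier (regular_module R)}"
      using t by (intro CollectI exI[of _ t] exI[of _ \<one>]) simp
    then have "t \<odot>\<^bsub>regular_module R\<^esub> \<one> \<in> ideal_power_smult R I n (regular_module R)"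
      unfolding ideal_power_smult_def by (rule subsetD[OF module_span_superset])
    then show "t \<in> ideal_power_smult R I n (regular_module R)"
      using P.Icarr[OF t] by simp
  qed
qed

end

section \<open>The adic filtrations of \<open>A0\<close> and \<open>B0\<close> inside
  \<open>A\<close> and \<open>B\<close>\<close>

locale adic_subalgebra =
  fixes A :: "('a, 'm) ring_scheme" and B :: "('a, 'b, 'k) module_scheme"
    and A0 I0 :: "'a set" and B0 :: "'b set"
  assumes algebra: "algebra A B" and A0: "subring A0 A" and I0: "ideal I0 (A\<lparr>carrier := A0\<rparr>)"
    and B0: "subring B0 B" and smult_B0: "\<lbrakk>a \<in> A0; x \<in> B0\<rbrakk> \<Longrightarrow> a \<odot>\<^bsub>B\<^esub> x \<in> B0"
begin

abbreviation "R0 \<equiv> A\<lparr>carrier := A0\<rparr>"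
abbreviation "M0 \<equiv> B\<lparr>carrier := B0\<rparr>"
abbreviation "P n \<equiv> ideal_power R0 I0 n"
abbreviation "Q n \<equiv> ideal_power_smult R0 I0 n M0"

sublocale B: cring B
  using algebra by (rule algebra.M_cring)

sublocale A: cring A
  using algebra by (rule algebra.R_cring)

sublocale AB: algebra A B
  by (rule algebra)

lemmas A0E = subringE[OF A0] and B0E = subringE[OF B0]

lemma A0_carrier [simp]: "a \<in> A0 \<Longrightarrow> a \<in> carrier A"
  using A0E(1) by blast

lemma B0_carrier [simp]: "b \<in> B0 \<Longrightarrow> b \<in> carrier B"
  using B0E(1) by blast

lemma R0_cring: "cring R0"
  using A.subcring_iff[OF A0E(1)] A.subcringI'[OF A0] by blast

sublocale R0: cring R0
  by (rule R0_cring)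

lemma M0_module: "module R0 M0"
proof (rule moduleI[OF R0_cring])
  show "abelian_group M0"
    using B.subring_is_ring[OF B0] by (rule ring.is_abelian_group)
qed (use smult_B0 in \<open>simp_all add: AB.smult_l_distr AB.smult_r_distr AB.smult_assoc1\<close>)

sublocale M0: module R0 M0
  by (rule M0_module)

lemma a_inv_R0: "a \<in> A0 \<Longrightarrow> \<ominus>\<^bsub>R0\<^esub> a = \<ominus>\<^bsub>A\<^esub> a"
  using A0E(5)[of a] by (intro R0.minus_equality) (simp_all add: A.l_neg)

lemma a_inv_M0: "b \<in> B0 \<Longrightarrow> \<ominus>\<^bsub>M0\<^esub> b = \<ominus>\<^bsub>B\<^esub> b"
  using B0E(5)[of b] by (intro M0.minus_equality) (simp_all add: B.l_neg)

lemma minus_M0: "\<lbrakk>b \<in> B0; b' \<in> B0\<rbrakk> \<Longrightarrow> b \<ominus>\<^bsub>M0\<^esub> b' = b \<ominus>\<^bsub>B\<^esub> b'"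
  by (simp add: a_minus_def a_inv_M0)

lemma minus_regular: "\<lbrakk>a \<in> A0; a' \<in> A0\<rbrakk> \<Longrightarrow> a \<ominus>\<^bsub>regular_module R0\<^esub> a' = a \<ominus>\<^bsub>A\<^esub> a'"
proof -
  assume a: "a \<in> A0" "a' \<in> A0"
  have "\<ominus>\<^bsub>regular_module R0\<^esub> a' = \<ominus>\<^bsub>R0\<^esub> a'"
    by (simp add: a_inv_def m_inv_def)
  then show ?thesis
    using a by (simp add: a_minus_def a_inv_R0)
qed

lemma P_ideal: "ideal (P n) R0"
  by (rule R0.ideal_power_ideal[OF I0])

lemma P_A0: "t \<in> P n \<Longrightarrow> t \<in> A0"
  using ideal.Icarr[OF P_ideal, of t n] by simp

lemma P_mult: "\<lbrakk>t \<in> P n; a \<in> A0\<rbrakk> \<Longrightarrow> t \<otimes>\<^bsub>A\<^esub> a \<in> P n"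
  using ideal.I_r_closed[OF P_ideal, of t n a] by simp

lemma P_add: "\<lbrakk>s \<in> P n; t \<in> P n\<rbrakk> \<Longrightarrow> s \<oplus>\<^bsub>A\<^esub> t \<in> P n"
  using additive_subgroup.a_closed[OF ideal.axioms(1)[OF P_ideal], of s n t] by simp

lemma P_zero: "\<zero>\<^bsub>A\<^esub> \<in> P n"
  using additive_subgroup.zero_closed[OF ideal.axioms(1)[OF P_ideal], of n] by simp

text \<open>Elements of \<open>P (m + n)\<close> are sums of products from \<open>P m\<close> and
  \<open>P n\<close>. This is how a prescribed number of powers is split off and spent on one
  purpose.\<close>

lemma P_induct [consumes 1, case_names prod add]:
  assumes t: "t \<in> P (m + n)"
    and prod: "\<And>r s. \<lbrakk>r \<in> P m; s \<in> P n\<rbrakk> \<Longrightarrow> X (r \<otimes>\<^bsub>A\<^esub> s)"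
    and add: "\<And>r s. \<lbrakk>r \<in> A0; s \<in> A0; X r; X s\<rbrakk> \<Longrightarrow> X (r \<oplus>\<^bsub>A\<^esub> s)"
  shows "X t"
proof -
  have "t \<in> ideal_prod R0 (P m) (P n)"
    using t R0.ideal_power_add[OF I0] by simp
  then have "t \<in> A0 \<and> X t"
  proof (induction rule: ideal_prod.induct)
    case (prod r s)
    then show ?case
      using assms(2)[of r s] P_A0 A0E(6) by auto
  next
    case (sum r s)
    then show ?case
      using add[of r s] A0E(7) by auto
  qed
  then show ?thesis ..
qed

lemma Q_submodule: "submodule (Q n) R0 M0"
  unfolding ideal_power_smult_def
  by (intro M0.module_span_submodule) (auto intro: smult_B0 P_A0)

lemma Q_gen: "\<lbrakk>t \<in> P n; x \<in> B0\<rbrakk> \<Longrightarrow> t \<odot>\<^bsub>B\<^esub> x \<in> Q n"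
  unfolding ideal_power_smult_def by (rule subsetD[OF module_span_superset]) auto

lemma Q_B0: "x \<in> Q n \<Longrightarrow> x \<in> B0"
  using M0.submoduleE(1)[OF Q_submodule, of n] by auto

lemma Q_add: "\<lbrakk>x \<in> Q n; y \<in> Q n\<rbrakk> \<Longrightarrow> x \<oplus>\<^bsub>B\<^esub> y \<in> Q n"
  using M0.submoduleE(5)[OF Q_submodule, of x n y] by simp

lemma Q_zero: "\<zero>\<^bsub>B\<^esub> \<in> Q n"
  using subgroup.one_closed[OF submodule.axioms(1)[OF Q_submodule], of n] by simp

lemma Q_finsum: "\<lbrakk>finite X; \<And>i. i \<in> X \<Longrightarrow> f i \<in> Q n\<rbrakk> \<Longrightarrow> (\<Oplus>\<^bsub>B\<^esub>i\<in>X. f i) \<in> Q n"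
proof (induction X rule: finite_induct)
  case (insert i X)
  have "f \<in> insert i X \<rightarrow> carrier B"
    using insert.prems Q_B0[THEN B0_carrier] by blast
  then show ?case
    using insert Q_add by (simp add: Pi_def)
qed (simp add: Q_zero)

lemma Q_minimal:
  assumes "X \<subseteq> B0" "\<zero>\<^bsub>B\<^esub> \<in> X" "\<And>x y. \<lbrakk>x \<in> X; y \<in> X\<rbrakk> \<Longrightarrow> x \<oplus>\<^bsub>B\<^esub> y \<in> X"
    "\<And>a x. \<lbrakk>a \<in> A0; x \<in> X\<rbrakk> \<Longrightarrow> a \<odot>\<^bsub>B\<^esub> x \<in> X" "\<And>t x. \<lbrakk>t \<in> P n; x \<in> B0\<rbrakk> \<Longrightarrow> t \<odot>\<^bsub>B\<^esub> x \<in> X"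
  shows "Q n \<subseteq> X"
  unfolding ideal_power_smult_def
proof (rule module_span_minimal)
  show "submodule X R0 M0"
  proof (rule M0.submoduleI)
    fix x assume x: "x \<in> X"
    then have "(\<ominus>\<^bsub>A\<^esub> \<one>\<^bsub>A\<^esub>) \<odot>\<^bsub>B\<^esub> x \<in> X"
      using A0E(3,5) by (intro assms(4)) auto
    moreover have "\<ominus>\<^bsub>M0\<^esub> x = (\<ominus>\<^bsub>A\<^esub> \<one>\<^bsub>A\<^esub>) \<odot>\<^bsub>B\<^esub> x"
      using x assms(1) a_inv_M0[of x] AB.smult_l_minus[of "\<one>\<^bsub>A\<^esub>" x] by auto
    ultimately show "\<ominus>\<^bsub>M0\<^esub> x \<in> X"
      by simp
  qed (use assms in auto)
qed (use assms(5) in auto)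

text \<open>The element \<open>x\<close> need not lie in \<open>B0\<close>: \<open>N\<close> of the
  powers move it there, and the other \<open>n\<close> give the depth.\<close>

lemma Q_smult:
  assumes x: "x \<in> carrier B" and N: "\<And>t. t \<in> P N \<Longrightarrow> t \<odot>\<^bsub>B\<^esub> x \<in> B0" and a: "a \<in> P (N + n)"
  shows "a \<odot>\<^bsub>B\<^esub> x \<in> Q n"
  using a
proof (induction rule: P_induct)
  case (prod r s)
  then have rs: "r \<in> carrier A" "s \<in> carrier A"
    by (auto intro: A0_carrier P_A0)
  have "(r \<otimes>\<^bsub>A\<^esub> s) \<odot>\<^bsub>B\<^esub> x = s \<odot>\<^bsub>B\<^esub> (r \<odot>\<^bsub>B\<^esub> x)"
    unfolding A.m_comm[OF rs] using rs x by (simp add: AB.smult_assoc1)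
  then show ?case
    using Q_gen[OF prod(2) N[OF prod(1)]] by simp
next
  case (add r s)
  then show ?case
    using add Q_add x by (simp add: AB.smult_l_distr)
qed

text \<open>The exponent is spent in three portions: \<open>N\<close> moves \<open>y\<close> into
  \<open>B0\<close>, \<open>c\<close> brings the value of \<open>T\<close> into \<open>A0\<close>,
  and the remaining \<open>n\<close> come out as a factor by \<open>A\<close>-linearity of
  \<open>T\<close>.\<close>

lemma functional_Q:
  assumes T: "T \<in> linear_maps A B (regular_module A)"
    and Tc: "\<And>t m. \<lbrakk>t \<in> P c; m \<in> B0\<rbrakk> \<Longrightarrow> T (t \<odot>\<^bsub>B\<^esub> m) \<in> A0"
    and y: "y \<in> carrier B" and N: "\<And>t. t \<in> P N \<Longrightarrow> t \<odot>\<^bsub>B\<^esub> y \<in> B0"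
    and x: "x \<in> Q (N + (c + n))"
  shows "T (y \<otimes>\<^bsub>B\<^esub> x) \<in> P n"
proof -
  have TA: "b \<in> carrier B \<Longrightarrow> T b \<in> carrier A"
    and Tadd: "\<lbrakk>b \<in> carrier B; b' \<in> carrier B\<rbrakk> \<Longrightarrow> T (b \<oplus>\<^bsub>B\<^esub> b') = T b \<oplus>\<^bsub>A\<^esub> T b'"
    and Tsmult: "\<lbrakk>a \<in> carrier A; b \<in> carrier B\<rbrakk> \<Longrightarrow> T (a \<odot>\<^bsub>B\<^esub> b) = a \<otimes>\<^bsub>A\<^esub> T b" for a b b'
    using linear_mapsD[OF T] by simp_all
  have ys: "y \<otimes>\<^bsub>B\<^esub> (a \<odot>\<^bsub>B\<^esub> b) = a \<odot>\<^bsub>B\<^esub> (y \<otimes>\<^bsub>B\<^esub> b)" if "a \<in> carrier A" "b \<in> carrier B" for a b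
    using that y AB.smult_assoc2[of a b y] by (simp add: B.m_comm)
  have 1: "T (t \<odot>\<^bsub>B\<^esub> m) \<in> P n" if t: "t \<in> P (c + n)" and m: "m \<in> B0" for t m
    using t
  proof (induction rule: P_induct)
    case (prod r s)
    have "T ((r \<otimes>\<^bsub>A\<^esub> s) \<odot>\<^bsub>B\<^esub> m) = s \<otimes>\<^bsub>A\<^esub> T (r \<odot>\<^bsub>B\<^esub> m)"
      using prod P_A0 m TA by (simp add: Tsmult A.m_assoc A.m_lcomm)
    then show ?case
      using P_mult[OF prod(2) Tc[OF prod(1) m]] by simp
  next
    case (add r s)
    then show ?case
      using add m P_add by (simp add: AB.smult_l_distr Tadd)
  qed
  have 2: "T (y \<otimes>\<^bsub>B\<^esub> (t \<odot>\<^bsub>B\<^esub> m)) \<in> P n" if t: "t \<in> P (N + (c + n))" and m: "m \<in> B0" for t m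
    using t
  proof (induction rule: P_induct)
    case (prod r s)
    then have rs: "r \<in> carrier A" "s \<in> carrier A"
      by (auto intro: A0_carrier P_A0)
    have "y \<otimes>\<^bsub>B\<^esub> ((r \<otimes>\<^bsub>A\<^esub> s) \<odot>\<^bsub>B\<^esub> m) = s \<odot>\<^bsub>B\<^esub> ((r \<odot>\<^bsub>B\<^esub> y) \<otimes>\<^bsub>B\<^esub> m)"
      unfolding A.m_comm[OF rs] using rs m y by (simp add: ys AB.smult_assoc2 AB.smult_assoc1)
    then show ?case
      using 1[OF prod(2) B0E(6)[OF N[OF prod(1)] m]] by simp
  next
    case (add r s)
    then show ?case
      using add m y P_add by (simp add: AB.smult_l_distr B.r_distr Tadd)
  qed
  have "Q (N + (c + n)) \<subseteq> {x \<in> B0. T (y \<otimes>\<^bsub>B\<^esub> x) \<in> P n}"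
  proof (rule Q_minimal)
    have "T \<zero>\<^bsub>B\<^esub> = \<zero>\<^bsub>A\<^esub>"
      using linear_maps_zero[OF AB.module_axioms A.regular_module_is_module T] by simp
    then show "\<zero>\<^bsub>B\<^esub> \<in> {x \<in> B0. T (y \<otimes>\<^bsub>B\<^esub> x) \<in> P n}"
      using y P_zero B0E(2) by simp
  next
    fix a x assume a: "a \<in> A0" and x: "x \<in> {x \<in> B0. T (y \<otimes>\<^bsub>B\<^esub> x) \<in> P n}"
    then have "T (y \<otimes>\<^bsub>B\<^esub> (a \<odot>\<^bsub>B\<^esub> x)) = T (y \<otimes>\<^bsub>B\<^esub> x) \<otimes>\<^bsub>A\<^esub> a"
      using y TA by (simp add: ys Tsmult A.m_comm)
    then show "a \<odot>\<^bsub>B\<^esub> x \<in> {x \<in> B0. T (y \<otimes>\<^bsub>B\<^esub> x) \<in> P n}"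
      using a x P_mult smult_B0 by simp
  next
    fix x x' assume "x \<in> {x \<in> B0. T (y \<otimes>\<^bsub>B\<^esub> x) \<in> P n}" "x' \<in> {x \<in> B0. T (y \<otimes>\<^bsub>B\<^esub> x) \<in> P n}"
    then show "x \<oplus>\<^bsub>B\<^esub> x' \<in> {x \<in> B0. T (y \<otimes>\<^bsub>B\<^esub> x) \<in> P n}"
      using y P_add B0E(7) by (simp add: B.r_distr Tadd)
  next
    fix t x assume "t \<in> P (N + (c + n))" "x \<in> B0"
    then show "t \<odot>\<^bsub>B\<^esub> x \<in> {x \<in> B0. T (y \<otimes>\<^bsub>B\<^esub> x) \<in> P n}"
      using 2 smult_B0 P_A0 by simp
  qed auto
  then show ?thesis
    using x by blast
qed

text \<open>The powers of \<open>I0\<close> decrease, so the maximum of the individual exponents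
  serves the whole finite set.\<close>

lemma colon_uniform:
  assumes "carrier B = (\<Union>n\<in>{1..}. module_colon B B0 (P n))" "finite X" "X \<subseteq> carrier B"
  shows "\<exists>N. \<forall>x\<in>X. \<forall>t\<in>P N. t \<odot>\<^bsub>B\<^esub> x \<in> B0"
  using assms(2,3)
proof (induction X rule: finite_induct)
  case (insert x X)
  then obtain N where N: "\<forall>x\<in>X. \<forall>t\<in>P N. t \<odot>\<^bsub>B\<^esub> x \<in> B0"
    by auto
  have "x \<in> (\<Union>n\<in>{1..}. module_colon B B0 (P n))"
    using insert.prems assms(1) by blast
  then obtain N' where N': "\<forall>t\<in>P N'. t \<odot>\<^bsub>B\<^esub> x \<in> B0"
    by (auto simp: module_colon_def)
  have "P (max N N') \<subseteq> P N" "P (max N N') \<subseteq> P N'"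
    by (intro R0.ideal_power_antimono[OF I0], simp)+
  then have "\<forall>x\<in>insert x X. \<forall>t\<in>P (max N N'). t \<odot>\<^bsub>B\<^esub> x \<in> B0"
    using N N' by auto
  then show ?case ..
qed simp

end

text \<open>What the topological argument retains of etaleness: a functional \<open>T\<close>, later
  the trace, whose finitely many coordinates \<open>T (y i \<otimes> b)\<close> determine
  \<open>b\<close> through \<open>expand\<close>.\<close>

locale adic_reconstruction = adic_subalgebra A B A0 I0 B0
  for A :: "('a, 'm) ring_scheme" and B :: "('a, 'b, 'k) module_scheme"
    and A0 I0 :: "'a set" and B0 :: "'b set" +
  fixes T :: "'b \<Rightarrow> 'a" and p N c :: nat and x y :: "nat \<Rightarrow> 'b"
  assumes T: "T \<in> linear_maps A B (regular_module A)"
    and Tc: "\<lbrakk>t \<in> P c; m \<in> B0\<rbrakk> \<Longrightarrow> T (t \<odot>\<^bsub>B\<^esub> m) \<in> A0"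
    and x: "i < p \<Longrightarrow> x i \<in> carrier B" and y: "i < p \<Longrightarrow> y i \<in> carrier B"
    and xN: "\<lbrakk>i < p; t \<in> P N\<rbrakk> \<Longrightarrow> t \<odot>\<^bsub>B\<^esub> x i \<in> B0" and yN: "\<lbrakk>i < p; t \<in> P N\<rbrakk> \<Longrightarrow> t \<odot>\<^bsub>B\<^esub> y i \<in> B0"
    and expand: "b \<in> carrier B \<Longrightarrow> (\<Oplus>\<^bsub>B\<^esub>i\<in>{..<p}. T (y i \<otimes>\<^bsub>B\<^esub> b) \<odot>\<^bsub>B\<^esub> x i) = b"
begin

lemma T_Q: "\<lbrakk>i < p; b \<in> Q (N + (c + n))\<rbrakk> \<Longrightarrow> T (y i \<otimes>\<^bsub>B\<^esub> b) \<in> P n"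
  using functional_Q[OF T Tc y yN] .

lemma T_diff:
  assumes "i < p" "b \<in> carrier B" "b' \<in> carrier B"
  shows "T (y i \<otimes>\<^bsub>B\<^esub> (b \<ominus>\<^bsub>B\<^esub> b')) = T (y i \<otimes>\<^bsub>B\<^esub> b) \<ominus>\<^bsub>A\<^esub> T (y i \<otimes>\<^bsub>B\<^esub> b')"
proof -
  have "\<ominus>\<^bsub>regular_module A\<^esub> a = \<ominus>\<^bsub>A\<^esub> a" for a
    by (simp add: a_inv_def m_inv_def)
  then show ?thesis
    using assms y linear_mapsD(2)[OF T]
      linear_maps_minus[OF AB.module_axioms A.regular_module_is_module T]
    by (simp add: a_minus_def B.r_distr B.r_minus)
qed

text \<open>The coordinates of an element of all \<open>Q n\<close> lie in all powers of
  \<open>I0\<close>, the shift by \<open>N + c\<close> being absorbed; so they vanish, and with them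
  the element.\<close>

theorem separated:
  assumes "adically_separated R0 I0 (regular_module R0)"
  shows "adically_separated R0 I0 M0"
proof -
  have sep: "(\<Inter>n\<in>{1..}. P n) = {\<zero>\<^bsub>A\<^esub>}"
    using assms by (simp add: adically_separated_def R0.ideal_power_smult_regular[OF I0])
  have "b = \<zero>\<^bsub>B\<^esub>" if b: "b \<in> (\<Inter>n\<in>{1..}. Q n)" for b
  proof -
    have bQ: "b \<in> Q n" if "n \<ge> 1" for n
      using b that by blast
    have bB: "b \<in> carrier B"
      using Q_B0[OF bQ[OF order.refl]] by simp
    have "T (y i \<otimes>\<^bsub>B\<^esub> b) = \<zero>\<^bsub>A\<^esub>" if i: "i < p" for i
    proof -
      have "T (y i \<otimes>\<^bsub>B\<^esub> b) \<in> P n" if "n \<ge> 1" for n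
        using that by (intro T_Q[OF i] bQ) simp
      then have "T (y i \<otimes>\<^bsub>B\<^esub> b) \<in> (\<Inter>n\<in>{1..}. P n)"
        by blast
      then show ?thesis
        unfolding sep by simp
    qed
    then have "(\<Oplus>\<^bsub>B\<^esub>i\<in>{..<p}. T (y i \<otimes>\<^bsub>B\<^esub> b) \<odot>\<^bsub>B\<^esub> x i) = (\<Oplus>\<^bsub>B\<^esub>i\<in>{..<p}. \<zero>\<^bsub>B\<^esub>)"
      using x by (intro B.finsum_cong') auto
    then show ?thesis
      using expand[OF bB] by simp
  qed
  then have "(\<Inter>n\<in>{1..}. Q n) = {\<zero>\<^bsub>B\<^esub>}"
    using Q_zero by auto
  then show ?thesis
    by (simp add: adically_separated_def)
qed

text \<open>Limits are taken coordinatewise in \<open>A0\<close> and recombined with the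
  \<open>x i\<close>. Both the membership of the coordinates in \<open>A0\<close> and that of the
  recombined limit in \<open>B0\<close> require an argument.\<close>

theorem complete:
  assumes "adically_complete R0 I0 (regular_module R0)"
  shows "adically_complete R0 I0 M0"
  unfolding adically_complete_def
proof (intro allI impI)
  fix s :: "nat \<Rightarrow> 'b"
  assume s_asm: "range s \<subseteq> carrier M0 \<and> adically_Cauchy R0 I0 M0 s"
  then have s: "s k \<in> B0" for k
    by auto
  have Cauchy: "\<exists>k. \<forall>i\<ge>k. \<forall>j\<ge>k. s i \<ominus>\<^bsub>B\<^esub> s j \<in> Q n" if "n \<ge> 1" for n
    using s_asm that s by (auto simp: adically_Cauchy_def minus_M0)
  \<comment> \<open>At this depth \<open>T_Q\<close> puts the coordinates of differences into
    \<open>P 1\<close>, in particular into \<open>A0\<close>.\<close>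
  obtain K where K: "\<And>i j. \<lbrakk>i \<ge> K; j \<ge> K\<rbrakk> \<Longrightarrow> s i \<ominus>\<^bsub>B\<^esub> s j \<in> Q (N + (c + 1))"
    using Cauchy[of "N + (c + 1)"] by auto
  \<comment> \<open>The coordinates of \<open>s k\<close> itself may lie outside \<open>A0\<close>;
    after translation by \<open>s K\<close> they lie inside.\<close>
  define r where "r k = s (k + K) \<ominus>\<^bsub>B\<^esub> s K" for k
  define a where "a i k = T (y i \<otimes>\<^bsub>B\<^esub> r k)" for i k
  have r: "r k \<in> B0" for k
    unfolding r_def by (rule Q_B0[OF K]) simp_all
  have r_diff: "r k \<ominus>\<^bsub>B\<^esub> r l = s (k + K) \<ominus>\<^bsub>B\<^esub> s (l + K)" for k l
  proof -
    have "s (k + K) \<in> carrier B" "s (l + K) \<in> carrier B" "s K \<in> carrier B"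
      using s by auto
    then show ?thesis
      unfolding r_def by (rule B.minus_identities(1))
  qed
  have a_A0: "a i k \<in> A0" if "i < p" for i k
    unfolding a_def r_def by (rule P_A0[OF T_Q[OF that K]]) simp_all
  have "\<exists>\<alpha>\<in>A0. \<forall>n\<ge>1. \<exists>k. \<forall>l\<ge>k. a i l \<ominus>\<^bsub>A\<^esub> \<alpha> \<in> P n" if i: "i < p" for i
  proof -
    \<comment> \<open>Passing to coordinates costs \<open>N + c\<close> powers, so depth
      \<open>n\<close> here requires depth \<open>N + (c + n)\<close> for \<open>s\<close>.\<close>
    have "adically_Cauchy R0 I0 (regular_module R0) (a i)"
      unfolding adically_Cauchy_def R0.ideal_power_smult_regular[OF I0]
    proof (intro allI impI)
      fix n :: nat assume "n \<ge> 1"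
      then obtain k where k: "\<And>j l. \<lbrakk>j \<ge> k; l \<ge> k\<rbrakk> \<Longrightarrow> s j \<ominus>\<^bsub>B\<^esub> s l \<in> Q (N + (c + n))"
        using Cauchy[of "N + (c + n)"] by auto
      have "a i j \<ominus>\<^bsub>regular_module R0\<^esub> a i l \<in> P n" if "j \<ge> k" "l \<ge> k" for j l
      proof -
        have "a i j \<ominus>\<^bsub>A\<^esub> a i l = T (y i \<otimes>\<^bsub>B\<^esub> (r j \<ominus>\<^bsub>B\<^esub> r l))"
          unfolding a_def using r i by (simp add: T_diff)
        also have "\<dots> \<in> P n"
          unfolding r_diff using that by (intro T_Q[OF i] k) simp_all
        finally show ?thesis
          using a_A0[OF i] by (simp add: minus_regular)
      qed
      then show "\<exists>k. \<forall>j\<ge>k. \<forall>l\<ge>k. a i j \<ominus>\<^bsub>regular_module R0\<^esub> a i l \<in> P n"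
        by blast
    qed
    moreover have "range (a i) \<subseteq> carrier (regular_module R0)"
      using a_A0[OF i] by auto
    ultimately obtain \<alpha> where \<alpha>: "\<alpha> \<in> carrier (regular_module R0)"
      "adically_converges R0 I0 (regular_module R0) (a i) \<alpha>"
      using assms unfolding adically_complete_def by blast
    then show ?thesis
      using a_A0[OF i]
      by (intro bexI[of _ \<alpha>])
        (simp_all add: adically_converges_def R0.ideal_power_smult_regular[OF I0] minus_regular)
  qed
  then have "\<forall>i. \<exists>\<alpha>. i < p \<longrightarrow> \<alpha> \<in> A0 \<and> (\<forall>n\<ge>1. \<exists>k. \<forall>l\<ge>k. a i l \<ominus>\<^bsub>A\<^esub> \<alpha> \<in> P n)"
    by blast
  then obtain \<alpha> where \<alpha>': "\<forall>i. i < p \<longrightarrow> \<alpha> i \<in> A0 \<and> (\<forall>n\<ge>1. \<exists>k. \<forall>l\<ge>k. a i l \<ominus>\<^bsub>A\<^esub> \<alpha> i \<in> P n)"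
    by (rule choice[THEN exE])
  then have \<alpha>: "\<alpha> i \<in> A0" if "i < p" for i
    using that by blast
  \<comment> \<open>So far this is an element of \<open>B\<close> only, since the \<open>x i\<close>
    need not lie in \<open>B0\<close>.\<close>
  define b where "b = (\<Oplus>\<^bsub>B\<^esub>i\<in>{..<p}. \<alpha> i \<odot>\<^bsub>B\<^esub> x i)"
  have b: "b \<in> carrier B"
    unfolding b_def using \<alpha> x by (intro B.finsum_closed) auto
  have conv: "\<exists>k. \<forall>l\<ge>k. r l \<ominus>\<^bsub>B\<^esub> b \<in> Q n" if n: "n \<ge> 1" for n
  proof -
    \<comment> \<open>The additional \<open>N\<close> is consumed by \<open>Q_smult\<close> in
      moving \<open>x i\<close> into \<open>B0\<close>.\<close>
    have "\<forall>i. \<exists>k. i < p \<longrightarrow> (\<forall>l\<ge>k. a i l \<ominus>\<^bsub>A\<^esub> \<alpha> i \<in> P (N + n))"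
      using \<alpha>' n by (metis trans_le_add2)
    then obtain k where k: "\<forall>i. i < p \<longrightarrow> (\<forall>l\<ge>k i. a i l \<ominus>\<^bsub>A\<^esub> \<alpha> i \<in> P (N + n))"
      by (rule choice[THEN exE])
    \<comment> \<open>The maximum is taken over finitely many coordinates. For \<open>p = 0\<close>
      its value is unspecified, but then no index is compared with it.\<close>
    have "r l \<ominus>\<^bsub>B\<^esub> b \<in> Q n" if l: "l \<ge> Max (k ` {..<p})" for l
    proof -
      have aA: "a i l \<in> carrier A" "\<alpha> i \<in> carrier A" if "i < p" for i
        using a_A0[OF that] \<alpha>[OF that] by auto
      have "(\<Oplus>\<^bsub>B\<^esub>i\<in>{..<p}. (a i l \<ominus>\<^bsub>A\<^esub> \<alpha> i) \<odot>\<^bsub>B\<^esub> x i) \<oplus>\<^bsub>B\<^esub> b =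
          (\<Oplus>\<^bsub>B\<^esub>i\<in>{..<p}. (a i l \<ominus>\<^bsub>A\<^esub> \<alpha> i) \<odot>\<^bsub>B\<^esub> x i \<oplus>\<^bsub>B\<^esub> \<alpha> i \<odot>\<^bsub>B\<^esub> x i)"
        unfolding b_def using aA x by (intro B.finsum_addf[symmetric]) auto
      also have "\<dots> = (\<Oplus>\<^bsub>B\<^esub>i\<in>{..<p}. a i l \<odot>\<^bsub>B\<^esub> x i)"
      proof (rule B.finsum_cong')
        fix i assume "i \<in> {..<p}"
        then have i: "i < p" by simp
        have "(a i l \<ominus>\<^bsub>A\<^esub> \<alpha> i) \<oplus>\<^bsub>A\<^esub> \<alpha> i = a i l"
          using aA[OF i] by (simp add: A.minus_identities(2))
        then show "(a i l \<ominus>\<^bsub>A\<^esub> \<alpha> i) \<odot>\<^bsub>B\<^esub> x i \<oplus>\<^bsub>B\<^esub> \<alpha> i \<odot>\<^bsub>B\<^esub> x i = a i l \<odot>\<^bsub>B\<^esub> x i"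
          using aA[OF i] x[OF i] AB.smult_l_distr[of "a i l \<ominus>\<^bsub>A\<^esub> \<alpha> i" "\<alpha> i" "x i"] by simp
      qed (use aA x in auto)
      also have "\<dots> = r l"
        unfolding a_def using r by (intro expand) simp
      finally have eq: "(\<Oplus>\<^bsub>B\<^esub>i\<in>{..<p}. (a i l \<ominus>\<^bsub>A\<^esub> \<alpha> i) \<odot>\<^bsub>B\<^esub> x i) \<oplus>\<^bsub>B\<^esub> b = r l" .
      have Qn: "(\<Oplus>\<^bsub>B\<^esub>i\<in>{..<p}. (a i l \<ominus>\<^bsub>A\<^esub> \<alpha> i) \<odot>\<^bsub>B\<^esub> x i) \<in> Q n"
      proof (rule Q_finsum)
        fix i assume "i \<in> {..<p}"
        then have i: "i < p" by simp
        then have "k i \<le> l"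
          using l by (meson Max_ge finite_imageI finite_lessThan image_eqI lessThan_iff order_trans)
        then show "(a i l \<ominus>\<^bsub>A\<^esub> \<alpha> i) \<odot>\<^bsub>B\<^esub> x i \<in> Q n"
          using k i x[OF i] xN[OF i] by (intro Q_smult) auto
      qed simp
      have "r l \<ominus>\<^bsub>B\<^esub> b = (\<Oplus>\<^bsub>B\<^esub>i\<in>{..<p}. (a i l \<ominus>\<^bsub>A\<^esub> \<alpha> i) \<odot>\<^bsub>B\<^esub> x i)"
        unfolding eq[symmetric] using B0_carrier[OF Q_B0[OF Qn]] b by (rule B.minus_identities(3)[OF _ _ b])
      then show ?thesis
        using Qn by simp
    qed
    then show ?thesis
      by blast
  qed
  \<comment> \<open>A single term suffices: both \<open>r l\<close> and \<open>r l - b\<close> lie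
    in \<open>B0\<close>, the latter because \<open>Q 1\<close> is contained in
    \<open>B0\<close>.\<close>
  have "b \<in> B0"
  proof -
    obtain l where "r l \<ominus>\<^bsub>B\<^esub> b \<in> Q 1"
      using conv[of 1] by auto
    then have "r l \<ominus>\<^bsub>B\<^esub> b \<in> B0"
      by (rule Q_B0)
    then have "r l \<oplus>\<^bsub>B\<^esub> \<ominus>\<^bsub>B\<^esub> (r l \<ominus>\<^bsub>B\<^esub> b) \<in> B0"
      using r B0E(5,7) by blast
    moreover have "r l \<oplus>\<^bsub>B\<^esub> \<ominus>\<^bsub>B\<^esub> (r l \<ominus>\<^bsub>B\<^esub> b) = b"
      by (rule B.minus_identities(4)[OF B0_carrier[OF r] b b])
    ultimately show ?thesis
      by simp
  qed
  show "\<exists>x\<in>carrier M0. adically_converges R0 I0 M0 s x"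
  proof
    \<comment> \<open>Adding \<open>s K\<close> undoes the translation.\<close>
    show z: "s K \<oplus>\<^bsub>B\<^esub> b \<in> carrier M0"
      using s \<open>b \<in> B0\<close> B0E(7) by simp
    show "adically_converges R0 I0 M0 s (s K \<oplus>\<^bsub>B\<^esub> b)"
      unfolding adically_converges_def
    proof (intro allI impI)
      fix n :: nat assume "n \<ge> 1"
      then obtain k where k: "\<And>l. l \<ge> k \<Longrightarrow> r l \<ominus>\<^bsub>B\<^esub> b \<in> Q n"
        using conv by blast
      have "s l \<ominus>\<^bsub>M0\<^esub> (s K \<oplus>\<^bsub>B\<^esub> b) \<in> Q n" if "l \<ge> k + K" for l
      proof -
        have "s l \<in> carrier B" "s K \<in> carrier B"
          using s by auto
        then have "s l \<ominus>\<^bsub>B\<^esub> (s K \<oplus>\<^bsub>B\<^esub> b) = (s l \<ominus>\<^bsub>B\<^esub> s K) \<ominus>\<^bsub>B\<^esub> b"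
          using b by (rule B.minus_identities(5))
        also have "\<dots> = r (l - K) \<ominus>\<^bsub>B\<^esub> b"
          using that by (simp add: r_def)
        also have "\<dots> \<in> Q n"
          using that by (intro k) simp
        finally show ?thesis
          using z s by (simp add: minus_M0)
      qed
      then show "\<exists>k. \<forall>i\<ge>k. s i \<ominus>\<^bsub>M0\<^esub> (s K \<oplus>\<^bsub>B\<^esub> b) \<in> Q n"
        by blast
    qed
  qed
qed

end

theorem theorem1:
  fixes A :: "('a, 'm) ring_scheme" and B :: "('a, 'b, 'k) module_scheme"
    and A0 I0 :: "'a set" and B0 :: "'b set" and c :: nat
  assumes "cring A"
    and "finite_etale A B"
    and "subring A0 A"
    and "ideal I0 (A\<lparr>carrier := A0\<rparr>)"
    and "subring B0 B"
    and "\<forall>a \<in> A0. \<forall>x \<in> B0. a \<odot>\<^bsub>B\<^esub> x \<in> B0"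
    and "carrier B = (\<Union>n\<in>{1..}. module_colon B B0 (ideal_power (A\<lparr>carrier := A0\<rparr>) I0 n))"
    and "c > 0"
    and "\<forall>t \<in> ideal_power (A\<lparr>carrier := A0\<rparr>) I0 c. \<forall>m \<in> B0. algebra_trace A B (t \<odot>\<^bsub>B\<^esub> m) \<in> A0"
  shows "(adically_separated (A\<lparr>carrier := A0\<rparr>) I0 (regular_module (A\<lparr>carrier := A0\<rparr>)) \<longrightarrow>
            adically_separated (A\<lparr>carrier := A0\<rparr>) I0 (B\<lparr>carrier := B0\<rparr>)) \<and>
         (adically_complete (A\<lparr>carrier := A0\<rparr>) I0 (regular_module (A\<lparr>carrier := A0\<rparr>)) \<longrightarrow>
            adically_complete (A\<lparr>carrier := A0\<rparr>) I0 (B\<lparr>carrier := B0\<rparr>))"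
proof -
  have alg: "algebra A B" and fp: "finitely_presented_module A B" and flat: "flat_module A B"
    and unr: "formally_unramified A B"
    using assms(2) by (auto simp: finite_etale_def)
  obtain n e f where d: "dual_basis A B n e f"
    using flat_finitely_presented_dual_basis[OF algebra.module[OF alg] flat fp] by blast
  have op: "operator_ring A B"
    using alg by (rule operator_ring.intro)
  obtain p :: nat and x y where xy: "\<forall>i<p. x i \<in> carrier B \<and> y i \<in> carrier B"
    and expand: "\<forall>b\<in>carrier B. b = (\<Oplus>\<^bsub>B\<^esub>i\<in>{..<p}. algebra_trace A B (y i \<otimes>\<^bsub>B\<^esub> b) \<odot>\<^bsub>B\<^esub> x i)"
    using operator_ring.trace_reconstruction[OF op unr d] by (elim exE conjE)
  have sub: "adic_subalgebra A B A0 I0 B0"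
    using alg assms(3-6) by (intro adic_subalgebra.intro) blast+
  \<comment> \<open>One exponent \<open>N\<close> is wanted for all \<open>x i\<close> and all
    \<open>y i\<close>, so both families are treated as a single finite set.\<close>
  have "x ` {..<p} \<union> y ` {..<p} \<subseteq> carrier B"
    using xy by auto
  then obtain N where N: "\<forall>z\<in>x ` {..<p} \<union> y ` {..<p}. \<forall>t\<in>ideal_power (A\<lparr>carrier := A0\<rparr>) I0 N. t \<odot>\<^bsub>B\<^esub> z \<in> B0"
    using adic_subalgebra.colon_uniform[OF sub assms(7), of "x ` {..<p} \<union> y ` {..<p}"] by auto
  have "adic_reconstruction A B A0 I0 B0 (algebra_trace A B) p N c x y"
  proof (intro adic_reconstruction.intro sub adic_reconstruction_axioms.intro)
    show "algebra_trace A B \<in> linear_maps A B (regular_module A)"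
      using operator_ring.algebra_trace_linear[OF op d] .
    show "(\<Oplus>\<^bsub>B\<^esub>i\<in>{..<p}. algebra_trace A B (y i \<otimes>\<^bsub>B\<^esub> b) \<odot>\<^bsub>B\<^esub> x i) = b" if "b \<in> carrier B" for b
      using expand[rule_format, OF that] by (rule sym)
  qed (use assms(9) xy N in auto)
  then show ?thesis
    using adic_reconstruction.separated[of A B A0 I0 B0] adic_reconstruction.complete[of A B A0 I0 B0]
    by (intro conjI impI)
qed

end
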